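(* Let $I$ be a countable index set and let $\{\phi_{l}\}_{l\in I},\{\tilde\phi_{l}\}_{l\in I}\subseteq L^{2}(G)$. Assume that $\{T_{h}\phi_{l}\}_{h\in H,l\in I}$ and $\{T_{h}\tilde\phi_{l}\}_{h\in H,l\in I}$ are Bessel sequences, and let $\mathbb W=\overline{\mathrm{span}}\{T_{h}\phi_{l}\}_{h\in H,l\in I}$. Then the following are equivalent: (i) $f=\sum_{l\in I}\sum_{h\in H}\langle f,T_{h}\tilde\phi_{l}\rangle T_{h}\phi_{l}$ for all $f\in\mathbb W$. (ii) For all $n\in I$, $$\hat\phi_{n}(\omega)=\sum_{l\in I}\hat\phi_{l}(\omega)\Big(\sum_{h\in H^{\perp}}\hat\phi_{n}(\omega\oplus h)\overline{\hat{\tilde\phi}_{l}(\omega\oplus h)}\Big)$$ holds for a.e. $\omega\in G^{*}$.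
   Context: Let $p\ge 2$ be an integer. The Vilenkin group $G$ is the set of sequences $x=(x_j)_{j\in\mathbb Z}$ with $x_j\in\{0,\dots,p-1\}$ for which there is $k=k(x)$ with $x_j=0$ for all $j<k$; the operation $\oplus$ is coordinatewise addition modulo $p$, $\ominus$ is the inverse operation, and the topology is generated by the neighbourhoods of zero $U_l=\{x\in G:x_j=0\text{ for }j\le l\}$, $l\in\mathbb Z$. Put $U=U_0$; the Haar measure $\mu$ is normalized by $\mu(U)=1$. The dual group $G^{*}$ consists of sequences $\omega=(\omega_j)$ of the same form, with analogous operations, neighbourhoods $U_l^{*}$, set $U^{*}=U_0^{*}$, and Haar measure $\mu^{*}$ with $\mu^{*}(U^{*})=1$; the pairing is $\chi(x,\omega)=\exp\big(\frac{2\pi i}{p}\sum_{j\in\mathbb Z}x_j\omega_{1-j}\big)$. Let $H=\{x\in G:x_j=0\text{ for }j>0\}$ (a countable discrete subgroup), whose annihilator is $H^{\perp}=\{\omega\in G^{*}:\omega_j=0\text{ for }j>0\}$. For $h\in H$, $T_hf(x)=f(x\ominus h)$. The Fourier transform is $\hat f(\omega)=\int_G f(x)\overline{\chi(x,\omega)}\,d\mu(x)$, extended to a unitary map $L^2(G)\to L^2(G^{*})$. A sequence $\{f_j\}_{j\in J}$ in a Hilbert space $\mathcal H$ is a Bessel sequence if there is $B>0$ with $\sum_{j}|\langle f,f_j\rangle|^2\le B\|f\|^2$ for all $f\in\mathcal H$ (here $\mathcal H=L^2(G)$). The closed span is taken in $L^2(G)$, and series of translates converge in $L^2(G)$. *)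

theory Defs
  imports "HOL-Analysis.Analysis"
begin

text \<open>
  The group \<open>G\<close> and its dual \<open>G\<^sup>*\<close> consist of digit sequences of the same form, with the same
  operation and the same neighbourhoods of zero, so both are modelled by the carrier
  \<open>vilenkin p\<close>. They are distinguished only by their role in the pairing \<open>vchar\<close> and by carrying
  separate Haar measures.
\<close>

type_synonym digits = "int \<Rightarrow> nat"

definition vilenkin :: "nat \<Rightarrow> digits set" where
  "vilenkin p = {x. (\<forall>j. x j < p) \<and> (\<exists>k. \<forall>j<k. x j = 0)}"

definition vplus :: "nat \<Rightarrow> digits \<Rightarrow> digits \<Rightarrow> digits" where
  "vplus p x y = (\<lambda>j. (x j + y j) mod p)"

definition vneg :: "nat \<Rightarrow> digits \<Rightarrow> digits" where
  "vneg p x = (\<lambda>j. (p - x j) mod p)"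

definition vminus :: "nat \<Rightarrow> digits \<Rightarrow> digits \<Rightarrow> digits" where
  "vminus p x y = vplus p x (vneg p y)"

definition vnbhd :: "nat \<Rightarrow> int \<Rightarrow> digits set" where
  "vnbhd p l = {x \<in> vilenkin p. \<forall>j\<le>l. x j = 0}"

definition vtopology :: "nat \<Rightarrow> digits topology" where
  "vtopology p = topology_generated_by {vplus p x ` vnbhd p l | x l. x \<in> vilenkin p}"

text \<open>
  The subgroup \<open>H\<close> of \<open>G\<close>. Its annihilator in \<open>G\<^sup>*\<close> is given by the same condition on digits;
  see \<open>vHperp_eq_annihilator\<close> below.
\<close>

definition vH :: "nat \<Rightarrow> digits set" where
  "vH p = {x \<in> vilenkin p. \<forall>j>0. x j = 0}"

definition vHperp :: "nat \<Rightarrow> digits set" where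
  "vHperp p = {w \<in> vilenkin p. \<forall>j>0. w j = 0}"

text \<open>
  For \<open>x\<close>, \<open>w\<close> in \<open>vilenkin p\<close> only finitely many terms of the sum over all integers are nonzero;
  the summation is restricted to these.
\<close>

definition vchar :: "nat \<Rightarrow> digits \<Rightarrow> digits \<Rightarrow> complex" where
  "vchar p x w =
     exp (2 * of_real pi * \<i> / of_nat p * of_nat (\<Sum>j | x j * w (1 - j) \<noteq> 0. x j * w (1 - j)))"

definition vtranslate :: "nat \<Rightarrow> digits \<Rightarrow> (digits \<Rightarrow> complex) \<Rightarrow> digits \<Rightarrow> complex" where
  "vtranslate p h f = (\<lambda>x. f (vminus p x h))"

text \<open>
  Normalized Haar measure, as a Borel measure. Regularity is not listed because it is automatic:
  the group is locally compact and second countable.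
\<close>

definition vhaar :: "nat \<Rightarrow> digits measure \<Rightarrow> bool" where
  "vhaar p M \<longleftrightarrow>
     space M = vilenkin p \<and>
     sets M = sigma_sets (vilenkin p) {S. openin (vtopology p) S} \<and>
     (\<forall>x\<in>vilenkin p. \<forall>A\<in>sets M. emeasure M (vplus p x ` A) = emeasure M A) \<and>
     (\<forall>K. compactin (vtopology p) K \<longrightarrow> emeasure M K < \<infinity>) \<and>
     emeasure M (vnbhd p 0) = 1"

text \<open>
  Elements are represented by functions rather than by classes modulo null sets. All the notions
  below depend only on the class.
\<close>

definition L2 :: "'a measure \<Rightarrow> ('a \<Rightarrow> complex) set" where
  "L2 M = {f \<in> borel_measurable M. integrable M (\<lambda>x. (cmod (f x))\<^sup>2)}"

definition L2_inner :: "'a measure \<Rightarrow> ('a \<Rightarrow> complex) \<Rightarrow> ('a \<Rightarrow> complex) \<Rightarrow> complex" where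
  "L2_inner M f g = (\<integral>x. f x * cnj (g x) \<partial>M)"

definition L2_norm :: "'a measure \<Rightarrow> ('a \<Rightarrow> complex) \<Rightarrow> real" where
  "L2_norm M f = sqrt (\<integral>x. (cmod (f x))\<^sup>2 \<partial>M)"

text \<open>
  Unordered (unconditional) convergence of a series in \<open>L2 M\<close>. The membership conditions matter:
  a Bochner integral that does not exist is \<open>0\<close>, so \<open>L2_norm\<close> is meaningful on \<open>L2 M\<close> only.
\<close>

definition L2_has_sum ::
    "'a measure \<Rightarrow> ('j \<Rightarrow> 'a \<Rightarrow> complex) \<Rightarrow> 'j set \<Rightarrow> ('a \<Rightarrow> complex) \<Rightarrow> bool" where
  "L2_has_sum M F J s \<longleftrightarrow>
     (\<forall>j\<in>J. F j \<in> L2 M) \<and> s \<in> L2 M \<and>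
     ((\<lambda>E. L2_norm M (\<lambda>x. s x - (\<Sum>j\<in>E. F j x))) \<longlongrightarrow> 0) (finite_subsets_at_top J)"

definition L2_bessel :: "'a measure \<Rightarrow> ('j \<Rightarrow> 'a \<Rightarrow> complex) \<Rightarrow> 'j set \<Rightarrow> bool" where
  "L2_bessel M F J \<longleftrightarrow>
     (\<forall>j\<in>J. F j \<in> L2 M) \<and>
     (\<exists>B>0. \<forall>f\<in>L2 M.
        (\<lambda>j. (cmod (L2_inner M f (F j)))\<^sup>2) summable_on J \<and>
        (\<Sum>\<^sub>\<infinity>j\<in>J. (cmod (L2_inner M f (F j)))\<^sup>2) \<le> B * (L2_norm M f)\<^sup>2)"

definition L2_span :: "('j \<Rightarrow> 'a \<Rightarrow> complex) \<Rightarrow> 'j set \<Rightarrow> ('a \<Rightarrow> complex) set" where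
  "L2_span F J = {(\<lambda>x. \<Sum>j\<in>E. c j * F j x) | E c. finite E \<and> E \<subseteq> J}"

definition L2_closed_span ::
    "'a measure \<Rightarrow> ('j \<Rightarrow> 'a \<Rightarrow> complex) \<Rightarrow> 'j set \<Rightarrow> ('a \<Rightarrow> complex) set" where
  "L2_closed_span M F J =
     {f \<in> L2 M. \<forall>e>0. \<exists>g \<in> L2_span F J. L2_norm M (\<lambda>x. f x - g x) < e}"

definition vfourier_L1 ::
    "nat \<Rightarrow> digits measure \<Rightarrow> (digits \<Rightarrow> complex) \<Rightarrow> digits \<Rightarrow> complex" where
  "vfourier_L1 p \<mu> f w = (\<integral>x. f x * cnj (vchar p x w) \<partial>\<mu>)"

text \<open>
  The extension of the Fourier integral by continuity from \<open>L\<^sup>1 \<inter> L\<^sup>2\<close> to \<open>L\<^sup>2\<close>: \<open>g\<close> is the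
  transform of \<open>f\<close> if some sequence in \<open>L\<^sup>1 \<inter> L\<^sup>2\<close> tends to \<open>f\<close> while its Fourier integrals tend
  to \<open>g\<close>, in the respective \<open>L\<^sup>2\<close> norms. By Plancherel's theorem such a \<open>g\<close> exists for each \<open>f\<close> in
  \<open>L\<^sup>2\<close>, is unique up to a null set, and the resulting map is unitary; \<open>vfourier\<close> picks a
  representative.
\<close>

definition is_vfourier ::
    "nat \<Rightarrow> digits measure \<Rightarrow> digits measure \<Rightarrow> (digits \<Rightarrow> complex) \<Rightarrow> (digits \<Rightarrow> complex) \<Rightarrow> bool" where
  "is_vfourier p \<mu> \<mu>' f g \<longleftrightarrow>
     f \<in> L2 \<mu> \<and> g \<in> L2 \<mu>' \<and>
     (\<exists>s :: nat \<Rightarrow> digits \<Rightarrow> complex.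
        (\<forall>n. s n \<in> L2 \<mu> \<and> integrable \<mu> (s n) \<and> vfourier_L1 p \<mu> (s n) \<in> L2 \<mu>') \<and>
        (\<lambda>n. L2_norm \<mu> (\<lambda>x. s n x - f x)) \<longlonglongrightarrow> 0 \<and>
        (\<lambda>n. L2_norm \<mu>' (\<lambda>w. vfourier_L1 p \<mu> (s n) w - g w)) \<longlonglongrightarrow> 0)"

definition vfourier ::
    "nat \<Rightarrow> digits measure \<Rightarrow> digits measure \<Rightarrow> (digits \<Rightarrow> complex) \<Rightarrow> digits \<Rightarrow> complex" where
  "vfourier p \<mu> \<mu>' f = (SOME g. is_vfourier p \<mu> \<mu>' f g)"

lemma vHperp_eq_annihilator:
  assumes "p \<ge> 2"
  shows "vHperp p = {w \<in> vilenkin p. \<forall>h\<in>vH p. vchar p h w = 1}"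
proof (intro set_eqI iffI)
  fix w assume w: "w \<in> vHperp p"
  have "vchar p h w = 1" if h: "h \<in> vH p" for h
  proof -
    have "h j * w (1 - j) = 0" for j
      using w h by (cases "j > 0") (auto simp: vHperp_def vH_def)
    then show ?thesis by (simp add: vchar_def)
  qed
  then show "w \<in> {w \<in> vilenkin p. \<forall>h\<in>vH p. vchar p h w = 1}"
    using w by (simp add: vHperp_def)
next
  fix w assume "w \<in> {w \<in> vilenkin p. \<forall>h\<in>vH p. vchar p h w = 1}"
  then have w: "w \<in> vilenkin p" and ann: "\<And>h. h \<in> vH p \<Longrightarrow> vchar p h w = 1"
    by auto
  have "w j = 0" if "j > 0" for j
  proof (rule ccontr)
    assume nz: "w j \<noteq> 0"
    define h :: digits where "h = (\<lambda>i. if i = 1 - j then 1 else 0)"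
    have "h \<in> vH p"
      using assms that by (auto simp: vH_def vilenkin_def h_def intro!: exI[of _ "1 - j"])
    then have 1: "vchar p h w = 1" by (rule ann)
    have "{i. h i * w (1 - i) \<noteq> 0} = {1 - j}" using nz by (auto simp: h_def)
    then have "vchar p h w = exp (2 * of_real pi * \<i> / of_nat p * of_nat (w j))"
      by (simp add: vchar_def h_def)
    also have "\<dots> = exp (2 * of_real pi * \<i> * of_nat (w j) / of_nat p)"
      by simp
    finally have "p dvd w j"
      using 1 complex_root_unity_eq_1[of p "w j"] assms by simp
    moreover have "w j < p" using w by (simp add: vilenkin_def)
    ultimately show False using nz by (auto dest: dvd_imp_le)
  qed
  then show "w \<in> vHperp p" using w by (simp add: vHperp_def)
qed

end

theory Submission
  imports Defs
begin

text \<open>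
  On the Fourier side, translation by \<open>h \<in> H\<close> is multiplication by \<open>cnj (\<chi> h)\<close>, and \<open>\<chi> h\<close> is constant
  along the cosets of the annihilator of \<open>H\<close>. Folding the integral that computes
  \<open>\<langle>f, T\<^sub>h \<phi>'\<^sub>l\<rangle>\<close> along these cosets therefore exhibits it as the \<open>h\<close>-th Fourier coefficient, over the
  compact group \<open>U\<^sup>*\<close>, of the periodic function \<open>[f, \<phi>'\<^sub>l]\<close> (\<open>bracket\<close> below) whose value at \<open>\<omega>\<close> is the
  sum over \<open>h \<in> H\<^sup>\<bottom>\<close> of the transform of \<open>f\<close> times the conjugate transform of \<open>\<phi>'\<^sub>l\<close> at \<open>\<omega> \<oplus> h\<close>. Parseval's
  identity on each coset of \<open>U\<^sup>*\<close>, summed over \<open>l\<close>, then says that the operator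
  \<open>S f = \<Sum>\<^sub>l \<Sum>\<^sub>h \<langle>f, T\<^sub>h \<phi>'\<^sub>l\<rangle> T\<^sub>h \<phi>\<^sub>l\<close> acts on transforms as the pointwise operator \<open>recon\<close>, which sends
  the transform of \<open>f\<close> to \<open>\<Sum>\<^sub>l \<Phi>\<^sub>l [f, \<phi>'\<^sub>l]\<close>. The pointwise identity of the theorem is thus exactly
  \<open>S \<phi>\<^sub>n = \<phi>\<^sub>n\<close>. One implication follows because \<open>\<phi>\<^sub>n\<close> lies in \<open>W\<close>; for the other, \<open>recon\<close> commutes with
  multiplication by \<open>cnj (\<chi> k)\<close>, so \<open>S\<close> fixes every \<open>T\<^sub>k \<phi>\<^sub>n\<close>, and linearity and continuity
  extend this to the closed span.

  All identities are tested against one explicit orthonormal basis, the functions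
  \<open>e\<^sub>h\<^sub>k = 1\<^sub>U\<^sub>\<oplus>\<^sub>h \<chi>(\<cdot>, k)\<close> with \<open>h, k \<in> H\<close> (\<open>vbasis\<close>). The transform of \<open>e\<^sub>h\<^sub>k\<close> is again such a
  function up to conjugation and exchange of \<open>h\<close> and \<open>k\<close> (\<open>vdual\<close>), so an element of \<open>L\<^sup>2(G)\<close> and its transform
  have the same coefficients. This gives the existence of the transform and Plancherel's theorem
  (\<open>is_vfourier_exists\<close>, \<open>Plancherel\<close>). The basis is total even for functions that are only
  integrable on each coset of \<open>U\<close> (\<open>vbasis_total\<close>, \<open>vdual_total\<close>). That matters twice: the bracket is a priori
  only integrable on \<open>U\<^sup>*\<close> and is recognized as square integrable from its square summable
  coefficients (\<open>L2_if_vdual_coeffs_square_summable\<close>), and \<open>recon\<close> is identified almost everywhere by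
  its coefficients (\<open>recon_eq_iff\<close>).

  The analytic core is \<open>recon_coeff\<close>. The Bessel bound for the \<open>\<phi>'\<^sub>l\<close> makes the brackets square summable in
  \<open>l\<close>, the one for the \<open>\<phi>\<^sub>l\<close> does the same for the transforms \<open>\<Phi>\<^sub>l\<close> on every coset of \<open>U\<^sup>*\<close>, and the
  Cauchy--Schwarz inequality gives the absolute convergence that justifies exchanging sums and
  integrals. The convergence of the series in \<open>L\<^sup>2(G)\<close> itself follows from completeness of
  \<open>L\<^sup>2\<close> (\<open>L2_bessel_synthesis\<close>, \<open>L2_has_sum_iterated\<close>).
\<close>

section \<open>Square-integrable functions: inner product and completeness\<close>

lemma L2_measurable [measurable_dest]: "f \<in> L2 M \<Longrightarrow> f \<in> borel_measurable M"
  by (simp add: L2_def)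

lemma L2_integrable_sq: "f \<in> L2 M \<Longrightarrow> integrable M (\<lambda>x. (cmod (f x))\<^sup>2)"
  by (simp add: L2_def)

lemma borel_measurable_cnj [measurable (raw)]:
  "f \<in> borel_measurable M \<Longrightarrow> (\<lambda>x. cnj (f x)) \<in> borel_measurable M"
  by (rule measurable_compose[OF _ borel_measurable_continuous_onI[of cnj]]) (auto intro: continuous_intros)

lemma L2_iff_nn: "f \<in> L2 M \<longleftrightarrow> f \<in> borel_measurable M \<and> (\<integral>\<^sup>+x. ennreal ((cmod (f x))\<^sup>2) \<partial>M) < \<infinity>"
  by (auto simp: L2_def integrable_iff_bounded)

lemma L2_norm_nonneg [simp]: "0 \<le> L2_norm M f"
  by (simp add: L2_norm_def)

lemma L2_norm_sq: "(L2_norm M f)\<^sup>2 = (\<integral>x. (cmod (f x))\<^sup>2 \<partial>M)"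
  by (simp add: L2_norm_def)

lemma L2_norm_sq_nn:
  assumes "f \<in> L2 M"
  shows "ennreal ((L2_norm M f)\<^sup>2) = (\<integral>\<^sup>+x. ennreal ((cmod (f x))\<^sup>2) \<partial>M)"
  using assms by (simp add: L2_norm_sq nn_integral_eq_integral L2_def)

lemma L2_norm_cong_AE:
  assumes "f \<in> borel_measurable M" "g \<in> borel_measurable M" "AE x in M. f x = g x"
  shows "L2_norm M f = L2_norm M g"
  unfolding L2_norm_def using assms by (auto intro!: arg_cong[where f = sqrt] integral_cong_AE)

lemma L2_integrable_norm_mult:
  assumes f: "f \<in> L2 M" and g: "g \<in> L2 M"
  shows "integrable M (\<lambda>x. cmod (f x) * cmod (g x))"
proof (rule Bochner_Integration.integrable_bound)
  show "integrable M (\<lambda>x. (cmod (f x))\<^sup>2 + (cmod (g x))\<^sup>2)"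
    using f g by (intro Bochner_Integration.integrable_add L2_integrable_sq)
  show "(\<lambda>x. cmod (f x) * cmod (g x)) \<in> borel_measurable M"
    using f g by measurable
  have "a * b \<le> a\<^sup>2 + b\<^sup>2" if "a \<ge> 0" "b \<ge> 0" for a b :: real
    using sum_squares_bound[of a b] mult_nonneg_nonneg[OF that] by linarith
  then show "AE x in M. norm (cmod (f x) * cmod (g x)) \<le> norm ((cmod (f x))\<^sup>2 + (cmod (g x))\<^sup>2)"
    by (auto simp: norm_mult)
qed

lemma L2_integrable_mult:
  assumes f: "f \<in> L2 M" and g: "g \<in> L2 M"
  shows "integrable M (\<lambda>x. f x * cnj (g x))"
proof (rule Bochner_Integration.integrable_bound[OF L2_integrable_norm_mult[OF f g]])
  show "(\<lambda>x. f x * cnj (g x)) \<in> borel_measurable M" using f g by measurable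
qed (auto simp: norm_mult)

lemma L2_cmult:
  assumes "f \<in> L2 M" shows "(\<lambda>x. c * f x) \<in> L2 M"
proof -
  have [measurable]: "f \<in> borel_measurable M" using assms by (rule L2_measurable)
  show ?thesis using L2_integrable_sq[OF assms] by (simp add: L2_def norm_mult power_mult_distrib)
qed

lemma L2_add:
  assumes f: "f \<in> L2 M" and g: "g \<in> L2 M"
  shows "(\<lambda>x. f x + g x) \<in> L2 M"
proof -
  have [measurable]: "f \<in> borel_measurable M" "g \<in> borel_measurable M" using f g by auto
  have "integrable M (\<lambda>x. (cmod (f x + g x))\<^sup>2)"
  proof (rule Bochner_Integration.integrable_bound)
    show "integrable M (\<lambda>x. 2 * (cmod (f x))\<^sup>2 + 2 * (cmod (g x))\<^sup>2)"
      using f g by (intro Bochner_Integration.integrable_add integrable_mult_right L2_integrable_sq)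
    have "(cmod (a + b))\<^sup>2 \<le> 2 * (cmod a)\<^sup>2 + 2 * (cmod b)\<^sup>2" for a b
      using power_mono[OF norm_triangle_ineq[of a b], of 2] sum_squares_bound[of "cmod a" "cmod b"]
      by (simp add: power2_sum)
    then show "AE x in M. norm ((cmod (f x + g x))\<^sup>2) \<le> norm (2 * (cmod (f x))\<^sup>2 + 2 * (cmod (g x))\<^sup>2)"
      by auto
  qed measurable
  then show ?thesis by (simp add: L2_def)
qed

lemma L2_diff:
  assumes f: "f \<in> L2 M" and g: "g \<in> L2 M"
  shows "(\<lambda>x. f x - g x) \<in> L2 M"
  using L2_add[OF f L2_cmult[OF g, of "-1"]] by simp

lemma L2_zero: "(\<lambda>x. 0) \<in> L2 M"
  by (simp add: L2_def)

lemma L2_sum: "(\<And>j. j \<in> E \<Longrightarrow> F j \<in> L2 M) \<Longrightarrow> (\<lambda>x. \<Sum>j\<in>E. F j x) \<in> L2 M"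
  by (induction E rule: infinite_finite_induct) (auto intro: L2_zero L2_add)

lemma L2_lincomb: "(\<And>j. j \<in> E \<Longrightarrow> F j \<in> L2 M) \<Longrightarrow> (\<lambda>x. \<Sum>j\<in>E. c j * F j x) \<in> L2 M"
  by (rule L2_sum) (rule L2_cmult)

lemma L2_mult_bounded:
  assumes f: "f \<in> L2 M" and g: "g \<in> borel_measurable M" and bd: "\<And>x. cmod (g x) \<le> 1"
  shows "(\<lambda>x. f x * g x) \<in> L2 M"
proof -
  have [measurable]: "f \<in> borel_measurable M" "g \<in> borel_measurable M" using f g by auto
  have "integrable M (\<lambda>x. (cmod (f x * g x))\<^sup>2)"
  proof (rule Bochner_Integration.integrable_bound[OF L2_integrable_sq[OF f]])
    show "AE x in M. norm ((cmod (f x * g x))\<^sup>2) \<le> norm ((cmod (f x))\<^sup>2)"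
      using bd by (auto simp: norm_mult intro!: power_mono mult_left_le)
  qed measurable
  then show ?thesis by (simp add: L2_def)
qed

lemma L2_cnj: "f \<in> L2 M \<Longrightarrow> (\<lambda>x. cnj (f x)) \<in> L2 M"
  by (auto simp: L2_def)

lemma L2_inner_add_left:
  "f \<in> L2 M \<Longrightarrow> g \<in> L2 M \<Longrightarrow> u \<in> L2 M \<Longrightarrow>
    L2_inner M (\<lambda>x. f x + g x) u = L2_inner M f u + L2_inner M g u"
  by (simp add: L2_inner_def ring_distribs L2_integrable_mult)

lemma L2_inner_diff_left:
  "f \<in> L2 M \<Longrightarrow> g \<in> L2 M \<Longrightarrow> u \<in> L2 M \<Longrightarrow>
    L2_inner M (\<lambda>x. f x - g x) u = L2_inner M f u - L2_inner M g u"
  by (simp add: L2_inner_def ring_distribs L2_integrable_mult)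

lemma L2_inner_cmult_left: "L2_inner M (\<lambda>x. c * f x) u = c * L2_inner M f u"
  by (simp add: L2_inner_def mult.assoc)

lemma L2_inner_lincomb_left:
  assumes "\<And>j. j \<in> E \<Longrightarrow> F j \<in> L2 M" "u \<in> L2 M"
  shows "L2_inner M (\<lambda>x. \<Sum>j\<in>E. c j * F j x) u = (\<Sum>j\<in>E. c j * L2_inner M (F j) u)"
  unfolding L2_inner_def sum_distrib_right
  by (subst Bochner_Integration.integral_sum)
     (auto simp: mult.assoc intro!: assms L2_integrable_mult)

lemma L2_inner_commute: "L2_inner M g f = cnj (L2_inner M f g)"
proof -
  have "cnj (L2_inner M f g) = (\<integral>x. cnj (f x * cnj (g x)) \<partial>M)"
    unfolding L2_inner_def by (rule Bochner_Integration.integral_cnj[symmetric])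
  then show ?thesis by (simp add: L2_inner_def mult.commute)
qed

lemma L2_inner_self: "L2_inner M f f = of_real ((L2_norm M f)\<^sup>2)"
  unfolding L2_inner_def L2_norm_sq complex_norm_square[symmetric] of_real_power[symmetric]
  by (rule integral_complex_of_real)

lemma L2_Cauchy_Schwarz_abs:
  assumes f: "f \<in> L2 M" and g: "g \<in> L2 M"
  shows "(\<integral>x. cmod (f x) * cmod (g x) \<partial>M) \<le> L2_norm M f * L2_norm M g"
proof -
  have [measurable]: "f \<in> borel_measurable M" "g \<in> borel_measurable M" using f g by auto
  let ?I = "\<integral>x. cmod (f x) * cmod (g x) \<partial>M"
  have nn: "(\<integral>\<^sup>+x. ennreal (cmod (f x)) * ennreal (cmod (g x)) \<partial>M) = ennreal ?I"
    using nn_integral_eq_integral[OF L2_integrable_norm_mult[OF f g]] by (simp add: ennreal_mult)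
  have "(\<integral>\<^sup>+x. ennreal (cmod (f x)) * ennreal (cmod (g x)) \<partial>M)\<^sup>2
      \<le> (\<integral>\<^sup>+x. ennreal (cmod (f x)) ^ 2 \<partial>M) * (\<integral>\<^sup>+x. ennreal (cmod (g x)) ^ 2 \<partial>M)"
    by (rule Cauchy_Schwarz_nn_integral) measurable
  then have "ennreal (?I\<^sup>2) \<le> ennreal ((L2_norm M f * L2_norm M g)\<^sup>2)"
    unfolding nn using f g
    by (simp add: L2_norm_sq_nn[symmetric] ennreal_power ennreal_mult[symmetric] power_mult_distrib)
  then have "?I\<^sup>2 \<le> (L2_norm M f * L2_norm M g)\<^sup>2" by simp
  then show ?thesis by (rule power2_le_imp_le) simp
qed

lemma L2_Cauchy_Schwarz:
  assumes f: "f \<in> L2 M" and g: "g \<in> L2 M"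
  shows "cmod (L2_inner M f g) \<le> L2_norm M f * L2_norm M g"
proof -
  have "cmod (L2_inner M f g) \<le> (\<integral>x. cmod (f x * cnj (g x)) \<partial>M)"
    unfolding L2_inner_def by (rule integral_norm_bound)
  then show ?thesis using L2_Cauchy_Schwarz_abs[OF f g] by (simp add: norm_mult)
qed

lemma L2_norm_minus_commute: "L2_norm M (\<lambda>x. f x - g x) = L2_norm M (\<lambda>x. g x - f x)"
  by (simp add: L2_norm_def norm_minus_commute)

lemma L2_inner_add_right:
  assumes "f \<in> L2 M" "g \<in> L2 M" "u \<in> L2 M"
  shows "L2_inner M u (\<lambda>x. f x + g x) = L2_inner M u f + L2_inner M u g"
  using arg_cong[OF L2_inner_add_left[OF assms], of cnj]
  by (simp only: complex_cnj_add L2_inner_commute[symmetric])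

lemma L2_norm_triangle:
  assumes f: "f \<in> L2 M" and g: "g \<in> L2 M"
  shows "L2_norm M (\<lambda>x. f x + g x) \<le> L2_norm M f + L2_norm M g"
proof -
  let ?s = "\<lambda>x. f x + g x"
  note s = L2_add[OF f g]
  have "of_real ((L2_norm M ?s)\<^sup>2) = L2_inner M f f + L2_inner M f g + (L2_inner M g f + L2_inner M g g)"
    unfolding L2_inner_self[symmetric]
    by (simp add: L2_inner_add_left L2_inner_add_right f g s)
  also have "\<dots> = of_real ((L2_norm M f)\<^sup>2 + 2 * Re (L2_inner M f g) + (L2_norm M g)\<^sup>2)"
    using L2_inner_commute[of M g f] by (simp add: L2_inner_self complex_eq_iff)
  finally have "(L2_norm M ?s)\<^sup>2 = (L2_norm M f)\<^sup>2 + 2 * Re (L2_inner M f g) + (L2_norm M g)\<^sup>2"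
    using of_real_eq_iff by blast
  also have "\<dots> \<le> (L2_norm M f + L2_norm M g)\<^sup>2"
    using L2_Cauchy_Schwarz[OF f g] complex_Re_le_cmod[of "L2_inner M f g"]
    by (simp add: power2_sum)
  finally show ?thesis by (rule power2_le_imp_le) simp
qed

lemma L2_norm_triangle_diff:
  assumes f: "f \<in> L2 M" and g: "g \<in> L2 M" and h: "h \<in> L2 M"
  shows "L2_norm M (\<lambda>x. f x - h x) \<le> L2_norm M (\<lambda>x. f x - g x) + L2_norm M (\<lambda>x. g x - h x)"
  using L2_norm_triangle[OF L2_diff[OF f g] L2_diff[OF g h]] by simp

text \<open>
  Riesz--Fischer, for sequences with geometrically decreasing steps. Every use below can choose its
  sequence, so this form of completeness suffices. The sequence converges almost everywhere, and Fatou's lemma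
  transfers the norm estimates to the pointwise limit.
\<close>

lemma L2_complete_fast:
  assumes s: "\<And>n. s n \<in> L2 M"
    and fast: "\<And>n. L2_norm M (\<lambda>x. s (Suc n) x - s n x) \<le> (1 / 2) ^ n"
  shows "\<exists>f \<in> L2 M. (\<lambda>n. L2_norm M (\<lambda>x. s n x - f x)) \<longlonglongrightarrow> 0"
proof -
  have sm [measurable]: "s n \<in> borel_measurable M" for n using s by auto
  define d where "d n x = cmod (s (Suc n) x - s n x)" for n x
  have dm [measurable]: "d n \<in> borel_measurable M" for n unfolding d_def by measurable
  have dnn: "0 \<le> d n x" for n x by (simp add: d_def)
  have diffL2: "(\<lambda>x. s n x - s m x) \<in> L2 M" for n m by (rule L2_diff[OF s s])
  \<comment> \<open>The weights \<open>2 ^ n\<close> still leave a convergent series of integrals, and make the steps summable pointwise, since \<open>d \<le> 2 ^ n * d\<^sup>2 + (1 / 2) ^ n\<close>.\<close>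
  have d2: "(\<integral>\<^sup>+x. ennreal (2 ^ n * (d n x)\<^sup>2) \<partial>M) \<le> ennreal ((1 / 2) ^ n)" for n
  proof -
    have "(\<integral>\<^sup>+x. ennreal (2 ^ n * (d n x)\<^sup>2) \<partial>M) = ennreal (2 ^ n) * (\<integral>\<^sup>+x. ennreal ((d n x)\<^sup>2) \<partial>M)"
      by (simp add: ennreal_mult nn_integral_cmult)
    also have "(\<integral>\<^sup>+x. ennreal ((d n x)\<^sup>2) \<partial>M) = ennreal ((L2_norm M (\<lambda>x. s (Suc n) x - s n x))\<^sup>2)"
      unfolding d_def by (rule L2_norm_sq_nn[OF diffL2, symmetric])
    also have "\<dots> \<le> ennreal (((1 / 2) ^ n)\<^sup>2)"
      by (intro ennreal_leI power_mono fast) simp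
    also have "ennreal (2 ^ n) * ennreal (((1 / 2) ^ n)\<^sup>2) = ennreal ((1 / 2) ^ n)"
      by (simp add: ennreal_mult[symmetric] power2_eq_square power_mult_distrib[symmetric])
    finally show ?thesis by (simp add: mult_left_mono)
  qed
  have "(\<integral>\<^sup>+x. (\<Sum>n. ennreal (2 ^ n * (d n x)\<^sup>2)) \<partial>M) = (\<Sum>n. \<integral>\<^sup>+x. ennreal (2 ^ n * (d n x)\<^sup>2) \<partial>M)"
    by (rule nn_integral_suminf) measurable
  also have "\<dots> \<le> (\<Sum>n. ennreal ((1 / 2) ^ n))"
    by (intro suminf_le d2) auto
  also have "\<dots> = ennreal (\<Sum>n. (1 / 2) ^ n)"
    by (rule suminf_ennreal2) (auto intro: summable_geometric)
  finally have "(\<integral>\<^sup>+x. (\<Sum>n. ennreal (2 ^ n * (d n x)\<^sup>2)) \<partial>M) \<noteq> \<infinity>"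
    by (auto simp: top_unique)
  then have "AE x in M. (\<Sum>n. ennreal (2 ^ n * (d n x)\<^sup>2)) \<noteq> \<infinity>"
    by (intro nn_integral_PInf_AE) auto
  then have conv: "AE x in M. convergent (\<lambda>n. s n x)"
  proof (rule AE_mp, intro AE_I2 impI)
    fix x assume fin: "(\<Sum>n. ennreal (2 ^ n * (d n x)\<^sup>2)) \<noteq> \<infinity>"
    have sm1: "summable (\<lambda>n. 2 ^ n * (d n x)\<^sup>2)"
      using fin by (intro summable_suminf_not_top) auto
    have sm2: "summable (\<lambda>n. (1 / 2 :: real) ^ n)" by (rule summable_geometric) simp
    have "summable (\<lambda>n. d n x)"
    proof (rule summable_comparison_test'[OF summable_add[OF sm1 sm2], of 0])
      fix n :: nat
      have "2 * ((sqrt 2 ^ n * d n x) * (sqrt (1 / 2) ^ n)) \<le> (sqrt 2 ^ n * d n x)\<^sup>2 + (sqrt (1 / 2) ^ n)\<^sup>2"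
        using sum_squares_bound[of "sqrt 2 ^ n * d n x" "sqrt (1 / 2) ^ n"] by (simp add: mult.assoc)
      also have "(sqrt 2 ^ n * d n x) * (sqrt (1 / 2) ^ n) = d n x"
      proof -
        have "sqrt 2 ^ n * sqrt (1 / 2) ^ n = (1 :: real)"
          by (simp add: power_mult_distrib[symmetric] real_sqrt_mult[symmetric])
        then show ?thesis by (simp add: mult_ac)
      qed
      also have "(sqrt 2 ^ n * d n x)\<^sup>2 = 2 ^ n * (d n x)\<^sup>2"
        by (simp add: power_mult_distrib power_mult[symmetric] mult.commute[of n]
            power_mult)
      also have "(sqrt (1 / 2) ^ n)\<^sup>2 = (1 / 2 :: real) ^ n"
        by (simp only: power_mult[symmetric] mult.commute[of n]) (simp add: power_mult)
      finally show "norm (d n x) \<le> 2 ^ n * (d n x)\<^sup>2 + (1 / 2) ^ n" using dnn[of n x] by simp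
    qed
    then have "summable (\<lambda>n. s (Suc n) x - s n x)"
      unfolding d_def by (rule summable_norm_cancel)
    then have "convergent (\<lambda>n. \<Sum>i<n. s (Suc i) x - s i x)" by (simp add: summable_iff_convergent)
    then have "convergent (\<lambda>n. s n x - s 0 x)" unfolding sum_lessThan_telescope[of "\<lambda>n. s n x"] .
    from convergent_add[OF this convergent_const[of "s 0 x"]]
    show "convergent (\<lambda>n. s n x)" by simp
  qed
  define f where "f x = lim (\<lambda>n. s n x)" for x
  have fm [measurable]: "f \<in> borel_measurable M" unfolding f_def by measurable
  have step: "L2_norm M (\<lambda>x. s (n + k) x - s n x) \<le> 2 * (1 / 2) ^ n - 2 * (1 / 2) ^ (n + k)" for n k
  proof (induction k)
    case 0 show ?case by (simp add: L2_norm_def)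
  next
    case (Suc k)
    have "L2_norm M (\<lambda>x. s (n + Suc k) x - s n x)
        \<le> L2_norm M (\<lambda>x. s (Suc (n + k)) x - s (n + k) x) + L2_norm M (\<lambda>x. s (n + k) x - s n x)"
      using L2_norm_triangle_diff[of "s (Suc (n + k))" M "s (n + k)" "s n"] s by simp
    then show ?case using Suc fast[of "n + k"] by simp
  qed
  have bound: "(\<integral>\<^sup>+x. ennreal ((cmod (s n x - f x))\<^sup>2) \<partial>M) \<le> ennreal ((2 * (1 / 2) ^ n)\<^sup>2)" for n
  proof -
    have "(\<integral>\<^sup>+x. ennreal ((cmod (s n x - f x))\<^sup>2) \<partial>M)
        = (\<integral>\<^sup>+x. liminf (\<lambda>k. ennreal ((cmod (s n x - s (n + k) x))\<^sup>2)) \<partial>M)"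
    proof (rule nn_integral_cong_AE, use conv in \<open>rule AE_mp\<close>, intro AE_I2 impI)
      fix x assume "convergent (\<lambda>n. s n x)"
      then have "(\<lambda>k. s k x) \<longlonglongrightarrow> f x" by (simp add: f_def convergent_LIMSEQ_iff)
      then have "(\<lambda>k. s (n + k) x) \<longlonglongrightarrow> f x" using LIMSEQ_ignore_initial_segment[of _ _ n] by (simp add: add.commute)
      then have "(\<lambda>k. ennreal ((cmod (s n x - s (n + k) x))\<^sup>2)) \<longlonglongrightarrow> ennreal ((cmod (s n x - f x))\<^sup>2)"
        by (intro tendsto_ennrealI tendsto_intros)
      then show "ennreal ((cmod (s n x - f x))\<^sup>2) = liminf (\<lambda>k. ennreal ((cmod (s n x - s (n + k) x))\<^sup>2))"
        by (intro lim_imp_Liminf[symmetric]) auto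
    qed
    also have "\<dots> \<le> liminf (\<lambda>k. \<integral>\<^sup>+x. ennreal ((cmod (s n x - s (n + k) x))\<^sup>2) \<partial>M)"
      by (rule nn_integral_liminf) measurable
    also have "\<dots> \<le> liminf (\<lambda>k. ennreal ((2 * (1 / 2) ^ n)\<^sup>2))"
    proof (intro Liminf_mono always_eventually allI)
      fix k
      have "(\<integral>\<^sup>+x. ennreal ((cmod (s n x - s (n + k) x))\<^sup>2) \<partial>M) = ennreal ((L2_norm M (\<lambda>x. s n x - s (n + k) x))\<^sup>2)"
        by (rule L2_norm_sq_nn[OF diffL2, symmetric])
      also have "\<dots> \<le> ennreal ((2 * (1 / 2) ^ n)\<^sup>2)"
      proof (intro ennreal_leI power_mono)
        show "L2_norm M (\<lambda>x. s n x - s (n + k) x) \<le> 2 * (1 / 2) ^ n"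
          unfolding L2_norm_minus_commute[of M "s n"]
          by (rule order_trans[OF step]) simp
      qed simp
      finally show "(\<integral>\<^sup>+x. ennreal ((cmod (s n x - s (n + k) x))\<^sup>2) \<partial>M) \<le> ennreal ((2 * (1 / 2) ^ n)\<^sup>2)" .
    qed
    also have "\<dots> = ennreal ((2 * (1 / 2) ^ n)\<^sup>2)" by (simp add: Liminf_const)
    finally show ?thesis .
  qed
  have dL2: "(\<lambda>x. s n x - f x) \<in> L2 M" for n
    unfolding L2_iff_nn using le_less_trans[OF bound[of n] ennreal_less_top] by (auto simp only: infinity_ennreal_def intro!: borel_measurable_diff sm fm)
  have fL2: "f \<in> L2 M" using L2_diff[OF s dL2, of 0 0] by simp
  have le: "L2_norm M (\<lambda>x. s n x - f x) \<le> 2 * (1 / 2) ^ n" for n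
  proof -
    have "ennreal ((L2_norm M (\<lambda>x. s n x - f x))\<^sup>2) \<le> ennreal ((2 * (1 / 2) ^ n)\<^sup>2)"
      unfolding L2_norm_sq_nn[OF dL2] by (rule bound)
    then have "(L2_norm M (\<lambda>x. s n x - f x))\<^sup>2 \<le> (2 * (1 / 2) ^ n)\<^sup>2"
      by (subst (asm) ennreal_le_iff) simp_all
    then show ?thesis by (rule power2_le_imp_le) simp
  qed
  have lim: "(\<lambda>n. 2 * (1 / 2 :: real) ^ n) \<longlonglongrightarrow> 0"
    by (intro tendsto_mult_right_zero LIMSEQ_power_zero) simp
  have "(\<lambda>n. L2_norm M (\<lambda>x. s n x - f x)) \<longlonglongrightarrow> 0"
    by (rule Lim_null_comparison[OF _ lim]) (simp add: le)
  with fL2 show ?thesis by blast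
qed

section \<open>Bessel sequences and orthonormal bases\<close>

lemma l2_infsum_Cauchy_Schwarz:
  fixes a b :: "'j \<Rightarrow> complex"
  assumes a: "(\<lambda>j. (cmod (a j))\<^sup>2) summable_on J" and b: "(\<lambda>j. (cmod (b j))\<^sup>2) summable_on J"
  shows "(\<lambda>j. cmod (a j * b j)) summable_on J"
    and "cmod (\<Sum>\<^sub>\<infinity>j\<in>J. a j * b j)
      \<le> sqrt (\<Sum>\<^sub>\<infinity>j\<in>J. (cmod (a j))\<^sup>2) * sqrt (\<Sum>\<^sub>\<infinity>j\<in>J. (cmod (b j))\<^sup>2)" (is "_ \<le> ?C")
proof -
  have fin: "(\<Sum>j\<in>E. cmod (a j * b j)) \<le> ?C" if E: "finite E" "E \<subseteq> J" for E
  proof -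
    have "(\<Sum>j\<in>E. cmod (a j * b j))\<^sup>2 \<le> (\<Sum>j\<in>E. (cmod (a j))\<^sup>2) * (\<Sum>j\<in>E. (cmod (b j))\<^sup>2)"
      unfolding norm_mult by (rule Cauchy_Schwarz_ineq_sum)
    also have "\<dots> \<le> (\<Sum>\<^sub>\<infinity>j\<in>J. (cmod (a j))\<^sup>2) * (\<Sum>\<^sub>\<infinity>j\<in>J. (cmod (b j))\<^sup>2)"
      by (intro mult_mono finite_sum_le_infsum a b E sum_nonneg infsum_nonneg) auto
    also have "\<dots> = ?C\<^sup>2"
      by (simp add: power_mult_distrib infsum_nonneg)
    finally show ?thesis by (rule power2_le_imp_le) (simp add: infsum_nonneg)
  qed
  show sm: "(\<lambda>j. cmod (a j * b j)) summable_on J"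
    by (rule nonneg_bdd_above_summable_on) (auto intro!: bdd_aboveI[of _ ?C] fin)
  have "cmod (\<Sum>\<^sub>\<infinity>j\<in>J. a j * b j) \<le> (\<Sum>\<^sub>\<infinity>j\<in>J. cmod (a j * b j))"
    using sm by (rule norm_infsum_bound)
  also have "\<dots> \<le> ?C" by (rule infsum_le_finite_sums[OF sm]) (rule fin)
  finally show "cmod (\<Sum>\<^sub>\<infinity>j\<in>J. a j * b j) \<le> ?C" .
qed

lemma L2_inner_sum_left:
  assumes "\<And>j. j \<in> E \<Longrightarrow> F j \<in> L2 M" "u \<in> L2 M"
  shows "L2_inner M (\<lambda>x. \<Sum>j\<in>E. F j x) u = (\<Sum>j\<in>E. L2_inner M (F j) u)"
  using L2_inner_lincomb_left[OF assms, where c = "\<lambda>_. 1"] by simp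

lemma L2_has_sum_inner:
  assumes s: "L2_has_sum M F J s" and u: "u \<in> L2 M"
  shows "((\<lambda>j. L2_inner M (F j) u) has_sum L2_inner M s u) J"
proof -
  have sL: "s \<in> L2 M" and FL: "\<And>j. j \<in> J \<Longrightarrow> F j \<in> L2 M"
    and lim: "((\<lambda>E. L2_norm M (\<lambda>x. s x - (\<Sum>j\<in>E. F j x))) \<longlongrightarrow> 0) (finite_subsets_at_top J)"
    using s by (auto simp: L2_has_sum_def)
  have "((\<lambda>E. L2_inner M s u - (\<Sum>j\<in>E. L2_inner M (F j) u)) \<longlongrightarrow> 0) (finite_subsets_at_top J)"
  proof (rule Lim_null_comparison)
    show "((\<lambda>E. L2_norm M (\<lambda>x. s x - (\<Sum>j\<in>E. F j x)) * L2_norm M u) \<longlongrightarrow> 0) (finite_subsets_at_top J)"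
      by (rule tendsto_mult_left_zero[OF lim])
    show "\<forall>\<^sub>F E in finite_subsets_at_top J. norm (L2_inner M s u - (\<Sum>j\<in>E. L2_inner M (F j) u))
        \<le> L2_norm M (\<lambda>x. s x - (\<Sum>j\<in>E. F j x)) * L2_norm M u"
    proof (rule eventually_finite_subsets_at_top_weakI)
      fix E assume E: "finite E" "E \<subseteq> J"
      have FE: "(\<lambda>x. \<Sum>j\<in>E. F j x) \<in> L2 M" using E FL by (intro L2_sum) auto
      have "L2_inner M s u - (\<Sum>j\<in>E. L2_inner M (F j) u) = L2_inner M (\<lambda>x. s x - (\<Sum>j\<in>E. F j x)) u"
        using E FL u by (subst L2_inner_diff_left[OF sL FE u]) (auto simp: L2_inner_sum_left subset_iff)
      then show "norm (L2_inner M s u - (\<Sum>j\<in>E. L2_inner M (F j) u))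
        \<le> L2_norm M (\<lambda>x. s x - (\<Sum>j\<in>E. F j x)) * L2_norm M u"
        using L2_Cauchy_Schwarz[OF L2_diff[OF sL FE] u] by simp
    qed
  qed
  from tendsto_diff[OF tendsto_const[of "L2_inner M s u"] this]
  show ?thesis by (simp add: has_sum_def)
qed

lemma L2_has_sum_cong_AE:
  assumes s: "L2_has_sum M F J s" and s': "s' \<in> L2 M" and eq: "AE x in M. s x = s' x"
  shows "L2_has_sum M F J s'"
proof -
  have sL: "s \<in> L2 M" and FL: "\<And>j. j \<in> J \<Longrightarrow> F j \<in> L2 M"
    using s by (auto simp: L2_has_sum_def)
  have "\<forall>\<^sub>F E in finite_subsets_at_top J. L2_norm M (\<lambda>x. s x - (\<Sum>j\<in>E. F j x))
      = L2_norm M (\<lambda>x. s' x - (\<Sum>j\<in>E. F j x))"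
  proof (rule eventually_finite_subsets_at_top_weakI)
    fix E assume "finite E" "E \<subseteq> J"
    then have FE: "(\<lambda>x. \<Sum>j\<in>E. F j x) \<in> L2 M" using FL by (intro L2_sum) auto
    show "L2_norm M (\<lambda>x. s x - (\<Sum>j\<in>E. F j x)) = L2_norm M (\<lambda>x. s' x - (\<Sum>j\<in>E. F j x))"
      using eq by (intro L2_norm_cong_AE L2_measurable L2_diff sL s' FE) auto
  qed
  from tendsto_cong[OF this] show ?thesis using s s' by (simp add: L2_has_sum_def)
qed

lemma L2_bessel_summable:
  "L2_bessel M F J \<Longrightarrow> f \<in> L2 M \<Longrightarrow> (\<lambda>j. (cmod (L2_inner M f (F j)))\<^sup>2) summable_on J"
  unfolding L2_bessel_def by blast

lemma cmod_L2_inner_commute: "cmod (L2_inner M f g) = cmod (L2_inner M g f)"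
  by (subst L2_inner_commute) simp

text \<open>
  The Bessel bound says that the analysis map \<open>u \<mapsto> (\<langle>u, F\<^sub>j\<rangle>)\<^sub>j\<close> is bounded into square summable
  families; by Cauchy--Schwarz, pairing its values with a square summable \<open>c\<close> is bounded in \<open>u\<close>.
\<close>

lemma L2_bessel_pairing_bound:
  fixes F :: "'j \<Rightarrow> 'a \<Rightarrow> complex"
  assumes "L2_bessel M F J"
  shows "\<exists>B>0. \<forall>c u J'. J' \<subseteq> J \<longrightarrow> (\<lambda>j. (cmod (c j))\<^sup>2) summable_on J' \<longrightarrow> u \<in> L2 M \<longrightarrow>
       (\<lambda>j. c j * L2_inner M (F j) u) summable_on J' \<and>
       cmod (\<Sum>\<^sub>\<infinity>j\<in>J'. c j * L2_inner M (F j) u) \<le> sqrt (\<Sum>\<^sub>\<infinity>j\<in>J'. (cmod (c j))\<^sup>2) * (sqrt B * L2_norm M u)"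
proof -
  obtain B where B: "B > 0"
    "\<forall>f\<in>L2 M. (\<lambda>j. (cmod (L2_inner M f (F j)))\<^sup>2) summable_on J \<and>
       (\<Sum>\<^sub>\<infinity>j\<in>J. (cmod (L2_inner M f (F j)))\<^sup>2) \<le> B * (L2_norm M f)\<^sup>2"
    using assms unfolding L2_bessel_def by blast
  show ?thesis
  proof (intro exI[of _ B] conjI B(1) allI impI)
    fix c :: "'j \<Rightarrow> complex" and u J'
    assume J': "J' \<subseteq> J" and c: "(\<lambda>j. (cmod (c j))\<^sup>2) summable_on J'" and u: "u \<in> L2 M"
    have b: "(\<lambda>j. (cmod (L2_inner M (F j) u))\<^sup>2) summable_on J"
      using conjunct1[OF bspec[OF B(2) u]] by (subst cmod_L2_inner_commute)
    have b': "(\<lambda>j. (cmod (L2_inner M (F j) u))\<^sup>2) summable_on J'"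
      by (rule summable_on_subset_banach[OF b J'])
    have "(\<Sum>\<^sub>\<infinity>j\<in>J'. (cmod (L2_inner M (F j) u))\<^sup>2) \<le> (\<Sum>\<^sub>\<infinity>j\<in>J. (cmod (L2_inner M (F j) u))\<^sup>2)"
      by (rule infsum_mono_neutral[OF b' b]) (use J' in auto)
    also have "\<dots> \<le> B * (L2_norm M u)\<^sup>2"
      using conjunct2[OF bspec[OF B(2) u]] by (subst cmod_L2_inner_commute)
    finally have "sqrt (\<Sum>\<^sub>\<infinity>j\<in>J'. (cmod (L2_inner M (F j) u))\<^sup>2) \<le> sqrt (B * (L2_norm M u)\<^sup>2)"
      by (rule real_sqrt_le_mono)
    also have "\<dots> = sqrt B * L2_norm M u" by (simp add: real_sqrt_mult)
    finally have le: "sqrt (\<Sum>\<^sub>\<infinity>j\<in>J'. (cmod (L2_inner M (F j) u))\<^sup>2) \<le> sqrt B * L2_norm M u" .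
    note CS = l2_infsum_Cauchy_Schwarz[OF c b']
    show "(\<lambda>j. c j * L2_inner M (F j) u) summable_on J'"
      using abs_summable_summable[OF CS(1)] .
    show "cmod (\<Sum>\<^sub>\<infinity>j\<in>J'. c j * L2_inner M (F j) u) \<le> sqrt (\<Sum>\<^sub>\<infinity>j\<in>J'. (cmod (c j))\<^sup>2) * (sqrt B * L2_norm M u)"
      using order_trans[OF CS(2) mult_left_mono[OF le]]
      by (simp add: infsum_nonneg)
  qed
qed

text \<open>
  A norm bound for synthesized vectors in weak form: \<open>s\<close> need not be presented as a limit of finite sums, only
  its pairing with itself has to be given by the coefficients \<open>c\<close>. This covers finite sums and
  remainders of infinite or iterated ones alike.
\<close>

lemma L2_bessel_norm_bound:
  fixes F :: "'j \<Rightarrow> 'a \<Rightarrow> complex"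
  assumes "L2_bessel M F J"
  shows "\<exists>B>0. \<forall>c s J'. J' \<subseteq> J \<longrightarrow> (\<lambda>j. (cmod (c j))\<^sup>2) summable_on J' \<longrightarrow> s \<in> L2 M \<longrightarrow>
       L2_inner M s s = (\<Sum>\<^sub>\<infinity>j\<in>J'. c j * L2_inner M (F j) s) \<longrightarrow>
       L2_norm M s \<le> sqrt B * sqrt (\<Sum>\<^sub>\<infinity>j\<in>J'. (cmod (c j))\<^sup>2)"
proof -
  obtain B where B: "B > 0"
    "\<forall>c u J'. J' \<subseteq> J \<longrightarrow> (\<lambda>j. (cmod (c j))\<^sup>2) summable_on J' \<longrightarrow> u \<in> L2 M \<longrightarrow>
       (\<lambda>j. c j * L2_inner M (F j) u) summable_on J' \<and>
       cmod (\<Sum>\<^sub>\<infinity>j\<in>J'. c j * L2_inner M (F j) u) \<le> sqrt (\<Sum>\<^sub>\<infinity>j\<in>J'. (cmod (c j))\<^sup>2) * (sqrt B * L2_norm M u)"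
    using L2_bessel_pairing_bound[OF assms] by blast
  show ?thesis
  proof (intro exI[of _ B] conjI B(1) allI impI)
    fix c :: "'j \<Rightarrow> complex" and s J'
    assume J': "J' \<subseteq> J" and c: "(\<lambda>j. (cmod (c j))\<^sup>2) summable_on J'" and s: "s \<in> L2 M"
      and self: "L2_inner M s s = (\<Sum>\<^sub>\<infinity>j\<in>J'. c j * L2_inner M (F j) s)"
    let ?R = "sqrt B * sqrt (\<Sum>\<^sub>\<infinity>j\<in>J'. (cmod (c j))\<^sup>2)"
    have "(L2_norm M s)\<^sup>2 \<le> ?R * L2_norm M s"
      using B(2)[rule_format, OF J' c s, THEN conjunct2] unfolding self[symmetric] L2_inner_self by (simp add: mult_ac norm_power)
    moreover have "0 \<le> ?R" using B(1) by (simp add: infsum_nonneg)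
    ultimately show "L2_norm M s \<le> ?R"
      by (cases "L2_norm M s = 0") (auto simp: power2_eq_square mult_le_cancel_right order_less_le)
  qed
qed

lemma infsum_tail_small:
  fixes a :: "'j \<Rightarrow> real"
  assumes a: "a summable_on J" and e: "e > 0"
  obtains E where "finite E" "E \<subseteq> J" "(\<Sum>\<^sub>\<infinity>j\<in>J - E. a j) < e"
proof -
  have "(sum a \<longlongrightarrow> infsum a J) (finite_subsets_at_top J)"
    using has_sum_infsum[OF a] by (simp add: has_sum_def)
  then have "\<forall>\<^sub>F E in finite_subsets_at_top J. dist (sum a E) (infsum a J) < e"
    using e by (rule tendstoD)
  then obtain E where E: "finite E" "E \<subseteq> J" "dist (sum a E) (infsum a J) < e"
    unfolding eventually_finite_subsets_at_top by blast
  have "infsum a (J - E) = infsum a J - infsum a E"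
    using E by (intro infsum_Diff a) auto
  with E that show thesis by (auto simp: dist_real_def)
qed

text \<open>
  Square summable coefficients give an unconditionally convergent series, because the norm of a partial sum over a
  set disjoint from a large finite set is controlled by the tail of the coefficients.
\<close>

lemma L2_bessel_synthesis:
  assumes bessel: "L2_bessel M F J" and c: "(\<lambda>j. (cmod (c j))\<^sup>2) summable_on J"
  shows "\<exists>s. L2_has_sum M (\<lambda>j x. c j * F j x) J s"
proof -
  have FL: "\<And>j. j \<in> J \<Longrightarrow> F j \<in> L2 M" using bessel by (auto simp: L2_bessel_def)
  obtain B where B: "B > 0"
    "\<forall>c s J'. J' \<subseteq> J \<longrightarrow> (\<lambda>j. (cmod (c j))\<^sup>2) summable_on J' \<longrightarrow> s \<in> L2 M \<longrightarrow>
       L2_inner M s s = (\<Sum>\<^sub>\<infinity>j\<in>J'. c j * L2_inner M (F j) s) \<longrightarrow>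
       L2_norm M s \<le> sqrt B * sqrt (\<Sum>\<^sub>\<infinity>j\<in>J'. (cmod (c j))\<^sup>2)"
    using L2_bessel_norm_bound[OF bessel] by blast
  define P where "P E x = (\<Sum>j\<in>E. c j * F j x)" for E x
  have PL: "P E \<in> L2 M" if "E \<subseteq> J" for E
    unfolding P_def using that FL by (intro L2_lincomb) auto
  have csub: "(\<lambda>j. (cmod (c j))\<^sup>2) summable_on A" if "A \<subseteq> J" for A
    by (rule summable_on_subset_banach[OF c that])
  have Pdiff: "L2_norm M (\<lambda>x. P E x - P E' x) \<le> sqrt B * sqrt (\<Sum>\<^sub>\<infinity>j\<in>J - E'. (cmod (c j))\<^sup>2)"
    if E: "finite E" "E' \<subseteq> E" "E \<subseteq> J" for E E'
  proof -
    have eq: "(\<lambda>x. P E x - P E' x) = P (E - E')"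
      using E by (auto simp: P_def sum_diff)
    have "L2_norm M (P (E - E')) \<le> sqrt B * sqrt (\<Sum>\<^sub>\<infinity>j\<in>E - E'. (cmod (c j))\<^sup>2)"
    proof (rule B(2)[rule_format])
      show "L2_inner M (P (E - E')) (P (E - E')) = (\<Sum>\<^sub>\<infinity>j\<in>E - E'. c j * L2_inner M (F j) (P (E - E')))"
        using E FL PL[of "E - E'"] unfolding P_def by (subst L2_inner_lincomb_left) auto
    qed (use E in \<open>auto intro!: PL csub\<close>)
    also have "\<dots> \<le> sqrt B * sqrt (\<Sum>\<^sub>\<infinity>j\<in>J - E'. (cmod (c j))\<^sup>2)"
      using E B(1) by (intro mult_left_mono real_sqrt_le_mono infsum_mono_neutral csub) auto
    finally show ?thesis unfolding eq .
  qed
  \<comment> \<open>An increasing exhaustion whose tails decrease so fast that the partial sums satisfy the hypothesis of \<open>L2_complete_fast\<close>.\<close>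
  have "\<exists>E. finite E \<and> E \<subseteq> J \<and> (\<Sum>\<^sub>\<infinity>j\<in>J - E. (cmod (c j))\<^sup>2) < ((1 / 2) ^ n)\<^sup>2 / B" for n :: nat
    using infsum_tail_small[OF c, of "((1 / 2) ^ n)\<^sup>2 / B"] B(1) by auto
  then obtain E0 where E0: "\<And>n. finite (E0 n)" "\<And>n. E0 n \<subseteq> J"
    "\<And>n. (\<Sum>\<^sub>\<infinity>j\<in>J - E0 n. (cmod (c j))\<^sup>2) < ((1 / 2) ^ n)\<^sup>2 / B" by metis
  define E where "E n = (\<Union>i\<le>n. E0 i)" for n
  have E: "finite (E n)" "E n \<subseteq> J" "E n \<subseteq> E (Suc n)" for n
    using E0 by (auto simp: E_def le_Suc_eq)
  have tail: "sqrt B * sqrt (\<Sum>\<^sub>\<infinity>j\<in>J - E n. (cmod (c j))\<^sup>2) \<le> (1 / 2) ^ n" for n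
  proof -
    have "(\<Sum>\<^sub>\<infinity>j\<in>J - E n. (cmod (c j))\<^sup>2) \<le> (\<Sum>\<^sub>\<infinity>j\<in>J - E0 n. (cmod (c j))\<^sup>2)"
      by (intro infsum_mono_neutral csub) (auto simp: E_def)
    also have "\<dots> \<le> ((1 / 2) ^ n)\<^sup>2 / B" using E0(3)[of n] by simp
    finally have "B * (\<Sum>\<^sub>\<infinity>j\<in>J - E n. (cmod (c j))\<^sup>2) \<le> ((1 / 2) ^ n)\<^sup>2"
      using B(1) by (simp add: field_simps)
    then have "sqrt (B * (\<Sum>\<^sub>\<infinity>j\<in>J - E n. (cmod (c j))\<^sup>2)) \<le> (1 / 2) ^ n"
      by (intro real_le_lsqrt) auto
    then show ?thesis by (simp add: real_sqrt_mult)
  qed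
  have "\<exists>s\<in>L2 M. (\<lambda>n. L2_norm M (\<lambda>x. P (E n) x - s x)) \<longlonglongrightarrow> 0"
    using order_trans[OF Pdiff[OF E(1) E(3) E(2)] tail] by (intro L2_complete_fast PL E) blast
  then obtain s where s: "s \<in> L2 M" "(\<lambda>n. L2_norm M (\<lambda>x. P (E n) x - s x)) \<longlonglongrightarrow> 0" by blast
  have "((\<lambda>E. L2_norm M (\<lambda>x. s x - P E x)) \<longlongrightarrow> 0) (finite_subsets_at_top J)"
  proof (rule tendstoI)
    fix e :: real assume e: "e > 0"
    have "(\<lambda>n. L2_norm M (\<lambda>x. P (E n) x - s x) + (1 / 2) ^ n) \<longlonglongrightarrow> 0 + 0"
      by (intro tendsto_add s(2) LIMSEQ_power_zero) simp
    then have "\<forall>\<^sub>F n in sequentially. L2_norm M (\<lambda>x. P (E n) x - s x) + (1 / 2) ^ n < e"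
      using e by (intro order_tendstoD) auto
    then obtain n where n: "L2_norm M (\<lambda>x. P (E n) x - s x) + (1 / 2) ^ n < e"
      by (auto simp: eventually_sequentially)
    show "\<forall>\<^sub>F A in finite_subsets_at_top J. dist (L2_norm M (\<lambda>x. s x - P A x)) 0 < e"
      unfolding eventually_finite_subsets_at_top
    proof (intro exI conjI allI impI)
      fix A assume A: "finite A \<and> E n \<subseteq> A \<and> A \<subseteq> J"
      have "L2_norm M (\<lambda>x. s x - P A x) \<le> L2_norm M (\<lambda>x. s x - P (E n) x) + L2_norm M (\<lambda>x. P (E n) x - P A x)"
        using A E by (intro L2_norm_triangle_diff s PL) auto
      also have "\<dots> = L2_norm M (\<lambda>x. P (E n) x - s x) + L2_norm M (\<lambda>x. P A x - P (E n) x)"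
        by (simp only: L2_norm_minus_commute)
      also have "\<dots> < e" using Pdiff[of A "E n"] A tail[of n] n by auto
      finally show "dist (L2_norm M (\<lambda>x. s x - P A x)) 0 < e" by simp
    qed (use E in auto)
  qed
  then have "L2_has_sum M (\<lambda>j x. c j * F j x) J s"
    using s(1) FL by (auto simp: L2_has_sum_def P_def intro: L2_cmult)
  then show ?thesis by blast
qed

lemma L2_bessel_subset:
  assumes "L2_bessel M F J" "J' \<subseteq> J"
  shows "L2_bessel M F J'"
proof -
  obtain B where B: "B > 0"
    "\<forall>f\<in>L2 M. (\<lambda>j. (cmod (L2_inner M f (F j)))\<^sup>2) summable_on J \<and>
       (\<Sum>\<^sub>\<infinity>j\<in>J. (cmod (L2_inner M f (F j)))\<^sup>2) \<le> B * (L2_norm M f)\<^sup>2"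
    using assms(1) unfolding L2_bessel_def by blast
  have sm: "(\<lambda>j. (cmod (L2_inner M f (F j)))\<^sup>2) summable_on J'" if "f \<in> L2 M" for f
    using conjunct1[OF bspec[OF B(2) that]] assms(2) by (rule summable_on_subset_banach)
  have "(\<Sum>\<^sub>\<infinity>j\<in>J'. (cmod (L2_inner M f (F j)))\<^sup>2) \<le> B * (L2_norm M f)\<^sup>2" if "f \<in> L2 M" for f
    by (rule order_trans[OF infsum_mono_neutral[OF sm[OF that] conjunct1[OF bspec[OF B(2) that]]] conjunct2[OF bspec[OF B(2) that]]])
       (use assms(2) in auto)
  then show ?thesis using B(1) sm assms unfolding L2_bessel_def by blast
qed

lemma infsum_Times_finite:
  fixes a :: "'h \<times> 'l \<Rightarrow> complex"
  assumes a: "a summable_on H \<times> L" and L: "finite L"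
  shows "infsum a (H \<times> L) = (\<Sum>l\<in>L. \<Sum>\<^sub>\<infinity>h\<in>H. a (h, l))"
proof -
  have "infsum a (H \<times> L) = (\<Sum>\<^sub>\<infinity>h\<in>H. \<Sum>\<^sub>\<infinity>l\<in>L. a (h, l))"
    by (rule infsum_Sigma_banach[OF a, symmetric])
  also have "\<dots> = (\<Sum>\<^sub>\<infinity>l\<in>L. \<Sum>\<^sub>\<infinity>h\<in>H. a (h, l))"
    using a by (intro infsum_swap_banach) (simp add: case_prod_unfold)
  finally show ?thesis using L by simp
qed

text \<open>
  The remainder after finitely many \<open>l\<close> pairs with itself through the coefficients outside \<open>H \<times> L\<close> only, so
  the norm bound for Bessel sequences makes it small.
\<close>

lemma L2_has_sum_iterated:
  assumes bessel: "L2_bessel M F (H \<times> I)" and c: "(\<lambda>j. (cmod (c j))\<^sup>2) summable_on H \<times> I"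
    and s: "L2_has_sum M (\<lambda>j x. c j * F j x) (H \<times> I) s"
    and g: "\<And>l. l \<in> I \<Longrightarrow> L2_has_sum M (\<lambda>h x. c (h, l) * F (h, l) x) H (g l)"
  shows "L2_has_sum M g I s"
proof -
  have sL: "s \<in> L2 M" using s by (simp add: L2_has_sum_def)
  have gL: "g l \<in> L2 M" if "l \<in> I" for l using g[OF that] by (simp add: L2_has_sum_def)
  obtain B where B: "B > 0"
    "\<forall>c s J'. J' \<subseteq> H \<times> I \<longrightarrow> (\<lambda>j. (cmod (c j))\<^sup>2) summable_on J' \<longrightarrow> s \<in> L2 M \<longrightarrow>
       L2_inner M s s = (\<Sum>\<^sub>\<infinity>j\<in>J'. c j * L2_inner M (F j) s) \<longrightarrow>
       L2_norm M s \<le> sqrt B * sqrt (\<Sum>\<^sub>\<infinity>j\<in>J'. (cmod (c j))\<^sup>2)"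
    using L2_bessel_norm_bound[OF bessel] by blast
  define S where "S = (\<Sum>\<^sub>\<infinity>j\<in>H \<times> I. (cmod (c j))\<^sup>2)"
  have bound: "L2_norm M (\<lambda>x. s x - (\<Sum>l\<in>L. g l x)) \<le> sqrt B * sqrt (\<Sum>\<^sub>\<infinity>j\<in>H \<times> I - H \<times> L. (cmod (c j))\<^sup>2)"
    if L: "finite L" "L \<subseteq> I" for L
  proof -
    let ?d = "\<lambda>x. s x - (\<Sum>l\<in>L. g l x)"
    have gsum: "(\<lambda>x. \<Sum>l\<in>L. g l x) \<in> L2 M" using L gL by (intro L2_sum) auto
    have dL: "?d \<in> L2 M" by (rule L2_diff[OF sL gsum])
    define a where "a j = c j * L2_inner M (F j) ?d" for j
    have hs: "(a has_sum L2_inner M s ?d) (H \<times> I)"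
      using L2_has_sum_inner[OF s dL] by (simp add: a_def[abs_def] L2_inner_cmult_left)
    have sub: "H \<times> L \<subseteq> H \<times> I" using L by auto
    have aL: "a summable_on H \<times> L"
      by (rule summable_on_subset_banach[OF _ sub]) (use hs in \<open>auto simp: summable_on_def\<close>)
    have "infsum a (H \<times> L) = (\<Sum>l\<in>L. \<Sum>\<^sub>\<infinity>h\<in>H. a (h, l))"
      by (rule infsum_Times_finite[OF aL L(1)])
    also have "\<dots> = (\<Sum>l\<in>L. L2_inner M (g l) ?d)"
    proof (rule sum.cong[OF refl])
      fix l assume "l \<in> L"
      then have "l \<in> I" using L by auto
      from L2_has_sum_inner[OF g[OF this] dL]
      show "(\<Sum>\<^sub>\<infinity>h\<in>H. a (h, l)) = L2_inner M (g l) ?d"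
        by (simp add: a_def[abs_def] L2_inner_cmult_left infsumI)
    qed
    also have "\<dots> = L2_inner M (\<lambda>x. \<Sum>l\<in>L. g l x) ?d"
      using L gL dL by (intro L2_inner_sum_left[symmetric]) auto
    finally have "infsum a (H \<times> I - H \<times> L) = L2_inner M s ?d - L2_inner M (\<lambda>x. \<Sum>l\<in>L. g l x) ?d"
      using infsum_Diff[OF _ aL sub] hs by (auto simp: summable_on_def infsumI)
    also have "\<dots> = L2_inner M ?d ?d" by (rule L2_inner_diff_left[OF sL gsum dL, symmetric])
    finally show ?thesis
      using c by (intro B(2)[rule_format] dL) (auto simp: a_def[abs_def] intro: summable_on_subset_banach)
  qed
  have "((\<lambda>L. L2_norm M (\<lambda>x. s x - (\<Sum>l\<in>L. g l x))) \<longlongrightarrow> 0) (finite_subsets_at_top I)"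
  proof (rule tendstoI)
    fix e :: real assume e: "e > 0"
    obtain E where E: "finite E" "E \<subseteq> H \<times> I" "(\<Sum>\<^sub>\<infinity>j\<in>H \<times> I - E. (cmod (c j))\<^sup>2) < e\<^sup>2 / B"
      using infsum_tail_small[OF c, of "e\<^sup>2 / B"] e B(1) by auto
    show "\<forall>\<^sub>F L in finite_subsets_at_top I. dist (L2_norm M (\<lambda>x. s x - (\<Sum>l\<in>L. g l x))) 0 < e"
      unfolding eventually_finite_subsets_at_top
    proof (intro exI conjI allI impI)
      fix L assume L: "finite L \<and> snd ` E \<subseteq> L \<and> L \<subseteq> I"
      have "(\<Sum>\<^sub>\<infinity>j\<in>H \<times> I - H \<times> L. (cmod (c j))\<^sup>2) \<le> (\<Sum>\<^sub>\<infinity>j\<in>H \<times> I - E. (cmod (c j))\<^sup>2)"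
        using L E(2) by (intro infsum_mono_neutral summable_on_subset_banach[OF c]) (auto simp: image_subset_iff)
      also have "\<dots> < e\<^sup>2 / B" by (rule E)
      finally have "B * (\<Sum>\<^sub>\<infinity>j\<in>H \<times> I - H \<times> L. (cmod (c j))\<^sup>2) < e\<^sup>2"
        using B(1) by (simp add: field_simps)
      then have "sqrt (B * (\<Sum>\<^sub>\<infinity>j\<in>H \<times> I - H \<times> L. (cmod (c j))\<^sup>2)) < e"
        using e by (intro real_less_lsqrt) (auto simp: infsum_nonneg)
      then show "dist (L2_norm M (\<lambda>x. s x - (\<Sum>l\<in>L. g l x))) 0 < e"
        using bound[of L] L by (simp add: real_sqrt_mult)
    qed (use E in auto)
  qed
  then show ?thesis using sL gL by (simp add: L2_has_sum_def)
qed

definition L2_orthonormal :: "'a measure \<Rightarrow> ('j \<Rightarrow> 'a \<Rightarrow> complex) \<Rightarrow> 'j set \<Rightarrow> bool" where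
  "L2_orthonormal M e J \<longleftrightarrow>
     (\<forall>j\<in>J. e j \<in> L2 M) \<and>
     (\<forall>i\<in>J. \<forall>j\<in>J. L2_inner M (e i) (e j) = (if i = j then 1 else 0))"

text \<open>
  Total in the sense of having trivial orthogonal complement. By completeness of \<open>L\<^sup>2\<close> this is equivalent to
  a dense span, and it is the form that a \<open>\<pi>\<close>-system argument can verify.
\<close>

definition L2_basis :: "'a measure \<Rightarrow> ('j \<Rightarrow> 'a \<Rightarrow> complex) \<Rightarrow> 'j set \<Rightarrow> bool" where
  "L2_basis M e J \<longleftrightarrow> L2_orthonormal M e J \<and>
     (\<forall>f\<in>L2 M. (\<forall>j\<in>J. L2_inner M f (e j) = 0) \<longrightarrow> (AE x in M. f x = 0))"

lemma L2_orthonormalD: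
  assumes "L2_orthonormal M e J"
  shows "j \<in> J \<Longrightarrow> e j \<in> L2 M"
    and "i \<in> J \<Longrightarrow> j \<in> J \<Longrightarrow> L2_inner M (e i) (e j) = (if i = j then 1 else 0)"
  using assms by (simp_all add: L2_orthonormal_def)

lemma L2_bessel_orthonormal:
  assumes on: "L2_orthonormal M e J"
  shows "L2_bessel M e J"
proof -
  note e = L2_orthonormalD(1)[OF on] and orth = L2_orthonormalD(2)[OF on]
  have fin: "(\<Sum>j\<in>E. (cmod (L2_inner M f (e j)))\<^sup>2) \<le> (L2_norm M f)\<^sup>2"
    if f: "f \<in> L2 M" and E: "finite E" "E \<subseteq> J" for f E
  proof -
    let ?S = "\<Sum>j\<in>E. (cmod (L2_inner M f (e j)))\<^sup>2"
    define s where "s x = (\<Sum>j\<in>E. L2_inner M f (e j) * e j x)" for x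
    have sL: "s \<in> L2 M" unfolding s_def using E e by (intro L2_lincomb) auto
    have su: "L2_inner M s u = (\<Sum>j\<in>E. L2_inner M f (e j) * L2_inner M (e j) u)" if "u \<in> L2 M" for u
      unfolding s_def using E e that by (intro L2_inner_lincomb_left) auto
    have sf: "L2_inner M s f = of_real ?S"
      unfolding su[OF f] by (subst (2) L2_inner_commute) (simp only: complex_norm_square of_real_sum)
    have se: "L2_inner M s (e i) = L2_inner M f (e i)" if "i \<in> E" for i
    proof -
      have "L2_inner M s (e i) = (\<Sum>j\<in>E. L2_inner M f (e j) * (if j = i then 1 else 0))"
        using that E by (subst su) (auto intro!: e sum.cong simp: orth subsetD[OF E(2)])
      then show ?thesis using that E by (simp add: if_distrib cong: if_cong)
    qed
    have ss: "L2_inner M s s = of_real ?S"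
    proof -
      have "L2_inner M s s = (\<Sum>j\<in>E. L2_inner M f (e j) * cnj (L2_inner M s (e j)))"
        unfolding su[OF sL] by (subst (2) L2_inner_commute) (rule refl)
      also have "\<dots> = (\<Sum>j\<in>E. L2_inner M f (e j) * cnj (L2_inner M f (e j)))"
        by (intro sum.cong refl) (simp add: se)
      finally show ?thesis by (simp only: complex_norm_square of_real_sum)
    qed
    have "cmod (of_real ?S) \<le> L2_norm M s * L2_norm M f"
      using L2_Cauchy_Schwarz[OF sL f] unfolding sf .
    moreover have "(L2_norm M s)\<^sup>2 = ?S" using ss unfolding L2_inner_self of_real_eq_iff .
    moreover have "cmod (of_real ?S) = ?S" by (subst norm_of_real) (simp add: sum_nonneg)
    ultimately have "(L2_norm M s)\<^sup>2 \<le> L2_norm M s * L2_norm M f" by simp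
    then have "L2_norm M s \<le> L2_norm M f"
      by (cases "L2_norm M s = 0") (auto simp: power2_eq_square mult_le_cancel_left order_less_le)
    then show ?thesis using \<open>(L2_norm M s)\<^sup>2 = ?S\<close> power_mono[of "L2_norm M s" "L2_norm M f" 2] by simp
  qed
  have sm: "(\<lambda>j. (cmod (L2_inner M f (e j)))\<^sup>2) summable_on J" if f: "f \<in> L2 M" for f
    by (rule nonneg_bdd_above_summable_on) (auto intro!: bdd_aboveI[of _ "(L2_norm M f)\<^sup>2"] fin f)
  have "(\<Sum>\<^sub>\<infinity>j\<in>J. (cmod (L2_inner M f (e j)))\<^sup>2) \<le> 1 * (L2_norm M f)\<^sup>2" if f: "f \<in> L2 M" for f
    using infsum_le_finite_sums[OF sm[OF f] fin[OF f]] by simp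
  then show ?thesis unfolding L2_bessel_def using e sm by (intro conjI exI[of _ "1::real"]) auto
qed

lemma L2_Riesz_Fischer:
  assumes on: "L2_orthonormal M e J"
    and c: "(\<lambda>j. (cmod (c j))\<^sup>2) summable_on J"
  shows "\<exists>s. L2_has_sum M (\<lambda>j x. c j * e j x) J s \<and> (\<forall>j\<in>J. L2_inner M s (e j) = c j)"
proof -
  note e = L2_orthonormalD(1)[OF on] and orth = L2_orthonormalD(2)[OF on]
  obtain s where s: "L2_has_sum M (\<lambda>j x. c j * e j x) J s"
    using L2_bessel_synthesis[OF L2_bessel_orthonormal[OF on] c] by blast
  have coef: "\<forall>i\<in>J. L2_inner M s (e i) = c i"
  proof
    fix i assume i: "i \<in> J"
    have "((\<lambda>j. c j * L2_inner M (e j) (e i)) has_sum L2_inner M s (e i)) J"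
      using L2_has_sum_inner[OF s e[OF i]] by (simp add: L2_inner_cmult_left)
    moreover have "((\<lambda>j. c j * L2_inner M (e j) (e i)) has_sum c i) J"
    proof (subst has_sum_cong_neutral)
      show "((\<lambda>j. if j = i then c i else 0) has_sum c i) {i}"
        using has_sum_finite[of "{i}" "\<lambda>j. if j = i then c i else 0"] by simp
    qed (use i in \<open>simp_all add: orth\<close>)
    ultimately show "L2_inner M s (e i) = c i" by (rule has_sum_unique)
  qed
  have "L2_has_sum M (\<lambda>j x. c j * e j x) J s \<and> (\<forall>j\<in>J. L2_inner M s (e j) = c j)" using s coef by (rule conjI)
  then show ?thesis by (rule exI[of _ s])
qed

text \<open>
  Riesz--Fischer produces a vector with the coefficients of \<open>f\<close>; totality identifies it with \<open>f\<close>.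
\<close>

lemma L2_orthonormal_basis_expansion:
  assumes basis: "L2_basis M e J"
    and f: "f \<in> L2 M"
  shows "L2_has_sum M (\<lambda>j x. L2_inner M f (e j) * e j x) J f"
proof -
  have on: "L2_orthonormal M e J" using basis by (simp add: L2_basis_def)
  note e = L2_orthonormalD(1)[OF on]
  have c: "(\<lambda>j. (cmod (L2_inner M f (e j)))\<^sup>2) summable_on J"
    by (rule L2_bessel_summable[OF L2_bessel_orthonormal[OF on] f])
  obtain s where s: "L2_has_sum M (\<lambda>j x. L2_inner M f (e j) * e j x) J s"
      "\<forall>j\<in>J. L2_inner M s (e j) = L2_inner M f (e j)"
    using L2_Riesz_Fischer[OF on c] by blast
  have sL: "s \<in> L2 M" using s(1) by (simp add: L2_has_sum_def)
  have "AE x in M. s x - f x = 0"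
    using basis s(2) L2_diff[OF sL f] by (auto simp: L2_basis_def L2_inner_diff_left[OF sL f e])
  then show ?thesis by (intro L2_has_sum_cong_AE[OF s(1) f]) simp
qed

lemma L2_Parseval:
  assumes basis: "L2_basis M e J"
    and f: "f \<in> L2 M" and g: "g \<in> L2 M"
  shows "((\<lambda>j. L2_inner M f (e j) * cnj (L2_inner M g (e j))) has_sum L2_inner M f g) J"
  using L2_has_sum_inner[OF L2_orthonormal_basis_expansion[OF basis f] g]
  by (simp add: L2_inner_cmult_left L2_inner_commute[of M g "e _"])

section \<open>Arithmetic of digit sequences\<close>

lemma add_mod_if: "a < p \<Longrightarrow> b < p \<Longrightarrow> (a + b) mod p = (if a + b < p then a + b else a + b - p)" for a b p :: nat
  by (simp add: mod_if)

lemma vplus_in: "p \<ge> 2 \<Longrightarrow> x \<in> vilenkin p \<Longrightarrow> y \<in> vilenkin p \<Longrightarrow> vplus p x y \<in> vilenkin p"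
proof -
  assume p: "p \<ge> 2" and x: "x \<in> vilenkin p" and y: "y \<in> vilenkin p"
  obtain k k' where "\<forall>j<k. x j = 0" "\<forall>j<k'. y j = 0" using x y by (auto simp: vilenkin_def)
  then have "\<forall>j<min k k'. vplus p x y j = 0" by (simp add: vplus_def)
  then have "\<exists>k. \<forall>j<k. vplus p x y j = 0" by blast
  moreover have "\<forall>j. vplus p x y j < p" using p by (simp add: vplus_def)
  ultimately show ?thesis by (simp add: vilenkin_def)
qed

lemma vneg_in: "p \<ge> 2 \<Longrightarrow> x \<in> vilenkin p \<Longrightarrow> vneg p x \<in> vilenkin p"
proof -
  assume p: "p \<ge> 2" and x: "x \<in> vilenkin p"
  obtain k where "\<forall>j<k. x j = 0" using x by (auto simp: vilenkin_def)
  then have "\<forall>j<k. vneg p x j = 0" by (simp add: vneg_def)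
  moreover have "\<forall>j. vneg p x j < p" using p by (simp add: vneg_def)
  ultimately show ?thesis by (auto simp: vilenkin_def)
qed

lemma vminus_in: "p \<ge> 2 \<Longrightarrow> x \<in> vilenkin p \<Longrightarrow> y \<in> vilenkin p \<Longrightarrow> vminus p x y \<in> vilenkin p"
  by (simp add: vminus_def vplus_in vneg_in)

lemma vminus_apply: "vminus p x y j = (x j + (p - y j)) mod p"
  by (simp add: vminus_def vplus_def vneg_def mod_add_right_eq)

lemma vdigit_less: "x \<in> vilenkin p \<Longrightarrow> x j < p"
  by (simp add: vilenkin_def)

lemma vplus_commute: "vplus p x y = vplus p y x"
  by (simp add: vplus_def add.commute)

text \<open>
  Subtraction of digits without borrowing. The term \<open>p - b\<close> is \<open>p\<close> when \<open>b = 0\<close>, which the reduction modulo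
  \<open>p\<close> absorbs.
\<close>

lemma digit_move:
  fixes a b c p :: nat
  assumes "a < p" "b < p" "c < p"
  shows "(a + b) mod p = c \<longleftrightarrow> a = (c + (p - b)) mod p"
proof (cases "b = 0")
  case False
  then have "p - b < p" using assms by simp
  then show ?thesis
    unfolding add_mod_if[OF assms(1,2)] add_mod_if[OF assms(3) \<open>p - b < p\<close>] using assms by auto
qed (use assms in auto)

lemma vplus_eq_iff:
  assumes "x \<in> vilenkin p" "h \<in> vilenkin p" "y \<in> vilenkin p"
  shows "vplus p x h j = y j \<longleftrightarrow> x j = vminus p y h j"
  using digit_move[of "x j" p "h j" "y j"] assms by (simp add: vplus_def vminus_apply vdigit_less)

lemma vminus_vplus:
  assumes "p \<ge> 2" "x \<in> vilenkin p" "h \<in> vilenkin p"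
  shows "vminus p (vplus p x h) h = x"
  using vplus_eq_iff[OF assms(2,3) vplus_in[OF assms]] by (auto simp: fun_eq_iff)

lemma vplus_vminus:
  assumes "p \<ge> 2" "x \<in> vilenkin p" "h \<in> vilenkin p"
  shows "vplus p (vminus p x h) h = x"
  using vplus_eq_iff[OF vminus_in[OF assms] assms(3,2)] by (auto simp: fun_eq_iff)

lemma vminus_eq_0_iff:
  assumes "x \<in> vilenkin p" "y \<in> vilenkin p"
  shows "vminus p x y j = 0 \<longleftrightarrow> x j = y j"
proof -
  have y: "y j < p" and x: "x j < p" using assms by (simp_all add: vdigit_less)
  have "(0 + y j) mod p = x j \<longleftrightarrow> 0 = (x j + (p - y j)) mod p"
    using y x by (intro digit_move[OF _ y x]) linarith
  moreover have "(0 + y j) mod p = y j" using y by simp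
  ultimately show ?thesis unfolding vminus_apply by metis
qed

lemma vH_vilenkin: "h \<in> vH p \<Longrightarrow> h \<in> vilenkin p"
  by (simp add: vH_def)

lemma vHperp_eq_vH: "vHperp p = vH p"
  by (simp add: vHperp_def vH_def)

lemma vH_vplus: "p \<ge> 2 \<Longrightarrow> h \<in> vH p \<Longrightarrow> k \<in> vH p \<Longrightarrow> vplus p h k \<in> vH p"
  by (simp add: vH_def vplus_in) (simp add: vplus_def)

lemma vH_vneg: "p \<ge> 2 \<Longrightarrow> h \<in> vH p \<Longrightarrow> vneg p h \<in> vH p"
  by (simp add: vH_def vneg_in) (simp add: vneg_def)

lemma vH_vminus: "p \<ge> 2 \<Longrightarrow> h \<in> vH p \<Longrightarrow> k \<in> vH p \<Longrightarrow> vminus p h k \<in> vH p"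
  by (simp add: vminus_def vH_vplus vH_vneg)

text \<open>
  The elements that detect single digits through the pairing.
\<close>

definition vdelta :: "int \<Rightarrow> digits" where
  "vdelta i = (\<lambda>j. if j = i then 1 else 0)"

lemma vdelta_in: "p \<ge> 2 \<Longrightarrow> vdelta i \<in> vilenkin p"
  by (auto simp: vilenkin_def vdelta_def intro!: exI[of _ i])

subsection \<open>Cylinders\<close>

definition vcyl :: "nat \<Rightarrow> int \<Rightarrow> digits \<Rightarrow> digits set" where
  "vcyl p l x = {y \<in> vilenkin p. \<forall>j\<le>l. y j = x j}"

lemma vcyl_subset: "vcyl p l x \<subseteq> vilenkin p"
  by (auto simp: vcyl_def)

lemma vcyl_self: "x \<in> vilenkin p \<Longrightarrow> x \<in> vcyl p l x"
  by (simp add: vcyl_def)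

lemma vcyl_cong: "(\<And>j. j \<le> l \<Longrightarrow> x j = y j) \<Longrightarrow> vcyl p l x = vcyl p l y"
  by (auto simp: vcyl_def)

lemma vcyl_mono: "y \<in> vcyl p l x \<Longrightarrow> l \<le> m \<Longrightarrow> vcyl p m y \<subseteq> vcyl p l x"
  by (auto simp: vcyl_def)

lemma vnbhd_eq_vcyl: "vnbhd p l = vcyl p l (\<lambda>_. 0)"
  by (simp add: vnbhd_def vcyl_def)

lemma vplus_in_vcyl_iff:
  assumes "p \<ge> 2" "y \<in> vilenkin p" "x \<in> vilenkin p" "h \<in> vilenkin p"
  shows "vplus p y h \<in> vcyl p l x \<longleftrightarrow> y \<in> vcyl p l (vminus p x h)"
  using assms vplus_eq_iff[OF assms(2,4,3)] by (auto simp: vcyl_def vplus_in)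

lemma vminus_in_vnbhd_iff:
  assumes "p \<ge> 2" "x \<in> vilenkin p" "y \<in> vilenkin p"
  shows "vminus p x y \<in> vnbhd p l \<longleftrightarrow> y \<in> vcyl p l x"
  using assms vminus_in[OF assms] by (auto simp: vnbhd_def vcyl_def vminus_eq_0_iff)

lemma vplus_image_vnbhd:
  assumes p: "p \<ge> 2" and x: "x \<in> vilenkin p"
  shows "vplus p x ` vnbhd p l = vcyl p l x"
proof (intro equalityI subsetI)
  fix y assume "y \<in> vplus p x ` vnbhd p l"
  then show "y \<in> vcyl p l x"
    using x p by (auto simp: vnbhd_def vcyl_def vplus_in) (simp add: vplus_def vdigit_less)
next
  fix y assume y: "y \<in> vcyl p l x"
  then have yv: "y \<in> vilenkin p" by (simp add: vcyl_def)
  have "vminus p y x \<in> vnbhd p l"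
    using y by (subst vminus_in_vnbhd_iff[OF p yv x]) (auto simp: vcyl_def x)
  moreover have "y = vplus p x (vminus p y x)" using vplus_vminus[OF p yv x] by (simp add: vplus_commute)
  ultimately show "y \<in> vplus p x ` vnbhd p l" by blast
qed

lemma vH_coset_unique:
  assumes "h \<in> vH p" "k \<in> vH p" "x \<in> vcyl p 0 h" "x \<in> vcyl p 0 k"
  shows "h = k"
proof
  fix j show "h j = k j" using assms by (cases "j \<le> 0") (auto simp: vH_def vcyl_def)
qed

text \<open>
  The representative in \<open>H\<close> of the coset of \<open>U\<close> that contains \<open>x\<close>.
\<close>

definition vhead :: "digits \<Rightarrow> digits" where
  "vhead x = (\<lambda>j. if j \<le> 0 then x j else 0)"

lemma vhead_in: "p \<ge> 2 \<Longrightarrow> x \<in> vilenkin p \<Longrightarrow> vhead x \<in> vH p"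
  by (auto simp: vH_def vilenkin_def vhead_def)

lemma vhead_coset: "x \<in> vilenkin p \<Longrightarrow> x \<in> vcyl p 0 (vhead x)"
  by (auto simp: vcyl_def vhead_def)

lemma countable_finite_support: "countable {x :: digits. finite {j. x j \<noteq> 0}}"
proof (rule countable_image_inj_on)
  let ?g = "\<lambda>x :: digits. {(j, n). n = x j \<and> n \<noteq> 0}"
  have "finite (?g x)" if "finite {j. x j \<noteq> 0}" for x
  proof -
    have "?g x \<subseteq> (\<lambda>j. (j, x j)) ` {j. x j \<noteq> 0}" by auto
    then show ?thesis using that finite_subset by blast
  qed
  then show "countable (?g ` {x. finite {j. x j \<noteq> 0}})"
    by (intro countable_subset[OF _ countable_Collect_finite]) blast
  show "inj_on ?g {x. finite {j. x j \<noteq> 0}}"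
  proof (rule inj_onI, rule ext)
    fix x y :: digits and j assume eq: "?g x = ?g y"
    have "(j, n) \<in> ?g x \<longleftrightarrow> (j, n) \<in> ?g y" for n unfolding eq ..
    then have "n = x j \<and> n \<noteq> 0 \<longleftrightarrow> n = y j \<and> n \<noteq> 0" for n by simp
    from this[of "x j"] this[of "y j"] show "x j = y j" by metis
  qed
qed

lemma finite_support_if_zero_above:
  assumes "x \<in> vilenkin p" "\<forall>j>l. x j = 0"
  shows "finite {j. x j \<noteq> 0}"
proof -
  obtain k where "\<forall>j<k. x j = 0" using assms by (auto simp: vilenkin_def)
  then have "{j. x j \<noteq> 0} \<subseteq> {k..l}" using assms(2) by (force simp: not_less[symmetric])
  then show ?thesis by (rule finite_subset) simp
qed

lemma countable_vH: "countable (vH p)"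
proof (rule countable_subset[OF _ countable_finite_support], rule subsetI)
  fix x assume "x \<in> vH p"
  then have "finite {j. x j \<noteq> 0}"
    by (intro finite_support_if_zero_above[where l = 0]) (auto simp: vH_def)
  then show "x \<in> {x. finite {j. x j \<noteq> 0}}" by simp
qed

definition vcyls :: "nat \<Rightarrow> digits set set" where
  "vcyls p = {vcyl p l x | l x. x \<in> vilenkin p}"

text \<open>
  A cylinder depends on the digits of its centre up to its level only, and these are finitely many nonzero
  ones. Countability makes every open set a countable union of cylinders, so that cylinders generate
  the Borel sets.
\<close>

lemma countable_vcyls: "countable (vcyls p)"
proof (rule countable_subset)
  show "vcyls p \<subseteq> (\<lambda>(l, x). vcyl p l x) ` (UNIV \<times> {x :: digits. finite {j. x j \<noteq> 0}})"
  proof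
    fix S assume "S \<in> vcyls p"
    then obtain l x where S: "S = vcyl p l x" and x: "x \<in> vilenkin p" by (auto simp: vcyls_def)
    define x' where "x' j = (if j \<le> l then x j else 0)" for j
    have "S = vcyl p l x'" unfolding S by (rule vcyl_cong) (simp add: x'_def)
    moreover have "finite {j. x' j \<noteq> 0}"
    proof (rule finite_support_if_zero_above[of _ p l])
      show "x' \<in> vilenkin p" using x by (fastforce simp: vilenkin_def x'_def)
    qed (simp add: x'_def)
    ultimately show "S \<in> (\<lambda>(l, x). vcyl p l x) ` (UNIV \<times> {x. finite {j. x j \<noteq> 0}})" by auto
  qed
  show "countable ((\<lambda>(l, x). vcyl p l x) ` (UNIV \<times> {x :: digits. finite {j. x j \<noteq> 0}}))"
    by (intro countable_image countable_SIGMA countable_finite_support) auto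
qed

text \<open>
  Cylinders form an ultrametric base: two of them are nested or disjoint.
\<close>

lemma Int_stable_vcyls: "Int_stable (insert {} (vcyls p))"
proof -
  have aux: "vcyl p l x \<inter> vcyl p m y \<in> insert {} (vcyls p)" if "l \<le> m" "y \<in> vilenkin p" for l m x y
  proof (cases "\<forall>j\<le>l. y j = x j")
    case True
    then have "y \<in> vcyl p l x" using that by (simp add: vcyl_def)
    then have "vcyl p l x \<inter> vcyl p m y = vcyl p m y" using vcyl_mono[OF _ that(1)] by blast
    then show ?thesis using that by (auto simp: vcyls_def)
  next
    case False
    then obtain j where "j \<le> l" "y j \<noteq> x j" by blast
    then have "vcyl p l x \<inter> vcyl p m y = {}" using that by (auto simp: vcyl_def)
    then show ?thesis by simp
  qed
  have "S \<inter> T \<in> insert {} (vcyls p)" if "S \<in> vcyls p" "T \<in> vcyls p" for S T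
  proof -
    obtain l x m y where ST: "S = vcyl p l x" "T = vcyl p m y" "x \<in> vilenkin p" "y \<in> vilenkin p"
      using \<open>S \<in> vcyls p\<close> \<open>T \<in> vcyls p\<close> by (auto simp: vcyls_def)
    show ?thesis
    proof (cases "l \<le> m")
      case True then show ?thesis using aux[of l m y x] ST by simp
    next
      case False then show ?thesis using aux[of m l x y] ST by (simp add: Int_commute)
    qed
  qed
  then show ?thesis unfolding Int_stable_def by blast
qed

lemma openin_vcyl:
  assumes "p \<ge> 2" "x \<in> vilenkin p"
  shows "openin (vtopology p) (vcyl p l x)"
  unfolding vtopology_def
  by (rule topology_generated_by_Basis) (use assms vplus_image_vnbhd[OF assms, of l] in blast)

lemma openin_vtopology_imp:
  assumes p: "p \<ge> 2" and S: "openin (vtopology p) S"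
  shows "S \<subseteq> vilenkin p \<and> (\<forall>x\<in>S. \<exists>l. vcyl p l x \<subseteq> S)"
proof -
  have "generate_topology_on {vplus p x ` vnbhd p l | x l. x \<in> vilenkin p} S"
    using S unfolding vtopology_def by (rule openin_topology_generated_by)
  then show ?thesis
  proof induction
    case Empty show ?case by simp
  next
    case (Int a b)
    have "\<exists>l. vcyl p l x \<subseteq> a \<inter> b" if x: "x \<in> a \<inter> b" for x
    proof -
      obtain l m where lm: "vcyl p l x \<subseteq> a" "vcyl p m x \<subseteq> b" using Int x by blast
      have "vcyl p (max l m) x \<subseteq> vcyl p l x" "vcyl p (max l m) x \<subseteq> vcyl p m x"
        by (auto simp: vcyl_def)
      with lm show ?thesis by blast
    qed
    then show ?case using Int by blast
  next
    case (UN K)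
    then show ?case by blast
  next
    case (Basis s)
    then obtain x l where s: "s = vcyl p l x" using vplus_image_vnbhd[OF p] by auto
    have "\<exists>l. vcyl p l y \<subseteq> s" if "y \<in> s" for y
      using vcyl_mono[of y p l x l] that s by blast
    then show ?case using s vcyl_subset by blast
  qed
qed

lemma sigma_sets_vcylsI:
  assumes "S \<subseteq> vilenkin p" "\<And>x. x \<in> S \<Longrightarrow> \<exists>l. vcyl p l x \<subseteq> S"
  shows "S \<in> sigma_sets (vilenkin p) (vcyls p)"
proof -
  let ?C = "{c \<in> vcyls p. c \<subseteq> S}"
  have "S = \<Union>?C"
  proof (intro equalityI subsetI)
    fix x assume x: "x \<in> S"
    then obtain l where "vcyl p l x \<subseteq> S" using assms(2) by blast
    moreover have "x \<in> vilenkin p" using x assms(1) by blast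
    ultimately show "x \<in> \<Union>?C" using vcyl_self by (fastforce simp: vcyls_def)
  qed auto
  moreover have "\<Union>?C \<in> sigma_sets (vilenkin p) (vcyls p)"
    by (rule sigma_sets_UNION) (auto intro: countable_subset[OF _ countable_vcyls] sigma_sets.Basic)
  ultimately show ?thesis by simp
qed

subsection \<open>The pairing\<close>

definition vroot :: "nat \<Rightarrow> complex" where
  "vroot p = exp (2 * of_real pi * \<i> / of_nat p)"

lemma vroot_power_eq_1_iff: "p \<ge> 2 \<Longrightarrow> vroot p ^ n = 1 \<longleftrightarrow> p dvd n"
  using complex_root_unity_eq_1[of p n]
  by (simp add: vroot_def exp_of_nat_mult[symmetric] mult_ac)

lemma vroot_power_mod: "p \<ge> 2 \<Longrightarrow> vroot p ^ (n mod p) = vroot p ^ n"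
proof -
  assume p: "p \<ge> 2"
  have "vroot p ^ n = vroot p ^ (p * (n div p) + n mod p)" by simp
  also have "\<dots> = vroot p ^ (n mod p)"
    using vroot_power_eq_1_iff[OF p, of p] by (simp only: power_add power_mult) simp
  finally show ?thesis by simp
qed

lemma vroot_norm: "cmod (vroot p) = 1"
  by (simp add: vroot_def norm_exp_eq_Re)

lemma finite_pairing_support:
  assumes "x \<in> vilenkin p" "w \<in> vilenkin p"
  shows "finite {j. x j * w (1 - j) \<noteq> 0}"
proof -
  obtain k k' where "\<forall>j<k. x j = 0" "\<forall>j<k'. w j = 0" using assms by (auto simp: vilenkin_def)
  then have "{j. x j * w (1 - j) \<noteq> 0} \<subseteq> {k..1 - k'}"
    by (auto simp: not_less[symmetric] algebra_simps)
  then show ?thesis by (rule finite_subset) simp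
qed

text \<open>
  Any finite set containing the support may be summed over. This allows one common index set when several
  pairings are compared, as in the multiplicativity of the pairing below.
\<close>

lemma vchar_eq_power:
  assumes "finite S" "{j. x j * w (1 - j) \<noteq> 0} \<subseteq> S"
  shows "vchar p x w = vroot p ^ (\<Sum>j\<in>S. x j * w (1 - j))"
proof -
  have "(\<Sum>j | x j * w (1 - j) \<noteq> 0. x j * w (1 - j)) = (\<Sum>j\<in>S. x j * w (1 - j))"
    using assms by (intro sum.mono_neutral_left) auto
  then show ?thesis
    unfolding vchar_def vroot_def by (simp add: exp_of_nat_mult[symmetric] mult_ac)
qed

lemma vchar_norm: "cmod (vchar p x w) = 1"
proof -
  have "vchar p x w = vroot p ^ (\<Sum>j | x j * w (1 - j) \<noteq> 0. x j * w (1 - j))"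
    unfolding vchar_def vroot_def by (simp add: exp_of_nat_mult[symmetric] mult_ac)
  then show ?thesis by (simp add: norm_power vroot_norm)
qed

lemma vchar_mult_cnj: "vchar p x w * cnj (vchar p x w) = 1"
  using complex_norm_square[of "vchar p x w"] by (simp add: vchar_norm)

lemma vchar_commute: "vchar p x w = vchar p w x"
proof -
  have "(\<Sum>j | x j * w (1 - j) \<noteq> 0. x j * w (1 - j)) = (\<Sum>j | w j * x (1 - j) \<noteq> 0. w j * x (1 - j))"
    by (rule sum.reindex_bij_witness[of _ "\<lambda>j. 1 - j" "\<lambda>j. 1 - j"]) auto
  then show ?thesis by (simp add: vchar_def)
qed

lemma vchar_add_left:
  assumes p: "p \<ge> 2" and xyw: "x \<in> vilenkin p" "y \<in> vilenkin p" "w \<in> vilenkin p"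
  shows "vchar p (vplus p x y) w = vchar p x w * vchar p y w"
proof -
  let ?S = "{j. x j * w (1 - j) \<noteq> 0} \<union> {j. y j * w (1 - j) \<noteq> 0} \<union> {j. vplus p x y j * w (1 - j) \<noteq> 0}"
  have fin: "finite ?S" by (intro finite_UnI finite_pairing_support[of _ p] vplus_in[OF p] xyw)
  have "vroot p ^ (((a + b) mod p) * c) = vroot p ^ (a * c) * vroot p ^ (b * c)" for a b c
    by (simp add: power_mult vroot_power_mod[OF p] power_add power_mult_distrib)
  then have "vroot p ^ (\<Sum>j\<in>?S. vplus p x y j * w (1 - j))
      = vroot p ^ (\<Sum>j\<in>?S. x j * w (1 - j)) * vroot p ^ (\<Sum>j\<in>?S. y j * w (1 - j))"
    by (simp add: power_sum vplus_def prod.distrib)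
  moreover have "vchar p (vplus p x y) w = vroot p ^ (\<Sum>j\<in>?S. vplus p x y j * w (1 - j))"
    "vchar p x w = vroot p ^ (\<Sum>j\<in>?S. x j * w (1 - j))"
    "vchar p y w = vroot p ^ (\<Sum>j\<in>?S. y j * w (1 - j))"
    by (rule vchar_eq_power[OF fin], blast)+
  ultimately show ?thesis by simp
qed

lemma vchar_minus_left:
  assumes p: "p \<ge> 2" and xyw: "x \<in> vilenkin p" "y \<in> vilenkin p" "w \<in> vilenkin p"
  shows "vchar p (vminus p x y) w = vchar p x w * cnj (vchar p y w)"
proof -
  have "vchar p x w = vchar p (vminus p x y) w * vchar p y w"
    using vchar_add_left[OF p vminus_in[OF p xyw(1,2)] xyw(2,3)] vplus_vminus[OF p xyw(1,2)] by simp
  then show ?thesis using vchar_mult_cnj[of p y w] by (simp add: mult.assoc)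
qed

lemma vchar_minus_right:
  assumes "p \<ge> 2" "x \<in> vilenkin p" "y \<in> vilenkin p" "w \<in> vilenkin p"
  shows "vchar p w (vminus p x y) = vchar p w x * cnj (vchar p w y)"
  using vchar_minus_left[OF assms] by (simp add: vchar_commute[of p w])

lemma vchar_add_right:
  assumes "p \<ge> 2" "x \<in> vilenkin p" "y \<in> vilenkin p" "w \<in> vilenkin p"
  shows "vchar p w (vplus p x y) = vchar p w x * vchar p w y"
  using vchar_add_left[OF assms] by (simp add: vchar_commute[of p w])

lemma vchar_vH: "p \<ge> 2 \<Longrightarrow> h \<in> vH p \<Longrightarrow> k \<in> vH p \<Longrightarrow> vchar p h k = 1"
  using vHperp_eq_annihilator[of p] by (auto simp: vHperp_eq_vH)

lemma vchar_vdelta: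
  assumes p: "p \<ge> 2" and x: "x \<in> vilenkin p"
  shows "vchar p x (vdelta (1 - j)) = 1 \<longleftrightarrow> x j = 0"
proof -
  have "vchar p x (vdelta (1 - j)) = vroot p ^ (\<Sum>i\<in>{j}. x i * vdelta (1 - j) (1 - i))"
    by (rule vchar_eq_power) (auto simp: vdelta_def)
  then have "vchar p x (vdelta (1 - j)) = 1 \<longleftrightarrow> p dvd x j"
    by (simp add: vdelta_def vroot_power_eq_1_iff[OF p])
  also have "\<dots> \<longleftrightarrow> x j = 0" using vdigit_less[OF x, of j] by (auto dest: dvd_imp_le)
  finally show ?thesis .
qed

lemma finite_char_subgroup:
  assumes p: "p \<ge> 2"
  shows "finite {k \<in> vH p. \<forall>j\<le>-int m. k j = 0}"
proof (rule finite_subset)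
  show "{k \<in> vH p. \<forall>j\<le>-int m. k j = 0} \<subseteq>
     {f. \<forall>x. (x \<in> {-int m<..0} \<longrightarrow> f x \<in> {..<p}) \<and> (x \<notin> {-int m<..0} \<longrightarrow> f x = 0)}"
    by (auto simp: vH_def vilenkin_def not_le not_less)
qed (rule finite_set_of_finite_funs; simp)

text \<open>
  Orthogonality of characters for the finite quotient \<open>U / U\<^sub>m\<close>: the characters of \<open>U\<close> that are trivial
  on \<open>U\<^sub>m\<close> form a finite group, and the sum over it vanishes at each point where one of them differs from 1,
  because multiplication by that character permutes the summands. It expresses the indicator of a small ball
  through characters.
\<close>

lemma indicator_vnbhd_char_sum:
  fixes m :: nat
  assumes p: "p \<ge> 2" and z: "z \<in> vnbhd p 0"
  defines "K \<equiv> {k \<in> vH p. \<forall>j\<le>-int m. k j = 0}"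
  shows "(\<Sum>k\<in>K. vchar p z k) = of_nat (card K) * indicator (vnbhd p (int m)) z"
    and "card K > 0"
proof -
  have zv: "z \<in> vilenkin p" and z0: "\<And>j. j \<le> 0 \<Longrightarrow> z j = 0" using z by (auto simp: vnbhd_def)
  have "(\<lambda>_. 0) \<in> K" using p by (auto simp: K_def vH_def vilenkin_def)
  then show "card K > 0" using finite_char_subgroup[OF p, of m] by (auto simp: K_def card_gt_0_iff)
  have Kv: "k \<in> vilenkin p" if "k \<in> K" for k using that by (auto simp: K_def vH_def)
  show "(\<Sum>k\<in>K. vchar p z k) = of_nat (card K) * indicator (vnbhd p (int m)) z"
  proof (cases "z \<in> vnbhd p (int m)")
    case True
    have "vchar p z k = 1" if "k \<in> K" for k
    proof -
      have "z j * k (1 - j) = 0" for j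
      proof (cases "j \<le> int m")
        case True with \<open>z \<in> vnbhd p (int m)\<close> show ?thesis by (simp add: vnbhd_def)
      next
        case False
        then have "1 - j \<le> - int m" by simp
        with that show ?thesis by (simp add: K_def)
      qed
      then show ?thesis by (simp add: vchar_def)
    qed
    then show ?thesis using True by simp
  next
    case False
    then obtain j where j: "j \<le> int m" "z j \<noteq> 0" using zv by (auto simp: vnbhd_def)
    then have j1: "j \<ge> 1" using z0[of j] by linarith
    let ?d = "vdelta (1 - j)"
    have dK: "?d \<in> K" using j1 j(1) vdelta_in[OF p, of "1 - j"]
      by (auto simp: K_def vH_def vdelta_def)
    have ne: "vchar p z ?d \<noteq> 1" using vchar_vdelta[OF p zv] j by simp
    have "(\<Sum>k\<in>K. vchar p z k) = (\<Sum>k\<in>K. vchar p z (vplus p k ?d))"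
    proof (rule sum.reindex_bij_witness[of _ "\<lambda>k. vplus p k ?d" "\<lambda>k. vminus p k ?d"])
      fix k assume k: "k \<in> K"
      show "vplus p (vminus p k ?d) ?d = k" "vminus p (vplus p k ?d) ?d = k"
        "vchar p z (vplus p (vminus p k ?d) ?d) = vchar p z k"
        by (simp_all add: vplus_vminus vminus_vplus p Kv k vdelta_in)
      show "vplus p k ?d \<in> K" using k dK p
        by (auto simp: K_def vH_vplus) (simp add: vplus_def)
      show "vminus p k ?d \<in> K" using k dK p
        by (auto simp: K_def vH_vminus) (simp add: vminus_apply)
    qed
    also have "\<dots> = (\<Sum>k\<in>K. vchar p z k) * vchar p z ?d"
      unfolding sum_distrib_right
      by (intro sum.cong refl) (simp add: vchar_add_right p Kv vdelta_in zv)
    finally have "(\<Sum>k\<in>K. vchar p z k) = 0" using ne by simp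
    then show ?thesis using False by simp
  qed
qed

section \<open>Haar measure and an explicit orthonormal basis\<close>

locale vilenkin_haar =
  fixes p :: nat and M :: "digits measure"
  assumes p: "p \<ge> 2" and haar: "vhaar p M"
begin

lemma space_M: "space M = vilenkin p"
  using haar by (simp add: vhaar_def)

text \<open>
  Every open set is a countable union of cylinders, hence the cylinders alone generate the Borel sets and
  measurability and uniqueness questions reduce to them.
\<close>

lemma sets_M: "sets M = sigma_sets (vilenkin p) (vcyls p)"
proof -
  have "sets M = sigma_sets (vilenkin p) {S. openin (vtopology p) S}"
    using haar by (simp add: vhaar_def)
  also have "\<dots> = sigma_sets (vilenkin p) (vcyls p)"
  proof
    show "sigma_sets (vilenkin p) {S. openin (vtopology p) S} \<subseteq> sigma_sets (vilenkin p) (vcyls p)"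
      by (rule sigma_sets_mono) (use openin_vtopology_imp[OF p] in \<open>auto intro!: sigma_sets_vcylsI\<close>)
    show "sigma_sets (vilenkin p) (vcyls p) \<subseteq> sigma_sets (vilenkin p) {S. openin (vtopology p) S}"
      by (rule sigma_sets_mono') (auto simp: vcyls_def intro: openin_vcyl[OF p])
  qed
  finally show ?thesis .
qed

lemma sets_MI:
  assumes "S \<subseteq> vilenkin p" "\<And>x. x \<in> S \<Longrightarrow> \<exists>l. vcyl p l x \<subseteq> S"
  shows "S \<in> sets M"
  unfolding sets_M using assms by (rule sigma_sets_vcylsI)

lemma sets_vcyl [measurable]: "vcyl p l x \<in> sets M"
  by (rule sets_MI[OF vcyl_subset]) (use vcyl_mono in blast)

lemma measurable_digit [measurable]: "(\<lambda>x. x j) \<in> measurable M (count_space UNIV)"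
proof (subst measurable_count_space_eq2_countable, intro conjI ballI)
  fix n :: nat
  show "(\<lambda>x. x j) -` {n} \<inter> space M \<in> sets M"
    by (rule sets_MI) (auto simp: space_M vcyl_def intro!: exI[of _ j])
qed auto

lemma measurable_translate [measurable]:
  assumes h: "h \<in> vilenkin p"
  shows "(\<lambda>x. vplus p x h) \<in> measurable M M"
proof (rule measurable_sigma_sets[OF sets_M])
  show "vcyls p \<subseteq> Pow (vilenkin p)" by (auto simp: vcyls_def vcyl_def)
  show "(\<lambda>x. vplus p x h) \<in> space M \<rightarrow> vilenkin p" using h by (auto simp: space_M vplus_in p)
  fix A assume "A \<in> vcyls p"
  then obtain l x where A: "A = vcyl p l x" and x: "x \<in> vilenkin p" by (auto simp: vcyls_def)
  have "(\<lambda>x. vplus p x h) -` A \<inter> space M = vcyl p l (vminus p x h)"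
    using vplus_in_vcyl_iff[OF p _ x h, of _ l] vcyl_subset[of p l "vminus p x h"] unfolding A space_M by blast
  then show "(\<lambda>x. vplus p x h) -` A \<inter> space M \<in> sets M" by simp
qed

text \<open>
  Invariance under images, restated for the push-forward: change of variables
  in integrals is then an instance of the general theory.
\<close>

lemma distr_translate:
  assumes h: "h \<in> vilenkin p"
  shows "distr M M (\<lambda>x. vplus p x h) = M"
proof (rule measure_eqI)
  fix A assume "A \<in> sets (distr M M (\<lambda>x. vplus p x h))"
  then have A: "A \<in> sets M" by simp
  let ?B = "(\<lambda>x. vplus p x h) -` A \<inter> space M"
  have B: "?B \<in> sets M" using measurable_translate[OF h] A by (rule measurable_sets)
  have "vplus p h ` ?B = A"
  proof (intro equalityI subsetI)
    fix y assume y: "y \<in> A"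
    then have yv: "y \<in> vilenkin p" using sets.sets_into_space[OF A] space_M by blast
    have "y = vplus p h (vminus p y h)" using vplus_vminus[OF p yv h] by (simp add: vplus_commute)
    moreover have "vminus p y h \<in> ?B"
      using y by (simp add: space_M vminus_in p yv h vplus_vminus)
    ultimately show "y \<in> vplus p h ` ?B" by blast
  qed (auto simp: vplus_commute)
  moreover have "emeasure M (vplus p h ` ?B) = emeasure M ?B"
    using haar h B unfolding vhaar_def by blast
  ultimately show "emeasure (distr M M (\<lambda>x. vplus p x h)) A = emeasure M A"
    using A by (simp add: emeasure_distr measurable_translate h)
qed simp

lemma borel_translate:
  "h \<in> vilenkin p \<Longrightarrow> f \<in> borel_measurable M \<Longrightarrow> (\<lambda>x. f (vplus p x h)) \<in> borel_measurable M"
  by (rule measurable_compose[OF measurable_translate])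

lemma integral_translate:
  fixes f :: "digits \<Rightarrow> complex"
  assumes h: "h \<in> vilenkin p" and f: "f \<in> borel_measurable M"
  shows "(\<integral>x. f (vplus p x h) \<partial>M) = (\<integral>x. f x \<partial>M)"
  using integral_distr[OF measurable_translate[OF h] f] by (simp add: distr_translate h)

lemma integrable_translate:
  fixes f :: "digits \<Rightarrow> 'b :: {banach, second_countable_topology}"
  assumes h: "h \<in> vilenkin p" and f: "integrable M f"
  shows "integrable M (\<lambda>x. f (vplus p x h))"
  using integrable_distr_eq[OF measurable_translate[OF h], of f] f by (simp add: distr_translate h)

lemma emeasure_vnbhd_0: "emeasure M (vnbhd p 0) = 1"
  using haar by (simp add: vhaar_def)

lemma sets_vnbhd [measurable]: "vnbhd p l \<in> sets M"
  by (simp add: vnbhd_eq_vcyl)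

lemma emeasure_coset: "h \<in> vilenkin p \<Longrightarrow> emeasure M (vcyl p 0 h) = 1"
proof -
  assume h: "h \<in> vilenkin p"
  have "emeasure M (vplus p h ` vnbhd p 0) = emeasure M (vnbhd p 0)"
    using haar h sets_vnbhd unfolding vhaar_def by blast
  then show ?thesis by (simp add: vplus_image_vnbhd[OF p h] emeasure_vnbhd_0)
qed

lemma vH_in_UN: "x \<in> vilenkin p \<Longrightarrow> \<exists>h\<in>vH p. x \<in> vcyl p 0 h"
  using vhead_in[OF p] vhead_coset by blast

sublocale sigma_finite_measure M
proof
  show "\<exists>A. countable A \<and> A \<subseteq> sets M \<and> \<Union>A = space M \<and> (\<forall>a\<in>A. emeasure M a \<noteq> \<infinity>)"
  proof (intro exI[of _ "vcyl p 0 ` vH p"] conjI)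
    show "\<Union>(vcyl p 0 ` vH p) = space M"
      using vH_in_UN vcyl_subset by (fastforce simp: space_M)
  qed (auto simp: countable_vH emeasure_coset vH_vilenkin)
qed

text \<open>
  \<open>H\<close> is countable, so null sets may be checked on the cosets of \<open>U\<close> one at a time.
\<close>

lemma AE_by_cosets:
  assumes "\<And>h. h \<in> vH p \<Longrightarrow> AE x in M. x \<in> vcyl p 0 h \<longrightarrow> P x"
  shows "AE x in M. P x"
proof -
  have "AE x in M. \<forall>h\<in>vH p. x \<in> vcyl p 0 h \<longrightarrow> P x"
    unfolding AE_ball_countable[OF countable_vH] using assms by blast
  then show ?thesis using AE_space by eventually_elim (use vH_in_UN in \<open>auto simp: space_M\<close>)
qed

lemma vchar_limit:
  assumes "x \<in> vilenkin p" "w \<in> vilenkin p"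
  shows "(\<lambda>n. vroot p ^ (\<Sum>j\<in>{-int n..int n}. x j * w (1 - j))) \<longlonglongrightarrow> vchar p x w"
proof (rule tendsto_eventually)
  let ?S = "{j. x j * w (1 - j) \<noteq> 0}"
  have fin: "finite ?S" by (rule finite_pairing_support[OF assms])
  obtain N :: nat where N: "\<And>j. j \<in> ?S \<Longrightarrow> nat \<bar>j\<bar> \<le> N"
    using finite_nat_set_iff_bounded_le[of "(\<lambda>j. nat \<bar>j\<bar>) ` ?S"] fin by auto
  show "\<forall>\<^sub>F n in sequentially. vroot p ^ (\<Sum>j\<in>{-int n..int n}. x j * w (1 - j)) = vchar p x w"
  proof (rule eventually_sequentiallyI[of N])
    fix n assume n: "N \<le> n"
    have "?S \<subseteq> {-int n..int n}"
    proof
      fix j assume "j \<in> ?S"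
      then have "nat \<bar>j\<bar> \<le> n" using N n by (meson order_trans)
      then show "j \<in> {-int n..int n}" by auto
    qed
    then show "vroot p ^ (\<Sum>j\<in>{-int n..int n}. x j * w (1 - j)) = vchar p x w"
      by (intro vchar_eq_power[symmetric]) auto
  qed
qed

text \<open>
  The pairing is a pointwise limit of its truncations to finitely many digits, each of them eventually exact.
\<close>

lemma borel_measurable_vchar_pair:
  assumes "vhaar p N"
  shows "(\<lambda>(x, w). vchar p x w) \<in> borel_measurable (M \<Otimes>\<^sub>M N)"
proof (rule borel_measurable_LIMSEQ_metric)
  interpret N: vilenkin_haar p N by unfold_locales (use p assms in auto)
  fix n :: nat
  have "(\<lambda>z. \<Sum>j\<in>{-int n..int n}. fst z j * snd z (1 - j)) \<in> measurable (M \<Otimes>\<^sub>M N) (count_space UNIV)"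
  proof (rule measurable_sum_nat)
    fix j
    have 1: "(\<lambda>z. fst z j) \<in> measurable (M \<Otimes>\<^sub>M N) (count_space UNIV)"
      by (rule measurable_compose[OF measurable_fst measurable_digit])
    have 2: "(\<lambda>z. snd z (1 - j)) \<in> measurable (M \<Otimes>\<^sub>M N) (count_space UNIV)"
      by (rule measurable_compose[OF measurable_snd N.measurable_digit])
    show "(\<lambda>z. fst z j * snd z (1 - j)) \<in> measurable (M \<Otimes>\<^sub>M N) (count_space UNIV)"
    proof (rule measurable_compose_countable[OF _ 1])
      show "(\<lambda>z. i * snd z (1 - j)) \<in> measurable (M \<Otimes>\<^sub>M N) (count_space UNIV)" for i
        by (rule measurable_compose[OF 2]) simp
    qed
  qed
  then show "(\<lambda>z. vroot p ^ (\<Sum>j\<in>{-int n..int n}. fst z j * snd z (1 - j))) \<in> borel_measurable (M \<Otimes>\<^sub>M N)"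
    by (rule measurable_compose) simp
next
  interpret N: vilenkin_haar p N by unfold_locales (use p assms in auto)
  fix z assume "z \<in> space (M \<Otimes>\<^sub>M N)"
  then show "(\<lambda>n. vroot p ^ (\<Sum>j\<in>{-int n..int n}. fst z j * snd z (1 - j))) \<longlonglongrightarrow> (case z of (x, w) \<Rightarrow> vchar p x w)"
    by (auto simp: space_pair_measure space_M N.space_M intro!: vchar_limit)
qed

lemma borel_measurable_vchar [measurable]:
  assumes "w \<in> vilenkin p"
  shows "(\<lambda>x. vchar p x w) \<in> borel_measurable M"
  using measurable_compose[OF measurable_Pair1' borel_measurable_vchar_pair[OF haar], of w]
    measurable_compose[OF measurable_Pair2'[of w M M] borel_measurable_vchar_pair[OF haar]] assms
  by (simp add: space_M)

lemma integrable_indicator_coset: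
  "h \<in> vilenkin p \<Longrightarrow> integrable M (indicator (vcyl p 0 h) :: digits \<Rightarrow> complex)"
proof -
  assume h: "h \<in> vilenkin p"
  have "integrable M (\<lambda>x. complex_of_real (indicator (vcyl p 0 h) x))"
    by (intro integrable_of_real integrable_real_indicator) (simp_all add: emeasure_coset h)
  then show ?thesis by (simp add: of_real_indicator)
qed

lemma integrable_mult_vchar:
  assumes f: "integrable M f" and w: "w \<in> vilenkin p"
  shows "integrable M (\<lambda>x. f x * vchar p x w)"
proof (rule Bochner_Integration.integrable_bound[OF f])
  show "(\<lambda>x. f x * vchar p x w) \<in> borel_measurable M"
    using f w by (intro borel_measurable_times borel_measurable_vchar borel_measurable_integrable)
qed (simp add: norm_mult vchar_norm)

lemma integrable_mult_cnj_vchar: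
  assumes f: "integrable M f" and w: "w \<in> vilenkin p"
  shows "integrable M (\<lambda>x. f x * cnj (vchar p x w))"
proof (rule Bochner_Integration.integrable_bound[OF f])
  show "(\<lambda>x. f x * cnj (vchar p x w)) \<in> borel_measurable M"
    using f w by (intro borel_measurable_times borel_measurable_cnj borel_measurable_vchar borel_measurable_integrable)
qed (simp add: norm_mult vchar_norm)

text \<open>
  The group \<open>U\<close> is its own annihilator under the pairing. For \<open>\<omega>\<close> outside it, some translation by an element of
  \<open>U\<close> multiplies the integral by a number different from 1.
\<close>

lemma integral_char_unit:
  assumes w: "w \<in> vilenkin p"
  shows "(\<integral>x. indicator (vnbhd p 0) x * vchar p x w \<partial>M) = indicator (vnbhd p 0) w"
proof (cases "w \<in> vnbhd p 0")
  case True
  have "indicator (vnbhd p 0) x * vchar p x w = indicator (vnbhd p 0) x" for x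
  proof (cases "x \<in> vnbhd p 0")
    case x: True
    have "x j * w (1 - j) = 0" for j
      using x \<open>w \<in> vnbhd p 0\<close> by (cases "j \<le> 0") (auto simp: vnbhd_def)
    then show ?thesis by (simp add: vchar_def)
  qed simp
  then have "(\<integral>x. indicator (vnbhd p 0) x * vchar p x w \<partial>M) = (\<integral>x. indicator (vnbhd p 0) x \<partial>M)"
    by (simp only:)
  also have "\<dots> = (\<integral>x. complex_of_real (indicator (vnbhd p 0) x) \<partial>M)" by (simp add: of_real_indicator)
  also have "\<dots> = of_real (\<integral>x. indicator (vnbhd p 0) x \<partial>M)" by (rule integral_complex_of_real)
  also have "(\<integral>x. indicator (vnbhd p 0) x \<partial>M) = measure M (vnbhd p 0)"
    using sets.sets_into_space[OF sets_vnbhd[of 0]] by (simp add: Int_absorb2)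
  finally show ?thesis using True emeasure_vnbhd_0 by (simp add: measure_def)
next
  case False
  then obtain j where j: "j \<le> 0" "w j \<noteq> 0" using w by (auto simp: vnbhd_def)
  let ?d = "vdelta (1 - j)"
  have d: "?d \<in> vilenkin p" by (rule vdelta_in[OF p])
  have ne: "vchar p ?d w \<noteq> 1" using vchar_vdelta[OF p w, of j] j by (simp add: vchar_commute[of p ?d])
  let ?I = "\<integral>x. indicator (vnbhd p 0) x * vchar p x w \<partial>M"
  have "?I = (\<integral>x. indicator (vnbhd p 0) (vplus p x ?d) * vchar p (vplus p x ?d) w \<partial>M)"
    by (rule integral_translate[OF d, symmetric]) (use w in measurable)
  also have "\<dots> = (\<integral>x. (indicator (vnbhd p 0) x * vchar p x w) * vchar p ?d w \<partial>M)"
  proof (rule Bochner_Integration.integral_cong[OF refl])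
    fix x assume "x \<in> space M"
    then have x: "x \<in> vilenkin p" by (simp add: space_M)
    have "vplus p x ?d \<in> vnbhd p 0 \<longleftrightarrow> x \<in> vnbhd p 0"
      using j x vplus_in[OF p x d] by (auto simp: vnbhd_def vplus_def vdelta_def vdigit_less)
    then show "indicator (vnbhd p 0) (vplus p x ?d) * vchar p (vplus p x ?d) w
      = (indicator (vnbhd p 0) x * vchar p x w) * vchar p ?d w"
      by (simp add: vchar_add_left[OF p x d w] indicator_def)
  qed
  also have "\<dots> = ?I * vchar p ?d w" by simp
  finally have "?I = 0" using ne by simp
  then show ?thesis using False by simp
qed

lemma integral_char_coset:
  assumes h: "h \<in> vilenkin p" and w: "w \<in> vilenkin p"
  shows "(\<integral>x. indicator (vcyl p 0 h) x * vchar p x w \<partial>M) = vchar p h w * indicator (vnbhd p 0) w"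
proof -
  have "(\<integral>x. indicator (vcyl p 0 h) x * vchar p x w \<partial>M)
      = (\<integral>x. indicator (vcyl p 0 h) (vplus p x h) * vchar p (vplus p x h) w \<partial>M)"
    by (rule integral_translate[OF h, symmetric]) (use w in measurable)
  also have "\<dots> = (\<integral>x. (indicator (vnbhd p 0) x * vchar p x w) * vchar p h w \<partial>M)"
  proof (rule Bochner_Integration.integral_cong[OF refl])
    fix x assume "x \<in> space M"
    then have x: "x \<in> vilenkin p" by (simp add: space_M)
    have "vminus p h h = (\<lambda>_. 0)" using h by (auto simp: vminus_eq_0_iff)
    then have "vplus p x h \<in> vcyl p 0 h \<longleftrightarrow> x \<in> vnbhd p 0"
      by (simp add: vplus_in_vcyl_iff[OF p x h h] vnbhd_eq_vcyl)
    then show "indicator (vcyl p 0 h) (vplus p x h) * vchar p (vplus p x h) w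
      = (indicator (vnbhd p 0) x * vchar p x w) * vchar p h w"
      by (simp add: vchar_add_left[OF p x h w] indicator_def)
  qed
  also have "\<dots> = vchar p h w * indicator (vnbhd p 0) w" by (simp add: integral_char_unit[OF w])
  finally show ?thesis .
qed

end

lemma cnj_indicator [simp]: "cnj (indicator A x) = indicator A x"
  by (simp add: indicator_def)

text \<open>
  The characters of \<open>U\<close>, indexed by \<open>k \<in> H\<close>, transported to each coset \<open>U \<oplus> h\<close>. As \<open>\<chi>(h, k) = 1\<close>, no
  phase arises from the choice of origin in the coset.
\<close>

definition vbasis :: "nat \<Rightarrow> digits \<times> digits \<Rightarrow> digits \<Rightarrow> complex" where
  "vbasis p = (\<lambda>(h, k) x. indicator (vcyl p 0 h) x * vchar p x k)"

text \<open>
  The Fourier transform of \<open>vbasis p (h, k)\<close>, see \<open>vfourier_L1_vbasis\<close>.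
\<close>

definition vdual :: "nat \<Rightarrow> digits \<times> digits \<Rightarrow> digits \<Rightarrow> complex" where
  "vdual p = (\<lambda>(h, k) w. cnj (vbasis p (k, h) w))"

lemma vbasis_norm_le: "cmod (vbasis p j x) \<le> 1"
  by (cases j) (auto simp: vbasis_def norm_mult vchar_norm indicator_def)

lemma vdual_norm_le: "cmod (vdual p j x) \<le> 1"
  by (cases j) (simp add: vdual_def vbasis_norm_le)

context vilenkin_haar
begin

abbreviation J :: "(digits \<times> digits) set" where "J \<equiv> vH p \<times> vH p"

lemma integrable_vbasis: "j \<in> J \<Longrightarrow> integrable M (vbasis p j)"
  by (cases j) (auto simp: vbasis_def intro!: integrable_mult_vchar integrable_indicator_coset vH_vilenkin)

lemma borel_vbasis: "j \<in> J \<Longrightarrow> vbasis p j \<in> borel_measurable M"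
  by (rule borel_measurable_integrable[OF integrable_vbasis])

lemma vbasis_L2: "j \<in> J \<Longrightarrow> vbasis p j \<in> L2 M"
proof -
  assume j: "j \<in> J"
  obtain h k where hk: "j = (h, k)" "h \<in> vH p" "k \<in> vH p" using j by auto
  have "(\<lambda>x. (cmod (vbasis p j x))\<^sup>2) = indicator (vcyl p 0 h)"
    by (auto simp: fun_eq_iff hk vbasis_def norm_mult vchar_norm indicator_def)
  then show ?thesis using borel_vbasis[OF j] hk
    by (simp add: L2_def integrable_indicator_iff emeasure_coset vH_vilenkin)
qed

lemma integral_vbasis_char:
  assumes h: "h \<in> vH p" and k: "k \<in> vH p" and w: "w \<in> vilenkin p"
  shows "(\<integral>x. vbasis p (h, k) x * cnj (vchar p x w) \<partial>M) = cnj (vbasis p (k, h) w)"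
proof -
  note v = vH_vilenkin[OF h] vH_vilenkin[OF k]
  have "(\<integral>x. vbasis p (h, k) x * cnj (vchar p x w) \<partial>M)
      = (\<integral>x. indicator (vcyl p 0 h) x * vchar p x (vminus p k w) \<partial>M)"
    by (intro Bochner_Integration.integral_cong refl)
       (simp add: vbasis_def space_M vchar_minus_right[OF p v(2) w])
  also have "\<dots> = vchar p h (vminus p k w) * indicator (vnbhd p 0) (vminus p k w)"
    by (rule integral_char_coset) (simp_all add: v vminus_in p w)
  also have "\<dots> = cnj (vbasis p (k, h) w)"
    by (simp add: vbasis_def vchar_minus_right[OF p v(2) w v(1)] vchar_vH[OF p h k]
        vchar_commute[of p h w] indicator_def vminus_in_vnbhd_iff[OF p v(2) w])
  finally show ?thesis .
qed

lemma vfourier_L1_vbasis: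
  "j \<in> J \<Longrightarrow> w \<in> vilenkin p \<Longrightarrow> vfourier_L1 p M (vbasis p j) w = vdual p j w"
  by (cases j) (auto simp: vfourier_L1_def vdual_def integral_vbasis_char)

lemma integral_vdual_char:
  "j \<in> J \<Longrightarrow> x \<in> vilenkin p \<Longrightarrow> (\<integral>w. vdual p j w * vchar p x w \<partial>M) = vbasis p j x"
proof -
  assume j: "j \<in> J" and x: "x \<in> vilenkin p"
  obtain h k where hk: "j = (h, k)" "h \<in> vH p" "k \<in> vH p" using j by auto
  have "(\<integral>w. vdual p j w * vchar p x w \<partial>M) = (\<integral>w. cnj (vbasis p (k, h) w * cnj (vchar p w x)) \<partial>M)"
    by (simp add: vdual_def hk vchar_commute[of p x] mult.commute del: Bochner_Integration.integral_cnj)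
  also have "\<dots> = cnj (cnj (vbasis p (h, k) x))"
    by (subst Bochner_Integration.integral_cnj) (simp add: integral_vbasis_char[OF hk(3,2) x])
  finally show ?thesis by (simp add: hk)
qed

lemma vbasis_orthonormal: "L2_orthonormal M (vbasis p) J"
  unfolding L2_orthonormal_def
proof (intro conjI ballI vbasis_L2)
  fix i j assume ij: "i \<in> J" "j \<in> J"
  obtain h k h' k' where hk: "i = (h, k)" "j = (h', k')" "h \<in> vH p" "k \<in> vH p" "h' \<in> vH p" "k' \<in> vH p"
    using ij by auto
  note v = hk(3-6)[THEN vH_vilenkin]
  show "L2_inner M (vbasis p i) (vbasis p j) = (if i = j then 1 else 0)"
  proof (cases "h = h'")
    case False
    then have z: "vbasis p i x * cnj (vbasis p j x) = 0" for x
      using vH_coset_unique[OF hk(3,5), of x] by (auto simp: vbasis_def hk indicator_def)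
    have "L2_inner M (vbasis p i) (vbasis p j) = 0" by (simp only: L2_inner_def z Bochner_Integration.integral_zero)
    then show ?thesis using False by (simp add: hk)
  next
    case True
    have "L2_inner M (vbasis p i) (vbasis p j) = (\<integral>x. vbasis p (h, k) x * cnj (vchar p x k') \<partial>M)"
      unfolding L2_inner_def
      by (intro Bochner_Integration.integral_cong refl) (simp add: vbasis_def hk True indicator_def)
    also have "\<dots> = cnj (vbasis p (k, h) k')"
      by (rule integral_vbasis_char) (use hk v in auto)
    also have "\<dots> = (if i = j then 1 else 0)"
    proof (cases "k = k'")
      case True
      then show ?thesis using \<open>h = h'\<close> v(4) vchar_vH[OF p hk(6) hk(5)]
        by (simp add: vbasis_def hk vcyl_self)
    next
      case False
      then have "k' \<notin> vcyl p 0 k"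
        using vH_coset_unique[OF hk(4,6), of k'] vcyl_self[OF v(4)] by blast
      then show ?thesis using False by (simp add: vbasis_def hk)
    qed
    finally show ?thesis .
  qed
qed

text \<open>
  Only local integrability is assumed, because the lemma serves for brackets and for \<open>recon\<close>, whose
  square integrability is not known beforehand. On a coset of \<open>U\<close>, vanishing coefficients mean that \<open>f\<close>
  integrates to zero against all characters, hence over all small balls, hence over all Borel sets.
\<close>

lemma vbasis_total:
  assumes loc: "\<And>h. h \<in> vH p \<Longrightarrow> integrable M (\<lambda>x. indicator (vcyl p 0 h) x * f x)"
    and zero: "\<And>j. j \<in> J \<Longrightarrow> (\<integral>x. f x * cnj (vbasis p j x) \<partial>M) = 0"
  shows "AE x in M. f x = 0"
proof (rule AE_by_cosets)
  fix h assume h: "h \<in> vH p"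
  define g where "g x = indicator (vcyl p 0 h) x * f x" for x
  have g: "integrable M g" unfolding g_def by (rule loc[OF h])
  have h0: "(\<lambda>_. 0) \<in> vH p" using p by (auto simp: vH_def vilenkin_def)
  have gk: "(\<integral>x. g x * cnj (vchar p x k) \<partial>M) = 0" if "k \<in> vH p" for k
    using zero[of "(h, k)"] h that by (simp add: vbasis_def g_def mult_ac)
  have g0: "(\<integral>x. g x \<partial>M) = 0" using gk[OF h0] by (simp add: vchar_def)
  have intA: "set_integrable M A g" if "A \<in> sets M" for A
    using g that unfolding set_integrable_def by (rule integrable_mult_indicator[rotated])
  have cyl: "(LINT x:A|M. g x) = 0" if A: "A \<in> vcyls p" for A
  proof (cases "A \<inter> vcyl p 0 h = {}")
    case True
    then have z: "indicator A x *\<^sub>R g x = 0" for x by (auto simp: g_def indicator_def)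
    show ?thesis by (simp only: set_lebesgue_integral_def z Bochner_Integration.integral_zero)
  next
    case False
    then obtain y where y: "y \<in> A" "y \<in> vcyl p 0 h" by blast
    obtain l x where A: "A = vcyl p l x" using A by (auto simp: vcyls_def)
    define m where "m = nat (max l 0)"
    define K where "K = {k \<in> vH p. \<forall>j\<le>-int m. k j = 0}"
    have yv: "y \<in> vilenkin p" using y by (simp add: vcyl_def)
    have Kv: "k \<in> vilenkin p" "k \<in> vH p" if "k \<in> K" for k using that by (auto simp: K_def vH_def)
    have zero_nbhd: "(\<lambda>_. 0) \<in> vnbhd p 0" using p by (auto simp: vnbhd_def vilenkin_def)
    have N0: "card K > 0" using indicator_vnbhd_char_sum(2)[OF p zero_nbhd, of m] by (simp add: K_def)
    \<comment> \<open>Inside the coset, the cylinder \<open>A\<close> is the ball of level \<open>max l 0\<close> about \<open>y\<close>; its indicator is real, so the character sum may be conjugated to match the coefficients.\<close>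
    have eq: "indicator A t *\<^sub>R g t = (\<Sum>k\<in>K. (vchar p y k / of_nat (card K)) * (g t * cnj (vchar p t k)))" if t: "t \<in> vilenkin p" for t
    proof (cases "t \<in> vcyl p 0 h")
      case False then show ?thesis by (simp add: g_def)
    next
      case True
      have z: "vminus p t y \<in> vnbhd p 0"
        using True y t yv by (subst vminus_in_vnbhd_iff[OF p]) (auto simp: vcyl_def)
      have "t \<in> A \<longleftrightarrow> y \<in> vcyl p (int m) t"
        using True y t yv by (auto simp: A vcyl_def m_def max_def)
      then have ind: "indicator A t = (indicator (vnbhd p (int m)) (vminus p t y) :: complex)"
        by (simp add: indicator_def vminus_in_vnbhd_iff[OF p t yv])
      have "of_nat (card K) * indicator (vnbhd p (int m)) (vminus p t y) = (\<Sum>k\<in>K. vchar p (vminus p t y) k)"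
        using indicator_vnbhd_char_sum(1)[OF p z, of m] by (simp add: K_def)
      also have "\<dots> = (\<Sum>k\<in>K. vchar p t k * cnj (vchar p y k))"
        by (intro sum.cong refl) (simp add: vchar_minus_left[OF p t yv] Kv)
      finally have "cnj (of_nat (card K) * indicator (vnbhd p (int m)) (vminus p t y))
          = (\<Sum>k\<in>K. cnj (vchar p t k) * vchar p y k)" by simp
      then have "indicator A t = (\<Sum>k\<in>K. cnj (vchar p t k) * vchar p y k) / of_nat (card K)"
        using N0 by (simp add: ind field_simps)
      then have "indicator A t * g t = (\<Sum>k\<in>K. (vchar p y k / of_nat (card K)) * (g t * cnj (vchar p t k)))"
        by (simp only: sum_divide_distrib sum_distrib_right) (simp add: mult_ac)
      then show ?thesis by (cases "t \<in> A") simp_all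
    qed
    have "(LINT x:A|M. g x) = (\<integral>t. (\<Sum>k\<in>K. (vchar p y k / of_nat (card K)) * (g t * cnj (vchar p t k))) \<partial>M)"
      unfolding set_lebesgue_integral_def
      by (rule Bochner_Integration.integral_cong[OF refl]) (simp add: eq space_M)
    also have "\<dots> = (\<Sum>k\<in>K. \<integral>t. (vchar p y k / of_nat (card K)) * (g t * cnj (vchar p t k)) \<partial>M)"
      by (rule Bochner_Integration.integral_sum) (intro integrable_mult_right integrable_mult_cnj_vchar g Kv)
    also have "\<dots> = 0" by (intro sum.neutral ballI) (simp add: gk Kv)
    finally show ?thesis .
  qed
  have all: "(LINT x:A|M. g x) = 0" if A: "A \<in> sets M" for A
  proof -
    have sub: "sigma_sets (vilenkin p) (insert {} (vcyls p)) = sets M"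
      unfolding sets_M
      by (intro equalityI sigma_sets_mono) (auto intro: sigma_sets.Basic sigma_sets.Empty)
    have A': "A \<in> sigma_sets (vilenkin p) (insert {} (vcyls p))" using A sub by simp
    have closed: "insert {} (vcyls p) \<subseteq> Pow (vilenkin p)" by (auto simp: vcyls_def vcyl_def)
    from Int_stable_vcyls closed A' show ?thesis
    proof (induction rule: sigma_sets_induct_disjoint)
      case (basic A) then show ?case using cyl by (auto simp: set_lebesgue_integral_def)
    next
      case empty show ?case by (simp add: set_lebesgue_integral_def)
    next
      case (compl A)
      then have A: "A \<in> sets M" using sub by simp
      have "(LINT x:vilenkin p - A|M. g x) = (\<integral>x. g x - indicator A x *\<^sub>R g x \<partial>M)"
        unfolding set_lebesgue_integral_def
        by (rule Bochner_Integration.integral_cong[OF refl]) (auto simp: space_M indicator_def)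
      also have "\<dots> = (\<integral>x. g x \<partial>M) - (LINT x:A|M. g x)"
        unfolding set_lebesgue_integral_def
        using g intA[OF A] by (intro Bochner_Integration.integral_diff) (auto simp: set_integrable_def)
      finally show ?case using compl g0 by simp
    next
      case (union A)
      then have A: "A i \<in> sets M" for i using sub by auto
      have "(LINT x:(\<Union>i. A i)|M. g x) = (\<Sum>i. (LINT x:A i|M. g x))"
      proof (rule lebesgue_integral_countable_add[OF A])
        show "A i \<inter> A j = {}" if "i \<noteq> j" for i j
          using union(1) that by (auto simp: disjoint_family_on_def)
        show "set_integrable M (\<Union>i. A i) g" using A by (intro intA) auto
      qed
      then show ?case using union by simp
    qed
  qed
  have "AE x in M. g x = 0" by (rule density_zero[OF g all])
  then show "AE x in M. x \<in> vcyl p 0 h \<longrightarrow> f x = 0"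
    by eventually_elim (auto simp: g_def)
qed

lemma L2_locally_integrable:
  assumes "f \<in> L2 M" "h \<in> vH p"
  shows "integrable M (\<lambda>x. indicator (vcyl p 0 h) x * f x)"
proof -
  have "(indicator (vcyl p 0 h) :: digits \<Rightarrow> complex) \<in> L2 M"
  proof -
    have "(\<lambda>x. (cmod (indicator (vcyl p 0 h) x))\<^sup>2) = indicator (vcyl p 0 h)"
      by (auto simp: indicator_def)
    then show ?thesis using assms(2)
      by (simp add: L2_def integrable_indicator_iff emeasure_coset vH_vilenkin)
  qed
  from L2_integrable_mult[OF this L2_cnj[OF assms(1)]] show ?thesis by simp
qed

lemma vbasis_L2_basis: "L2_basis M (vbasis p) J"
  unfolding L2_basis_def
proof (intro conjI ballI impI vbasis_orthonormal)
  fix f assume f: "f \<in> L2 M" and z: "\<forall>j\<in>J. L2_inner M f (vbasis p j) = 0"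
  show "AE x in M. f x = 0"
    by (rule vbasis_total[OF L2_locally_integrable[OF f]])
       (use z in \<open>auto simp: L2_inner_def\<close>)
qed

lemma vdual_L2: "j \<in> J \<Longrightarrow> vdual p j \<in> L2 M"
  by (cases j) (auto simp: vdual_def intro!: L2_cnj vbasis_L2)

lemma vdual_total:
  assumes loc: "\<And>h. h \<in> vH p \<Longrightarrow> integrable M (\<lambda>x. indicator (vcyl p 0 h) x * f x)"
    and zero: "\<And>j. j \<in> J \<Longrightarrow> (\<integral>x. f x * cnj (vdual p j x) \<partial>M) = 0"
  shows "AE x in M. f x = 0"
proof -
  have "AE x in M. cnj (f x) = 0"
  proof (rule vbasis_total)
    fix h assume h: "h \<in> vH p"
    have "integrable M (\<lambda>x. cnj (indicator (vcyl p 0 h) x * f x))"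
      using loc[OF h] by (intro integrable_cnj)
    then show "integrable M (\<lambda>x. indicator (vcyl p 0 h) x * cnj (f x))" by simp
  next
    fix j assume j: "j \<in> J"
    have "(\<integral>x. cnj (f x) * cnj (vbasis p j x) \<partial>M) = (\<integral>x. cnj (f x * cnj (vdual p (prod.swap j) x)) \<partial>M)"
      by (cases j) (simp add: vdual_def del: Bochner_Integration.integral_cnj)
    also have "\<dots> = cnj (\<integral>x. f x * cnj (vdual p (prod.swap j) x) \<partial>M)"
      by (rule Bochner_Integration.integral_cnj)
    finally show "(\<integral>x. cnj (f x) * cnj (vbasis p j x) \<partial>M) = 0" using zero[of "prod.swap j"] j by auto
  qed
  then show ?thesis by simp
qed

lemma vdual_L2_basis: "L2_basis M (vdual p) J"
  unfolding L2_basis_def L2_orthonormal_def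
proof (intro conjI ballI impI vdual_L2)
  fix i j assume ij: "i \<in> J" "j \<in> J"
  have "L2_inner M (vdual p i) (vdual p j) = L2_inner M (vbasis p (prod.swap j)) (vbasis p (prod.swap i))"
    by (cases i, cases j) (simp add: L2_inner_def vdual_def mult.commute)
  also have "\<dots> = (if i = j then 1 else 0)"
    using L2_orthonormalD(2)[OF vbasis_orthonormal, of "prod.swap j" "prod.swap i"] ij by (auto simp: prod.swap_def prod_eq_iff)
  finally show "L2_inner M (vdual p i) (vdual p j) = (if i = j then 1 else 0)" .
next
  fix f assume f: "f \<in> L2 M" and z: "\<forall>j\<in>J. L2_inner M f (vdual p j) = 0"
  show "AE x in M. f x = 0"
    by (rule vdual_total[OF L2_locally_integrable[OF f]])
       (use z in \<open>auto simp: L2_inner_def\<close>)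
qed

text \<open>
  Riesz--Fischer provides an element of \<open>L\<^sup>2\<close> with the same coefficients, and totality among locally
  integrable functions shows that it equals \<open>f\<close>.
\<close>

lemma L2_if_vdual_coeffs_square_summable:
  assumes fm: "f \<in> borel_measurable M"
    and loc: "\<And>h. h \<in> vH p \<Longrightarrow> integrable M (\<lambda>x. indicator (vcyl p 0 h) x * f x)"
    and sq: "(\<lambda>j. (cmod (\<integral>x. f x * cnj (vdual p j x) \<partial>M))\<^sup>2) summable_on J"
  shows "f \<in> L2 M"
proof -
  have on: "L2_orthonormal M (vdual p) J" using vdual_L2_basis by (simp add: L2_basis_def)
  obtain s where s: "L2_has_sum M (\<lambda>j x. (\<integral>x. f x * cnj (vdual p j x) \<partial>M) * vdual p j x) J s"
     "\<forall>j\<in>J. L2_inner M s (vdual p j) = (\<integral>x. f x * cnj (vdual p j x) \<partial>M)"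
    using L2_Riesz_Fischer[OF on sq] by blast
  have sL: "s \<in> L2 M" using s(1) by (simp add: L2_has_sum_def)
  have [measurable]: "s \<in> borel_measurable M" using sL by auto
  have "AE x in M. f x - s x = 0"
  proof (rule vdual_total)
    show "integrable M (\<lambda>x. indicator (vcyl p 0 h) x * (f x - s x))" if "h \<in> vH p" for h
      using loc[OF that] L2_locally_integrable[OF sL that] by (simp add: right_diff_distrib)
    fix j assume j: "j \<in> J"
    obtain h k where hk: "j = (h, k)" "h \<in> vH p" "k \<in> vH p" using j by auto
    have "integrable M (\<lambda>x. (indicator (vcyl p 0 k) x * f x) * vchar p x h)"
      by (intro integrable_mult_vchar loc hk vH_vilenkin)
    then have i1: "integrable M (\<lambda>x. f x * cnj (vdual p j x))"
      by (simp add: hk vdual_def vbasis_def mult_ac)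
    have "(\<integral>x. (f x - s x) * cnj (vdual p j x) \<partial>M) = (\<integral>x. f x * cnj (vdual p j x) \<partial>M) - L2_inner M s (vdual p j)"
      unfolding L2_inner_def left_diff_distrib
      by (intro Bochner_Integration.integral_diff i1 L2_integrable_mult sL vdual_L2 j)
    then show "(\<integral>x. (f x - s x) * cnj (vdual p j x) \<partial>M) = 0" using s(2) j by simp
  qed
  then have "AE x in M. (cmod (s x))\<^sup>2 = (cmod (f x))\<^sup>2" by eventually_elim simp
  then have "integrable M (\<lambda>x. (cmod (f x))\<^sup>2)"
    using L2_integrable_sq[OF sL] by (rule integrable_cong_AE_imp[rotated 2]) (use fm in measurable)
  then show ?thesis using fm by (simp add: L2_def)
qed

end

section \<open>The Fourier transform on L2\<close>

lemma integrable_count_space_iff_summable_on: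
  fixes f :: "'j \<Rightarrow> complex"
  shows "integrable (count_space J) f \<longleftrightarrow> (\<lambda>j. cmod (f j)) summable_on J"
  using abs_summable_equivalent[of f J] by (simp add: Infinite_Set_Sum.abs_summable_on_def)

text \<open>
  Holds without a convergence hypothesis: both sides are 0 for a family that is not absolutely summable, since
  for complex families unconditional and absolute summability coincide.
\<close>

lemma integral_count_space_eq_infsum:
  fixes f :: "'j \<Rightarrow> complex"
  shows "(\<integral>j. f j \<partial>count_space J) = (\<Sum>\<^sub>\<infinity>j\<in>J. f j)"
proof (cases "integrable (count_space J) f")
  case True
  then have "infsetsum f J = infsum f J"
    by (intro infsetsum_infsum) (simp add: Infinite_Set_Sum.abs_summable_on_def)
  then show ?thesis by (simp add: infsetsum_def)
next
  case False
  then have "\<not> f summable_on J"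
    using summable_on_iff_abs_summable_on_complex[of f J] integrable_count_space_iff_summable_on[of J f] by simp
  then show ?thesis using False by (simp add: not_integrable_integral_eq infsum_not_exists)
qed

text \<open>
  Fubini for the product with a counting measure. The sum of the series is a measurable function on all
  of the space, including the null set where it diverges.
\<close>

lemma (in sigma_finite_measure) countable_sum_integral:
  fixes q :: "'j \<Rightarrow> 'a \<Rightarrow> complex"
  assumes J: "countable J" and q: "\<forall>j\<in>J. integrable M (q j)"
    and sm: "(\<lambda>j. \<integral>x. cmod (q j x) \<partial>M) summable_on J"
  shows "AE x in M. (\<lambda>j. cmod (q j x)) summable_on J"
    and "integrable M (\<lambda>x. \<Sum>\<^sub>\<infinity>j\<in>J. q j x)"
    and "(\<integral>x. (\<Sum>\<^sub>\<infinity>j\<in>J. q j x) \<partial>M) = (\<Sum>\<^sub>\<infinity>j\<in>J. \<integral>x. q j x \<partial>M)"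
proof -
  interpret C: sigma_finite_measure "count_space J"
    by (rule sigma_finite_measure_count_space_countable[OF J])
  interpret P: pair_sigma_finite "count_space J" M ..
  have "(\<lambda>j. complex_of_real (\<integral>x. cmod (q j x) \<partial>M)) summable_on J"
    using sm by (rule summable_on_of_real)
  then have "integrable (count_space J) (\<lambda>j. complex_of_real (\<integral>x. cmod (q j x) \<partial>M))"
    by (simp add: integrable_count_space_iff_summable_on summable_on_iff_abs_summable_on_complex)
  then have int1: "integrable (count_space J) (\<lambda>j. \<integral>x. cmod (q j x) \<partial>M)"
    by (simp only: complex_of_real_integrable_eq)
  have int: "integrable (count_space J \<Otimes>\<^sub>M M) (\<lambda>(j, x). q j x)"
  proof (rule P.Fubini_integrable)
    show "(\<lambda>(j, x). q j x) \<in> borel_measurable (count_space J \<Otimes>\<^sub>M M)"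
      by (rule measurable_pair_measure_countable1[OF J]) (use q in auto)
    show "integrable (count_space J) (\<lambda>j. \<integral>x. norm (case (j, x) of (j, x) \<Rightarrow> q j x) \<partial>M)"
      using int1 by simp
    show "AE j in count_space J. integrable M (\<lambda>x. case (j, x) of (j, x) \<Rightarrow> q j x)"
      using q by (simp add: AE_count_space)
  qed
  show "AE x in M. (\<lambda>j. cmod (q j x)) summable_on J"
    using P.AE_integrable_snd[OF int] by (simp only: integrable_count_space_iff_summable_on)
  show "integrable M (\<lambda>x. \<Sum>\<^sub>\<infinity>j\<in>J. q j x)"
    using P.integrable_snd[OF int] by (simp only: integral_count_space_eq_infsum)
  show "(\<integral>x. (\<Sum>\<^sub>\<infinity>j\<in>J. q j x) \<partial>M) = (\<Sum>\<^sub>\<infinity>j\<in>J. \<integral>x. q j x \<partial>M)"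
    using P.Fubini_integral[OF int] by (simp only: integral_count_space_eq_infsum)
qed

lemma L2_cong_space: "(\<And>x. x \<in> space M \<Longrightarrow> f x = g x) \<Longrightarrow> f \<in> L2 M \<longleftrightarrow> g \<in> L2 M"
  unfolding L2_def using measurable_cong[of M f g borel]
    Bochner_Integration.integrable_cong[of M M "\<lambda>x. (cmod (f x))\<^sup>2" "\<lambda>x. (cmod (g x))\<^sup>2"] by auto

lemma L2_norm_cong_space: "(\<And>x. x \<in> space M \<Longrightarrow> f x = g x) \<Longrightarrow> L2_norm M f = L2_norm M g"
  unfolding L2_norm_def by (intro arg_cong[where f = sqrt] Bochner_Integration.integral_cong) auto

lemma L2_inner_tendsto:
  assumes s: "\<And>n. s n \<in> L2 M" and f: "f \<in> L2 M" and u: "u \<in> L2 M"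
    and lim: "(\<lambda>n. L2_norm M (\<lambda>x. s n x - f x)) \<longlonglongrightarrow> 0"
  shows "(\<lambda>n. L2_inner M (s n) u) \<longlonglongrightarrow> L2_inner M f u"
proof -
  have "(\<lambda>n. L2_inner M (s n) u - L2_inner M f u) \<longlonglongrightarrow> 0"
  proof (rule Lim_null_comparison)
    show "(\<lambda>n. L2_norm M (\<lambda>x. s n x - f x) * L2_norm M u) \<longlonglongrightarrow> 0"
      by (rule tendsto_mult_left_zero[OF lim])
    have "norm (L2_inner M (s n) u - L2_inner M f u) \<le> L2_norm M (\<lambda>x. s n x - f x) * L2_norm M u" for n
      using L2_Cauchy_Schwarz[OF L2_diff[OF s f] u, of n] by (simp add: L2_inner_diff_left s f u)
    then show "\<forall>\<^sub>F n in sequentially. norm (L2_inner M (s n) u - L2_inner M f u)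
        \<le> L2_norm M (\<lambda>x. s n x - f x) * L2_norm M u" by simp
  qed
  then show ?thesis by (simp add: LIM_zero_iff)
qed

locale vilenkin_pair =
  G: vilenkin_haar p \<mu> + D: vilenkin_haar p \<mu>' for p :: nat and \<mu> \<mu>' :: "digits measure"
begin

sublocale pair_sigma_finite \<mu> \<mu>' ..

abbreviation J :: "(digits \<times> digits) set" where "J \<equiv> vH p \<times> vH p"

text \<open>
  Fubini moves the Fourier kernel from \<open>s\<close> onto the basis function, whose inverse transform is explicit.
\<close>

lemma fourier_L1_coeff:
  assumes s: "integrable \<mu> s" and j: "j \<in> J"
  shows "L2_inner \<mu>' (vfourier_L1 p \<mu> s) (vdual p j) = L2_inner \<mu> s (vbasis p j)"
proof -
  have sm [measurable]: "s \<in> borel_measurable \<mu>" using s by auto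
  have dj [measurable]: "vdual p j \<in> borel_measurable \<mu>'" using D.vdual_L2[OF j] by auto
  obtain h k where hk: "j = (h, k)" "h \<in> vH p" "k \<in> vH p" using j by auto
  have dint: "integrable \<mu>' (vdual p j)"
    unfolding hk vdual_def using D.integrable_vbasis[of "(k, h)"] hk by (auto intro: integrable_cnj)
  have [measurable]: "(\<lambda>(x, w). vchar p x w) \<in> borel_measurable (\<mu> \<Otimes>\<^sub>M \<mu>')"
    by (rule G.borel_measurable_vchar_pair[OF D.haar])
  let ?f = "\<lambda>x w. s x * cnj (vchar p x w) * cnj (vdual p j w)"
  have nf: "norm (?f x w) = cmod (s x) * cmod (vdual p j w)" for x w
    by (simp add: norm_mult vchar_norm)
  have int: "integrable (\<mu> \<Otimes>\<^sub>M \<mu>') (\<lambda>(x, w). ?f x w)"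
  proof (rule Fubini_integrable)
    show meas: "(\<lambda>(x, w). ?f x w) \<in> borel_measurable (\<mu> \<Otimes>\<^sub>M \<mu>')" by measurable
    show "integrable \<mu> (\<lambda>x. \<integral>w. norm (case (x, w) of (x, w) \<Rightarrow> ?f x w) \<partial>\<mu>')"
      using s by (simp add: nf)
    show "AE x in \<mu>. integrable \<mu>' (\<lambda>w. case (x, w) of (x, w) \<Rightarrow> ?f x w)"
    proof (rule AE_I2)
      fix x assume x: "x \<in> space \<mu>"
      have "integrable \<mu>' (\<lambda>w. s x * cnj (vdual p j w * vchar p w x))"
        using x by (intro integrable_mult_right integrable_cnj D.integrable_mult_vchar dint) (simp add: G.space_M)
      then show "integrable \<mu>' (\<lambda>w. case (x, w) of (x, w) \<Rightarrow> ?f x w)"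
        by (simp add: vchar_commute[of p x] mult_ac)
    qed
  qed
  have "L2_inner \<mu>' (vfourier_L1 p \<mu> s) (vdual p j) = (\<integral>w. (\<integral>x. ?f x w \<partial>\<mu>) \<partial>\<mu>')"
    by (simp add: L2_inner_def vfourier_L1_def)
  also have "\<dots> = (\<integral>x. (\<integral>w. ?f x w \<partial>\<mu>') \<partial>\<mu>)" by (rule Fubini_integral[OF int])
  also have "\<dots> = (\<integral>x. s x * cnj (vbasis p j x) \<partial>\<mu>)"
  proof (rule Bochner_Integration.integral_cong[OF refl])
    fix x assume "x \<in> space \<mu>"
    then have x: "x \<in> vilenkin p" by (simp add: G.space_M)
    have "(\<integral>w. ?f x w \<partial>\<mu>') = (\<integral>w. s x * cnj (vdual p j w * vchar p x w) \<partial>\<mu>')"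
      by (simp add: mult_ac)
    also have "\<dots> = s x * cnj (\<integral>w. vdual p j w * vchar p x w \<partial>\<mu>')"
      by (simp only: integral_mult_right_zero Bochner_Integration.integral_cnj)
    finally show "(\<integral>w. ?f x w \<partial>\<mu>') = s x * cnj (vbasis p j x)"
      by (simp add: D.integral_vdual_char[OF j x])
  qed
  finally show ?thesis by (simp add: L2_inner_def)
qed

text \<open>
  The transform characterized by its coefficients, without reference to approximating sequences. It determines
  the transform up to a null set because the dual basis is total.
\<close>

definition fourier_pair :: "(digits \<Rightarrow> complex) \<Rightarrow> (digits \<Rightarrow> complex) \<Rightarrow> bool" where
  "fourier_pair f g \<longleftrightarrow> f \<in> L2 \<mu> \<and> g \<in> L2 \<mu>' \<and>
     (\<forall>j\<in>J. L2_inner \<mu>' g (vdual p j) = L2_inner \<mu> f (vbasis p j))"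

lemma fourier_pair_coeff:
  "fourier_pair f g \<Longrightarrow> j \<in> J \<Longrightarrow> L2_inner \<mu>' g (vdual p j) = L2_inner \<mu> f (vbasis p j)"
  unfolding fourier_pair_def by blast

lemma is_vfourier_imp_fourier_pair:
  assumes "is_vfourier p \<mu> \<mu>' f g"
  shows "fourier_pair f g"
proof -
  obtain s where s: "\<And>n. s n \<in> L2 \<mu>" "\<And>n. integrable \<mu> (s n)" "\<And>n. vfourier_L1 p \<mu> (s n) \<in> L2 \<mu>'"
    "(\<lambda>n. L2_norm \<mu> (\<lambda>x. s n x - f x)) \<longlonglongrightarrow> 0"
    "(\<lambda>n. L2_norm \<mu>' (\<lambda>w. vfourier_L1 p \<mu> (s n) w - g w)) \<longlonglongrightarrow> 0"
    and fg: "f \<in> L2 \<mu>" "g \<in> L2 \<mu>'"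
    using assms unfolding is_vfourier_def by blast
  have "L2_inner \<mu>' g (vdual p j) = L2_inner \<mu> f (vbasis p j)" if j: "j \<in> J" for j
  proof (rule LIMSEQ_unique)
    show "(\<lambda>n. L2_inner \<mu> (s n) (vbasis p j)) \<longlonglongrightarrow> L2_inner \<mu> f (vbasis p j)"
      by (rule L2_inner_tendsto[OF s(1) fg(1) G.vbasis_L2[OF j] s(4)])
    show "(\<lambda>n. L2_inner \<mu> (s n) (vbasis p j)) \<longlonglongrightarrow> L2_inner \<mu>' g (vdual p j)"
      using L2_inner_tendsto[OF s(3) fg(2) D.vdual_L2[OF j] s(5)] by (simp add: fourier_L1_coeff s(2) j)
  qed
  then show ?thesis using fg by (simp add: fourier_pair_def)
qed

lemma vfourier_L1_lincomb:
  assumes E: "E \<subseteq> J" and w: "w \<in> vilenkin p"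
  shows "vfourier_L1 p \<mu> (\<lambda>x. \<Sum>j\<in>E. c j * vbasis p j x) w = (\<Sum>j\<in>E. c j * vdual p j w)"
proof -
  have "vfourier_L1 p \<mu> (\<lambda>x. \<Sum>j\<in>E. c j * vbasis p j x) w
      = (\<integral>x. (\<Sum>j\<in>E. c j * (vbasis p j x * cnj (vchar p x w))) \<partial>\<mu>)"
    by (simp add: vfourier_L1_def sum_distrib_right mult.assoc)
  also have "\<dots> = (\<Sum>j\<in>E. \<integral>x. c j * (vbasis p j x * cnj (vchar p x w)) \<partial>\<mu>)"
    by (rule Bochner_Integration.integral_sum, intro integrable_mult_right G.integrable_mult_cnj_vchar G.integrable_vbasis w)
       (use E in auto)
  also have "\<dots> = (\<Sum>j\<in>E. c j * vfourier_L1 p \<mu> (vbasis p j) w)" by (simp add: vfourier_L1_def)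
  also have "\<dots> = (\<Sum>j\<in>E. c j * vdual p j w)"
    using E w by (intro sum.cong refl arg_cong2[where f = "(*)"] G.vfourier_L1_vbasis) auto
  finally show ?thesis .
qed

text \<open>
  The transform of \<open>f\<close> is the series with the coefficients of \<open>f\<close> in the dual basis. Finite partial sums of
  the expansion of \<open>f\<close> serve as the approximating sequence, as their Fourier integrals are known termwise.
\<close>

lemma is_vfourier_exists:
  assumes f: "f \<in> L2 \<mu>"
  shows "\<exists>g. is_vfourier p \<mu> \<mu>' f g"
proof -
  define c where "c j = L2_inner \<mu> f (vbasis p j)" for j
  have on: "L2_orthonormal \<mu>' (vdual p) J" using D.vdual_L2_basis by (simp add: L2_basis_def)
  have csq: "(\<lambda>j. (cmod (c j))\<^sup>2) summable_on J"
    unfolding c_def by (rule L2_bessel_summable[OF L2_bessel_orthonormal[OF G.vbasis_orthonormal] f])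
  have sf: "L2_has_sum \<mu> (\<lambda>j x. c j * vbasis p j x) J f"
    unfolding c_def by (rule L2_orthonormal_basis_expansion[OF G.vbasis_L2_basis f])
  obtain g where sg: "L2_has_sum \<mu>' (\<lambda>j x. c j * vdual p j x) J g"
    using L2_Riesz_Fischer[OF on csq] by blast
  define S where "S E x = (\<Sum>j\<in>E. c j * vbasis p j x)" for E x
  define T where "T E w = (\<Sum>j\<in>E. c j * vdual p j w)" for E w
  have "\<exists>E. finite E \<and> E \<subseteq> J \<and> L2_norm \<mu> (\<lambda>x. S E x - f x) < 1 / Suc n \<and> L2_norm \<mu>' (\<lambda>w. T E w - g w) < 1 / Suc n" for n
  proof -
    have e: "(0::real) < 1 / Suc n" by simp
    have "\<forall>\<^sub>F E in finite_subsets_at_top J. L2_norm \<mu> (\<lambda>x. f x - S E x) < 1 / Suc n"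
      using sf e unfolding L2_has_sum_def S_def by (blast dest: order_tendstoD(2))
    moreover have "\<forall>\<^sub>F E in finite_subsets_at_top J. L2_norm \<mu>' (\<lambda>w. g w - T E w) < 1 / Suc n"
      using sg e unfolding L2_has_sum_def T_def by (blast dest: order_tendstoD(2))
    moreover have "\<forall>\<^sub>F E in finite_subsets_at_top J. finite E \<and> E \<subseteq> J"
      by (rule eventually_finite_subsets_at_top_weakI) simp
    ultimately have "\<forall>\<^sub>F E in finite_subsets_at_top J. finite E \<and> E \<subseteq> J \<and> L2_norm \<mu> (\<lambda>x. S E x - f x) < 1 / Suc n
       \<and> L2_norm \<mu>' (\<lambda>w. T E w - g w) < 1 / Suc n"
      by eventually_elim (auto simp: L2_norm_minus_commute[of \<mu> f] L2_norm_minus_commute[of \<mu>' g])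
    then show ?thesis by (blast dest: eventually_happens' [OF finite_subsets_at_top_neq_bot])
  qed
  then have "\<forall>n. \<exists>E. finite E \<and> E \<subseteq> J \<and> L2_norm \<mu> (\<lambda>x. S E x - f x) < 1 / Suc n
      \<and> L2_norm \<mu>' (\<lambda>w. T E w - g w) < 1 / Suc n" ..
  from choice[OF this] obtain E where E0: "\<forall>n. finite (E n) \<and> E n \<subseteq> J \<and>
      L2_norm \<mu> (\<lambda>x. S (E n) x - f x) < 1 / Suc n \<and> L2_norm \<mu>' (\<lambda>w. T (E n) w - g w) < 1 / Suc n" ..
  have E: "finite (E n)" "E n \<subseteq> J" "L2_norm \<mu> (\<lambda>x. S (E n) x - f x) < 1 / Suc n"
    "L2_norm \<mu>' (\<lambda>w. T (E n) w - g w) < 1 / Suc n" for n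
    using E0 by (simp_all only:)
  have ST: "vfourier_L1 p \<mu> (S (E n)) w = T (E n) w" if "w \<in> space \<mu>'" for n w
    unfolding S_def[abs_def] T_def using that by (intro vfourier_L1_lincomb E) (simp add: D.space_M)
  have lim: "(\<lambda>n. a n) \<longlonglongrightarrow> 0" if "\<And>n. 0 \<le> a n" "\<And>n. a n < 1 / Suc n" for a :: "nat \<Rightarrow> real"
    by (rule Lim_null_comparison[OF _ LIMSEQ_Suc[OF lim_1_over_n]])
       (use that in \<open>auto intro!: always_eventually less_imp_le\<close>)
  have "is_vfourier p \<mu> \<mu>' f g"
    unfolding is_vfourier_def
  proof (intro conjI exI[of _ "\<lambda>n. S (E n)"] allI f)
    show "g \<in> L2 \<mu>'" using sg by (simp add: L2_has_sum_def)
    fix n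
    show "S (E n) \<in> L2 \<mu>" unfolding S_def[abs_def] using E(2)[of n] by (intro L2_lincomb G.vbasis_L2) auto
    show "integrable \<mu> (S (E n))" unfolding S_def[abs_def] using E(2)[of n]
      by (intro Bochner_Integration.integrable_sum integrable_mult_right G.integrable_vbasis) auto
    have "T (E n) \<in> L2 \<mu>'" unfolding T_def[abs_def] using E(2)[of n] by (intro L2_lincomb D.vdual_L2) auto
    then show "vfourier_L1 p \<mu> (S (E n)) \<in> L2 \<mu>'" using ST by (subst L2_cong_space)
  next
    show "(\<lambda>n. L2_norm \<mu> (\<lambda>x. S (E n) x - f x)) \<longlonglongrightarrow> 0" by (rule lim) (simp, rule E)
    have "L2_norm \<mu>' (\<lambda>w. vfourier_L1 p \<mu> (S (E n)) w - g w) = L2_norm \<mu>' (\<lambda>w. T (E n) w - g w)" for n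
      by (rule L2_norm_cong_space) (simp add: ST)
    then show "(\<lambda>n. L2_norm \<mu>' (\<lambda>w. vfourier_L1 p \<mu> (S (E n)) w - g w)) \<longlonglongrightarrow> 0"
      using lim[OF L2_norm_nonneg E(4)] by simp
  qed
  then show ?thesis by blast
qed

lemma fourier_pair_vfourier: "f \<in> L2 \<mu> \<Longrightarrow> fourier_pair f (vfourier p \<mu> \<mu>' f)"
  unfolding vfourier_def
  by (rule is_vfourier_imp_fourier_pair) (rule someI_ex[OF is_vfourier_exists])

lemma Plancherel:
  assumes "fourier_pair f f'" "fourier_pair g g'"
  shows "L2_inner \<mu> f g = L2_inner \<mu>' f' g'"
proof (rule has_sum_unique)
  show "((\<lambda>j. L2_inner \<mu> f (vbasis p j) * cnj (L2_inner \<mu> g (vbasis p j))) has_sum L2_inner \<mu> f g) J"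
    using assms by (intro L2_Parseval G.vbasis_L2_basis) (auto simp: fourier_pair_def)
  have "((\<lambda>j. L2_inner \<mu>' f' (vdual p j) * cnj (L2_inner \<mu>' g' (vdual p j))) has_sum L2_inner \<mu>' f' g') J"
    using assms by (intro L2_Parseval D.vdual_L2_basis) (auto simp: fourier_pair_def)
  then show "((\<lambda>j. L2_inner \<mu> f (vbasis p j) * cnj (L2_inner \<mu> g (vbasis p j))) has_sum L2_inner \<mu>' f' g') J"
    using assms by (subst has_sum_cong[where g = "\<lambda>j. L2_inner \<mu>' f' (vdual p j) * cnj (L2_inner \<mu>' g' (vdual p j))"])
       (simp_all add: fourier_pair_coeff[OF assms(1)] fourier_pair_coeff[OF assms(2)])
qed

lemma vtranslate_L2:
  assumes h: "h \<in> vilenkin p" and f: "f \<in> L2 \<mu>"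
  shows "vtranslate p h f \<in> L2 \<mu>"
  using G.borel_translate[OF vneg_in[OF G.p h] L2_measurable[OF f]]
    G.integrable_translate[OF vneg_in[OF G.p h] L2_integrable_sq[OF f]]
  by (simp add: L2_def vtranslate_def vminus_def)

text \<open>
  The translate of \<open>vbasis p (h', k)\<close> by \<open>-h\<close> is \<open>vbasis p (h' \<ominus> h, k)\<close>, again without a phase, so the
  claim can be read off from coefficients.
\<close>

lemma fourier_pair_translate:
  assumes h: "h \<in> vH p" and fg: "fourier_pair f g"
  shows "fourier_pair (vtranslate p h f) (\<lambda>w. cnj (vchar p h w) * g w)"
  unfolding fourier_pair_def
proof (intro conjI ballI)
  have hv: "h \<in> vilenkin p" using h by (rule vH_vilenkin)
  have f: "f \<in> L2 \<mu>" and g: "g \<in> L2 \<mu>'" using fg by (auto simp: fourier_pair_def)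
  have gm [measurable]: "g \<in> borel_measurable \<mu>'" and fm [measurable]: "f \<in> borel_measurable \<mu>" using f g by auto
  show "vtranslate p h f \<in> L2 \<mu>" by (rule vtranslate_L2[OF hv f])
  have [measurable]: "(\<lambda>w. vchar p h w) \<in> borel_measurable \<mu>'"
    using D.borel_measurable_vchar[OF hv] by (simp add: vchar_commute[of p h])
  have "(\<lambda>w. g w * cnj (vchar p h w)) \<in> L2 \<mu>'"
    by (rule L2_mult_bounded[OF g]) (auto simp: vchar_norm)
  then show "(\<lambda>w. cnj (vchar p h w) * g w) \<in> L2 \<mu>'" by (simp add: mult.commute)
  fix j assume "j \<in> J"
  then obtain h' k where j: "j = (h', k)" "h' \<in> vH p" "k \<in> vH p" by auto
  let ?j' = "(vminus p h' h, k)"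
  note v = vH_vilenkin[OF j(2)] vH_vilenkin[OF j(3)]
  have j': "?j' \<in> J" using j h by (simp add: vH_vminus G.p)
  have vbm: "vbasis p j \<in> borel_measurable \<mu>" using j by (intro G.borel_vbasis) auto
  have "L2_inner \<mu> (vtranslate p h f) (vbasis p j)
      = (\<integral>x. vtranslate p h f (vplus p x h) * cnj (vbasis p j (vplus p x h)) \<partial>\<mu>)"
    unfolding L2_inner_def
    by (rule G.integral_translate[OF hv, symmetric])
       (intro borel_measurable_times borel_measurable_cnj L2_measurable[OF vtranslate_L2[OF hv f]] vbm)
  also have "\<dots> = (\<integral>x. f x * cnj (vbasis p ?j' x) \<partial>\<mu>)"
  proof (rule Bochner_Integration.integral_cong[OF refl])
    fix x assume "x \<in> space \<mu>"
    then have x: "x \<in> vilenkin p" by (simp add: G.space_M)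
    show "vtranslate p h f (vplus p x h) * cnj (vbasis p j (vplus p x h)) = f x * cnj (vbasis p ?j' x)"
      by (simp add: vtranslate_def vminus_vplus[OF G.p x hv] j vbasis_def vchar_add_left[OF G.p x hv v(2)]
          vchar_vH[OF G.p h j(3)] indicator_def vplus_in_vcyl_iff[OF G.p x v(1) hv])
  qed
  also have "\<dots> = L2_inner \<mu>' g (vdual p ?j')" using fg j' by (simp add: fourier_pair_def L2_inner_def)
  also have "\<dots> = L2_inner \<mu>' (\<lambda>w. cnj (vchar p h w) * g w) (vdual p j)"
    unfolding L2_inner_def
  proof (rule Bochner_Integration.integral_cong[OF refl])
    fix w assume "w \<in> space \<mu>'"
    then have w: "w \<in> vilenkin p" by (simp add: D.space_M)
    show "g w * cnj (vdual p ?j' w) = cnj (vchar p h w) * g w * cnj (vdual p j w)"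
      by (simp add: vdual_def vbasis_def j vchar_minus_right[OF G.p v(1) hv w] vchar_commute[of p h] mult_ac)
  qed
  finally show "L2_inner \<mu>' (\<lambda>w. cnj (vchar p h w) * g w) (vdual p j) = L2_inner \<mu> (vtranslate p h f) (vbasis p j)" ..
qed

end

section \<open>Periodization\<close>

context vilenkin_haar
begin

definition periodize :: "(digits \<Rightarrow> complex) \<Rightarrow> digits \<Rightarrow> complex" where
  "periodize q w = (\<Sum>\<^sub>\<infinity>h\<in>vH p. q (vplus p w h))"

lemma coset_translate_indicator:
  assumes h: "h \<in> vH p" and k: "k \<in> vH p" and w: "w \<in> vilenkin p"
  shows "(indicator (vcyl p 0 k) w :: 'b :: zero_neq_one) = indicator (vcyl p 0 (vplus p k h)) (vplus p w h)"
proof -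
  have "vminus p (vplus p k h) h = k" by (rule vminus_vplus[OF p vH_vilenkin[OF k] vH_vilenkin[OF h]])
  then show ?thesis
    using vplus_in_vcyl_iff[OF p w vH_vilenkin[OF vH_vplus[OF p k h]] vH_vilenkin[OF h], of 0] by (simp add: indicator_def)
qed

lemma coset_partition:
  assumes k: "k \<in> vH p" and w: "w \<in> vilenkin p"
  shows "\<exists>h\<in>vH p. \<forall>h'\<in>vH p. w \<in> vcyl p 0 (vplus p k h') \<longleftrightarrow> h' = h"
proof -
  obtain a where a: "a \<in> vH p" "w \<in> vcyl p 0 a" using vH_in_UN[OF w] by blast
  note v = vH_vilenkin[OF k] vH_vilenkin[OF a(1)]
  let ?h = "vminus p a k"
  have h: "?h \<in> vH p" by (rule vH_vminus[OF p a(1) k])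
  have kh: "vplus p k ?h = a" using vplus_vminus[OF p v(2,1)] by (simp add: vplus_commute)
  show ?thesis
  proof (rule bexI[OF ballI h])
    fix h' assume h': "h' \<in> vH p"
    show "w \<in> vcyl p 0 (vplus p k h') \<longleftrightarrow> h' = ?h"
    proof
      assume "w \<in> vcyl p 0 (vplus p k h')"
      then have "vplus p k h' = a" using vH_coset_unique[OF vH_vplus[OF p k h'] a(1) _ a(2)] by blast
      then show "h' = ?h" using vminus_vplus[OF p vH_vilenkin[OF h'] v(1)] by (simp add: vplus_commute)
    qed (use a kh in simp)
  qed
qed

text \<open>
  The translates of one coset of \<open>U\<close> by the elements of \<open>H\<close> partition the group, so folding \<open>q\<close> into that coset
  preserves its integral. The functions \<open>t h\<close> are the pieces of \<open>q\<close> after folding and the \<open>r h\<close> the same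
  pieces before; translation invariance matches their integrals.
\<close>

lemma periodize_integral:
  assumes q: "integrable M q" and k: "k \<in> vH p"
  shows "AE w in M. w \<in> vcyl p 0 k \<longrightarrow> (\<lambda>h. cmod (q (vplus p w h))) summable_on vH p"
    and "integrable M (\<lambda>w. indicator (vcyl p 0 k) w * periodize q w)"
    and "(\<integral>w. indicator (vcyl p 0 k) w * periodize q w \<partial>M) = (\<integral>w. q w \<partial>M)"
proof -
  define r where "r h w = indicator (vcyl p 0 (vplus p k h)) w * q w" for h w
  define t where "t h w = indicator (vcyl p 0 k) w * q (vplus p w h)" for h w
  have tr: "t h w = r h (vplus p w h)" if "h \<in> vH p" "w \<in> space M" for h w
    using coset_translate_indicator[OF that(1) k, of w, where 'b = complex] that by (simp add: t_def r_def space_M)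
  have rint: "integrable M (r h)" for h
    unfolding r_def
    by (rule Bochner_Integration.integrable_bound[OF q]) (use q in \<open>auto simp: norm_mult indicator_def\<close>)
  have tint: "integrable M (t h)" if h: "h \<in> vH p" for h
    using integrable_translate[OF vH_vilenkin[OF h] rint[of h]] tr[OF h]
    by (subst Bochner_Integration.integrable_cong[OF refl]) auto
  have tn: "(\<integral>w. cmod (t h w) \<partial>M) = (\<integral>w. cmod (r h w) \<partial>M)" if h: "h \<in> vH p" for h
  proof -
    have "complex_of_real (\<integral>w. cmod (t h w) \<partial>M) = (\<integral>w. complex_of_real (cmod (r h (vplus p w h))) \<partial>M)"
      unfolding integral_complex_of_real[symmetric]
      by (rule Bochner_Integration.integral_cong[OF refl]) (simp add: tr[OF h])
    also have "\<dots> = (\<integral>w. complex_of_real (cmod (r h w)) \<partial>M)"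
      using rint by (intro integral_translate[OF vH_vilenkin[OF h]]) auto
    finally show ?thesis by (simp only: integral_complex_of_real of_real_eq_iff)
  qed
  have ti: "(\<integral>w. t h w \<partial>M) = (\<integral>w. r h w \<partial>M)" if h: "h \<in> vH p" for h
  proof -
    have "(\<integral>w. t h w \<partial>M) = (\<integral>w. r h (vplus p w h) \<partial>M)"
      by (rule Bochner_Integration.integral_cong[OF refl]) (simp add: tr[OF h])
    then show ?thesis using integral_translate[OF vH_vilenkin[OF h] borel_measurable_integrable[OF rint]] by simp
  qed
  have rsm: "(\<lambda>h. \<integral>w. cmod (r h w) \<partial>M) summable_on vH p"
  proof (rule nonneg_bdd_above_summable_on)
    show "bdd_above (sum (\<lambda>h. \<integral>w. cmod (r h w) \<partial>M) ` {F. F \<subseteq> vH p \<and> finite F})"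
    proof (rule bdd_aboveI)
      fix S assume "S \<in> sum (\<lambda>h. \<integral>w. cmod (r h w) \<partial>M) ` {F. F \<subseteq> vH p \<and> finite F}"
      then obtain F where F: "F \<subseteq> vH p" "finite F" and S: "S = (\<Sum>h\<in>F. \<integral>w. cmod (r h w) \<partial>M)" by auto
      have "S = (\<integral>w. (\<Sum>h\<in>F. cmod (r h w)) \<partial>M)"
        unfolding S using rint by (subst Bochner_Integration.integral_sum) auto
      also have "\<dots> \<le> (\<integral>w. cmod (q w) \<partial>M)"
      proof (rule integral_mono)
        fix w assume "w \<in> space M"
        then have w: "w \<in> vilenkin p" by (simp add: space_M)
        obtain h where h: "h \<in> vH p" "\<forall>h'\<in>vH p. w \<in> vcyl p 0 (vplus p k h') \<longleftrightarrow> h' = h"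
          using coset_partition[OF k w] ..
        have "(\<Sum>h\<in>F. cmod (r h w)) = (\<Sum>h'\<in>F. if h' = h then cmod (q w) else 0)"
          using F h(2) by (intro sum.cong refl) (auto simp: r_def norm_mult indicator_def)
        also have "\<dots> \<le> cmod (q w)" using F by (simp add: sum.delta)
        finally show "(\<Sum>h\<in>F. cmod (r h w)) \<le> cmod (q w)" .
      qed (use rint q in auto)
      finally show "S \<le> (\<integral>w. cmod (q w) \<partial>M)" .
    qed
  qed simp
  then have tsm: "(\<lambda>h. \<integral>w. cmod (t h w) \<partial>M) summable_on vH p"
    using tn by (subst summable_on_cong) auto
  have tint': "\<forall>h\<in>vH p. integrable M (t h)" and rint': "\<forall>h\<in>vH p. integrable M (r h)"
    using tint rint by blast+
  note T = countable_sum_integral[OF countable_vH tint' tsm]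
  note R = countable_sum_integral[OF countable_vH rint' rsm]
  have tper: "(\<Sum>\<^sub>\<infinity>h\<in>vH p. t h w) = indicator (vcyl p 0 k) w * periodize q w" for w
    unfolding t_def periodize_def by (rule infsum_cmult_right')
  show "AE w in M. w \<in> vcyl p 0 k \<longrightarrow> (\<lambda>h. cmod (q (vplus p w h))) summable_on vH p"
    using T(1) by eventually_elim (auto simp: t_def)
  show "integrable M (\<lambda>w. indicator (vcyl p 0 k) w * periodize q w)"
    using T(2) by (simp add: tper)
  have "(\<integral>w. indicator (vcyl p 0 k) w * periodize q w \<partial>M) = (\<Sum>\<^sub>\<infinity>h\<in>vH p. \<integral>w. t h w \<partial>M)"
    using T(3) by (simp add: tper)
  also have "\<dots> = (\<Sum>\<^sub>\<infinity>h\<in>vH p. \<integral>w. r h w \<partial>M)" by (rule infsum_cong) (rule ti)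
  also have "\<dots> = (\<integral>w. (\<Sum>\<^sub>\<infinity>h\<in>vH p. r h w) \<partial>M)" by (rule R(3)[symmetric])
  also have "\<dots> = (\<integral>w. q w \<partial>M)"
  proof (rule Bochner_Integration.integral_cong[OF refl])
    fix w assume "w \<in> space M"
    then have w: "w \<in> vilenkin p" by (simp add: space_M)
    obtain h where h: "h \<in> vH p" "\<forall>h'\<in>vH p. w \<in> vcyl p 0 (vplus p k h') \<longleftrightarrow> h' = h"
      using coset_partition[OF k w] ..
    have "(\<Sum>\<^sub>\<infinity>h'\<in>vH p. r h' w) = (\<Sum>\<^sub>\<infinity>h'\<in>{h}. r h' w)"
      by (rule infsum_cong_neutral) (use h in \<open>auto simp: r_def\<close>)
    then show "(\<Sum>\<^sub>\<infinity>h'\<in>vH p. r h' w) = q w" using h by (simp add: r_def)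
  qed
  finally show "(\<integral>w. indicator (vcyl p 0 k) w * periodize q w \<partial>M) = (\<integral>w. q w \<partial>M)" .
qed

lemma AE_summable_translates:
  assumes q: "integrable M q"
  shows "AE w in M. (\<lambda>h. cmod (q (vplus p w h))) summable_on vH p"
  by (rule AE_by_cosets) (rule periodize_integral(1)[OF q])

lemma periodize_mult_char:
  assumes h: "h \<in> vH p" and w: "w \<in> vilenkin p"
  shows "periodize (\<lambda>w. vchar p w h * q w) w = vchar p w h * periodize q w"
proof -
  have "vchar p (vplus p w h') h = vchar p w h" if "h' \<in> vH p" for h'
    by (simp add: vchar_add_left[OF p w vH_vilenkin[OF that] vH_vilenkin[OF h]] vchar_vH[OF p that h])
  then have "periodize (\<lambda>w. vchar p w h * q w) w = (\<Sum>\<^sub>\<infinity>h'\<in>vH p. vchar p w h * q (vplus p w h'))"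
    unfolding periodize_def by (intro infsum_cong) simp
  then show ?thesis by (simp add: periodize_def infsum_cmult_right')
qed

end

section \<open>Reconstruction from two Bessel systems of translates\<close>

lemma summable_on_Times_section:
  fixes a :: "'h \<times> 'l \<Rightarrow> 'c :: banach"
  assumes a: "a summable_on H \<times> I" and l: "l \<in> I"
  shows "(\<lambda>h. a (h, l)) summable_on H"
proof -
  have "a summable_on (\<lambda>h. (h, l)) ` H" by (rule summable_on_subset_banach[OF a]) (use l in auto)
  then show ?thesis by (subst (asm) summable_on_reindex) (auto simp: o_def inj_on_def)
qed

lemma summable_on_Times_swap:
  fixes a :: "'h \<times> 'l \<Rightarrow> 'c :: banach"
  assumes a: "a summable_on H \<times> I"
  shows "(\<lambda>(l, h). a (h, l)) summable_on I \<times> H"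
proof -
  have "a summable_on prod.swap ` (I \<times> H)" using a by (simp only: product_swap)
  then show ?thesis by (subst (asm) summable_on_reindex) (auto simp: o_def case_prod_unfold inj_on_def prod.swap_def prod_eq_iff)
qed

lemma infsum_Times_iterated:
  fixes a :: "'h \<times> 'l \<Rightarrow> 'c :: banach"
  assumes a: "a summable_on H \<times> I"
  shows "(\<lambda>l. \<Sum>\<^sub>\<infinity>h\<in>H. a (h, l)) summable_on I"
    and "(\<Sum>\<^sub>\<infinity>l\<in>I. \<Sum>\<^sub>\<infinity>h\<in>H. a (h, l)) = infsum a (H \<times> I)"
proof -
  note sw = summable_on_Times_swap[OF a]
  show "(\<lambda>l. \<Sum>\<^sub>\<infinity>h\<in>H. a (h, l)) summable_on I" by (rule summable_on_Sigma_banach[OF sw])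
  have "(\<Sum>\<^sub>\<infinity>l\<in>I. \<Sum>\<^sub>\<infinity>h\<in>H. a (h, l)) = infsum (\<lambda>(l, h). a (h, l)) (I \<times> H)"
    by (rule infsum_Sigma'_banach[OF sw])
  also have "\<dots> = infsum a (prod.swap ` (I \<times> H))"
    by (subst infsum_reindex) (auto simp: o_def case_prod_unfold inj_on_def prod.swap_def prod_eq_iff intro!: infsum_cong)
  finally show "(\<Sum>\<^sub>\<infinity>l\<in>I. \<Sum>\<^sub>\<infinity>h\<in>H. a (h, l)) = infsum a (H \<times> I)" by (simp only: product_swap)
qed

lemma L2_bessel_reindex:
  assumes "L2_bessel M F (g ` A)" "inj_on g A"
  shows "L2_bessel M (\<lambda>a. F (g a)) A"
  using assms by (auto simp: L2_bessel_def summable_on_reindex infsum_reindex o_def)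

context vilenkin_haar
begin

text \<open>
  Parseval's identity on the compact group \<open>U\<close>, seen inside the global basis: a function living on \<open>U \<oplus> k\<close>
  has only coefficients with second index \<open>k\<close>. It is enough that one of the two factors does.
\<close>

lemma coset_Parseval:
  assumes u: "u \<in> L2 M" and v: "v \<in> L2 M" and k: "k \<in> vH p"
    and zero: "\<And>h k'. h \<in> vH p \<Longrightarrow> k' \<in> vH p \<Longrightarrow> k' \<noteq> k \<Longrightarrow> L2_inner M u (vdual p (h, k')) = 0"
  shows "((\<lambda>h. L2_inner M u (vdual p (h, k)) * cnj (L2_inner M v (vdual p (h, k)))) has_sum L2_inner M u v) (vH p)"
proof -
  let ?a = "\<lambda>j. L2_inner M u (vdual p j) * cnj (L2_inner M v (vdual p j))"
  have "(?a has_sum L2_inner M u v) J" by (rule L2_Parseval[OF vdual_L2_basis u v])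
  then have "(?a has_sum L2_inner M u v) ((\<lambda>h. (h, k)) ` vH p)"
    by (rule has_sum_cong_neutral[THEN iffD1, rotated -1]) (use k zero in auto)
  then show ?thesis by (subst (asm) has_sum_reindex) (auto simp: o_def inj_on_def)
qed

text \<open>
  The function \<open>u\<close> is the bracket of \<open>f\<close> and \<open>\<psi>\<close> restricted to a coset. Characters from \<open>H\<close> are invariant under
  \<open>H\<close>, so unfolding the periodization in the coefficients of \<open>u\<close> gives inner products over the whole group.
  Square integrability is then a consequence of square summability.
\<close>

lemma bracket_coset:
  assumes f: "f \<in> L2 M" and \<psi>: "\<psi> \<in> L2 M" and k: "k \<in> vH p"
    and sq: "(\<lambda>h. (cmod (L2_inner M f (\<lambda>w. cnj (vchar p h w) * \<psi> w)))\<^sup>2) summable_on vH p"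
  defines "u \<equiv> \<lambda>w. indicator (vcyl p 0 k) w * periodize (\<lambda>w. f w * cnj (\<psi> w)) w"
  shows "u \<in> L2 M"
    and "\<And>h. h \<in> vH p \<Longrightarrow> L2_inner M u (vdual p (h, k)) = L2_inner M f (\<lambda>w. cnj (vchar p h w) * \<psi> w)"
    and "\<And>h k'. h \<in> vH p \<Longrightarrow> k' \<in> vH p \<Longrightarrow> k' \<noteq> k \<Longrightarrow> L2_inner M u (vdual p (h, k')) = 0"
proof -
  have q: "integrable M (\<lambda>w. f w * cnj (\<psi> w))" by (rule L2_integrable_mult[OF f \<psi>])
  have uint: "integrable M u" unfolding u_def by (rule periodize_integral(2)[OF q k])
  show coeff: "L2_inner M u (vdual p (h, k)) = L2_inner M f (\<lambda>w. cnj (vchar p h w) * \<psi> w)" if h: "h \<in> vH p" for h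
  proof -
    have qh: "integrable M (\<lambda>w. vchar p w h * (f w * cnj (\<psi> w)))"
      using integrable_mult_vchar[OF q vH_vilenkin[OF h]] by (simp add: mult.commute)
    have "L2_inner M u (vdual p (h, k)) = (\<integral>w. indicator (vcyl p 0 k) w * periodize (\<lambda>w. vchar p w h * (f w * cnj (\<psi> w))) w \<partial>M)"
      unfolding L2_inner_def
    proof (rule Bochner_Integration.integral_cong[OF refl])
      fix w assume "w \<in> space M"
      then have w: "w \<in> vilenkin p" by (simp add: space_M)
      show "u w * cnj (vdual p (h, k) w) = indicator (vcyl p 0 k) w * periodize (\<lambda>w. vchar p w h * (f w * cnj (\<psi> w))) w"
        by (simp add: periodize_mult_char[OF h w] u_def vdual_def vbasis_def indicator_def)
    qed
    also have "\<dots> = (\<integral>w. vchar p w h * (f w * cnj (\<psi> w)) \<partial>M)" by (rule periodize_integral(3)[OF qh k])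
    finally show ?thesis by (simp add: L2_inner_def vchar_commute[of p h] mult_ac)
  qed
  show zero: "L2_inner M u (vdual p (h, k')) = 0" if "h \<in> vH p" "k' \<in> vH p" "k' \<noteq> k" for h k'
  proof -
    have "u w * cnj (vdual p (h, k') w) = 0" for w
      using vH_coset_unique[OF k that(2), of w] that(3) by (auto simp: u_def vdual_def vbasis_def indicator_def)
    then show ?thesis by (simp only: L2_inner_def Bochner_Integration.integral_zero)
  qed
  show "u \<in> L2 M"
  proof (rule L2_if_vdual_coeffs_square_summable)
    show "u \<in> borel_measurable M" using uint by auto
    show "integrable M (\<lambda>x. indicator (vcyl p 0 h) x * u x)" for h
      by (rule Bochner_Integration.integrable_bound[OF uint]) (use uint in \<open>auto simp: norm_mult indicator_def\<close>)
    have "(\<lambda>h. (cmod (L2_inner M u (vdual p (h, k))))\<^sup>2) summable_on vH p"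
      using sq by (subst summable_on_cong) (auto simp: coeff)
    then have "(\<lambda>j. (cmod (L2_inner M u (vdual p j)))\<^sup>2) summable_on (\<lambda>h. (h, k)) ` vH p"
      by (subst summable_on_reindex) (auto simp: o_def inj_on_def)
    then have "(\<lambda>j. (cmod (L2_inner M u (vdual p j)))\<^sup>2) summable_on J"
      by (rule summable_on_cong_neutral[THEN iffD1, rotated -1]) (use k zero in auto)
    then show "(\<lambda>j. (cmod (\<integral>x. u x * cnj (vdual p j x) \<partial>M))\<^sup>2) summable_on J" by (simp add: L2_inner_def)
  qed
qed

text \<open>
  Multiplication by a basis function confines the conjugate of \<open>\<psi>\<close> to one coset. The coefficients of the product are those of the modulated
  generators against that basis function, which is what Parseval's identity pairs with the bracket.
\<close>

lemma localized_generator: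
  assumes \<psi>: "\<psi> \<in> L2 M" and i: "h0 \<in> vH p" "k \<in> vH p"
  defines "v \<equiv> \<lambda>w. cnj (\<psi> w) * vdual p (h0, k) w"
  shows "v \<in> L2 M"
    and "\<And>h. h \<in> vH p \<Longrightarrow> L2_inner M v (vdual p (h, k))
       = cnj (L2_inner M (\<lambda>w. cnj (vchar p h w) * \<psi> w) (vdual p (h0, k)))"
    and "\<And>h k'. h \<in> vH p \<Longrightarrow> k' \<in> vH p \<Longrightarrow> k' \<noteq> k \<Longrightarrow> L2_inner M v (vdual p (h, k')) = 0"
proof -
  have "vdual p (h0, k) \<in> borel_measurable M" using i by (intro L2_measurable vdual_L2) auto
  then show "v \<in> L2 M" unfolding v_def by (intro L2_mult_bounded L2_cnj \<psi> vdual_norm_le)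
  show "L2_inner M v (vdual p (h, k))
       = cnj (L2_inner M (\<lambda>w. cnj (vchar p h w) * \<psi> w) (vdual p (h0, k)))" for h
  proof -
    have "L2_inner M v (vdual p (h, k)) = (\<integral>w. cnj (cnj (vchar p h w) * \<psi> w * cnj (vdual p (h0, k) w)) \<partial>M)"
      unfolding L2_inner_def v_def
      by (rule Bochner_Integration.integral_cong[OF refl])
         (simp add: vdual_def vbasis_def vchar_commute[of p h] indicator_def)
    then show ?thesis by (simp only: Bochner_Integration.integral_cnj L2_inner_def)
  qed
  show "L2_inner M v (vdual p (h, k')) = 0" if "h \<in> vH p" "k' \<in> vH p" "k' \<noteq> k" for h k'
  proof -
    have "v w * cnj (vdual p (h, k') w) = 0" for w
      using vH_coset_unique[OF i(2) that(2), of w] that(3) by (auto simp: v_def vdual_def vbasis_def indicator_def)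
    then show ?thesis by (simp only: L2_inner_def Bochner_Integration.integral_zero)
  qed
qed

end

lemma has_sum_norm_sq:
  assumes "((\<lambda>j. a j * cnj (a j)) has_sum L2_inner M u u) J"
  shows "((\<lambda>j. (cmod (a j))\<^sup>2) has_sum (L2_norm M u)\<^sup>2) J"
  using assms unfolding complex_norm_square[symmetric] L2_inner_self by (simp only: has_sum_of_real_iff)

locale translate_systems = vilenkin_pair p \<mu> \<mu>' for p :: nat and \<mu> \<mu>' :: "digits measure" +
  fixes I :: "'i set" and \<phi> \<phi>' :: "'i \<Rightarrow> digits \<Rightarrow> complex"
  assumes I: "countable I"
    and \<phi>: "l \<in> I \<Longrightarrow> \<phi> l \<in> L2 \<mu>" and \<phi>': "l \<in> I \<Longrightarrow> \<phi>' l \<in> L2 \<mu>"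
    and bessel: "L2_bessel \<mu> (\<lambda>(h, l). vtranslate p h (\<phi> l)) (vH p \<times> I)"
    and bessel': "L2_bessel \<mu> (\<lambda>(h, l). vtranslate p h (\<phi>' l)) (vH p \<times> I)"
begin

abbreviation \<Phi> :: "'i \<Rightarrow> digits \<Rightarrow> complex" where "\<Phi> l \<equiv> vfourier p \<mu> \<mu>' (\<phi> l)"
abbreviation \<Phi>' :: "'i \<Rightarrow> digits \<Rightarrow> complex" where "\<Phi>' l \<equiv> vfourier p \<mu> \<mu>' (\<phi>' l)"

lemma fourier_pair_\<phi>: "l \<in> I \<Longrightarrow> fourier_pair (\<phi> l) (\<Phi> l)" and fourier_pair_\<phi>': "l \<in> I \<Longrightarrow> fourier_pair (\<phi>' l) (\<Phi>' l)"
  by (simp_all add: fourier_pair_vfourier \<phi> \<phi>')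

text \<open>
  Periodic under \<open>H\<^sup>\<bottom>\<close>, which has the same digit description as \<open>H\<close> (\<open>vHperp_eq_vH\<close>).
\<close>

definition bracket :: "(digits \<Rightarrow> complex) \<Rightarrow> 'i \<Rightarrow> digits \<Rightarrow> complex" where
  "bracket g l = D.periodize (\<lambda>w. g w * cnj (\<Phi>' l w))"

text \<open>
  The operator \<open>S\<close> on the Fourier side.
\<close>

definition recon :: "(digits \<Rightarrow> complex) \<Rightarrow> digits \<Rightarrow> complex" where
  "recon g w = (\<Sum>\<^sub>\<infinity>l\<in>I. \<Phi> l w * bracket g l w)"

definition analysis :: "(digits \<Rightarrow> complex) \<Rightarrow> digits \<times> 'i \<Rightarrow> complex" where
  "analysis f = (\<lambda>(h, l). L2_inner \<mu> f (vtranslate p h (\<phi>' l)))"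

definition testcoeff :: "digits \<times> digits \<Rightarrow> digits \<times> 'i \<Rightarrow> complex" where
  "testcoeff i = (\<lambda>(h, l). L2_inner \<mu> (vtranslate p h (\<phi> l)) (vbasis p i))"

lemma analysis_square_summable:
  "f \<in> L2 \<mu> \<Longrightarrow> (\<lambda>j. (cmod (analysis f j))\<^sup>2) summable_on vH p \<times> I"
  using L2_bessel_summable[OF bessel', of f] by (simp add: analysis_def case_prod_unfold)

lemma testcoeff_square_summable:
  assumes i: "i \<in> J"
  shows "(\<lambda>j. (cmod (testcoeff i j))\<^sup>2) summable_on vH p \<times> I"
proof -
  have "(\<lambda>j. (cmod (L2_inner \<mu> (vbasis p i) (case j of (h, l) \<Rightarrow> vtranslate p h (\<phi> l))))\<^sup>2) summable_on vH p \<times> I"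
    by (rule L2_bessel_summable[OF bessel G.vbasis_L2[OF i]])
  then show ?thesis by (subst (asm) cmod_L2_inner_commute) (simp add: testcoeff_def case_prod_unfold)
qed

lemma analysis_fourier:
  assumes "fourier_pair f g" "h \<in> vH p" "l \<in> I"
  shows "analysis f (h, l) = L2_inner \<mu>' g (\<lambda>w. cnj (vchar p h w) * \<Phi>' l w)"
  unfolding analysis_def by (simp add: Plancherel[OF assms(1) fourier_pair_translate[OF assms(2) fourier_pair_\<phi>'[OF assms(3)]]])

lemma testcoeff_fourier:
  assumes "i \<in> J" "h \<in> vH p" "l \<in> I"
  shows "testcoeff i (h, l) = L2_inner \<mu>' (\<lambda>w. cnj (vchar p h w) * \<Phi> l w) (vdual p i)"
  unfolding testcoeff_def by (simp add: fourier_pair_coeff[OF fourier_pair_translate[OF assms(2) fourier_pair_\<phi>[OF assms(3)]] assms(1)])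

text \<open>
  The coefficients of \<open>recon g\<close> are those of the doubly infinite reconstruction series of \<open>f\<close>. For each \<open>l\<close>, the
  inner sum over \<open>h\<close> is an inner product of the bracket \<open>u l\<close> and the localized generator \<open>v l\<close> on one coset.
  The squared norms of both are summable over \<open>l\<close> by the two Bessel bounds, so the products are
  summable in \<open>L\<^sup>1\<close> and sum and integral may be exchanged.
\<close>

lemma recon_coeff:
  assumes fg: "fourier_pair f g" and i: "i \<in> J"
  shows "(\<lambda>j. analysis f j * testcoeff i j) summable_on vH p \<times> I"
    and "AE w in \<mu>'. w \<in> vcyl p 0 (snd i) \<longrightarrow> (\<lambda>l. cmod (\<Phi> l w * bracket g l w)) summable_on I"
    and "integrable \<mu>' (\<lambda>w. recon g w * cnj (vdual p i w))"
    and "infsum (\<lambda>j. analysis f j * testcoeff i j) (vH p \<times> I) = (\<integral>w. recon g w * cnj (vdual p i w) \<partial>\<mu>')"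
proof -
  obtain h0 k where ik: "i = (h0, k)" "h0 \<in> vH p" "k \<in> vH p" using i by auto
  have f: "f \<in> L2 \<mu>" and g: "g \<in> L2 \<mu>'" using fg by (auto simp: fourier_pair_def)
  note csq = analysis_square_summable[OF f] and dsq = testcoeff_square_summable[OF i]
  show cd: "(\<lambda>j. analysis f j * testcoeff i j) summable_on vH p \<times> I"
    by (rule abs_summable_summable) (rule l2_infsum_Cauchy_Schwarz(1)[OF csq dsq])
  define u where "u l w = indicator (vcyl p 0 k) w * bracket g l w" for l w
  define v where "v l w = cnj (\<Phi> l w) * vdual p i w" for l w
  have \<Phi>L: "\<Phi> l \<in> L2 \<mu>'" "\<Phi>' l \<in> L2 \<mu>'" if "l \<in> I" for l
    using fourier_pair_\<phi>[OF that] fourier_pair_\<phi>'[OF that] by (auto simp: fourier_pair_def)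
  have ul: "u l \<in> L2 \<mu>'"
    "h \<in> vH p \<Longrightarrow> L2_inner \<mu>' (u l) (vdual p (h, k)) = analysis f (h, l)"
    "h \<in> vH p \<Longrightarrow> k' \<in> vH p \<Longrightarrow> k' \<noteq> k \<Longrightarrow> L2_inner \<mu>' (u l) (vdual p (h, k')) = 0"
    if l: "l \<in> I" for l h k'
  proof -
    have sq: "(\<lambda>h. (cmod (L2_inner \<mu>' g (\<lambda>w. cnj (vchar p h w) * \<Phi>' l w)))\<^sup>2) summable_on vH p"
      using summable_on_Times_section[OF csq l] by (subst summable_on_cong) (auto simp: analysis_fourier[OF fg _ l])
    note B = D.bracket_coset[OF g \<Phi>L(2)[OF l] ik(3) sq, folded bracket_def u_def]
    show "u l \<in> L2 \<mu>'" using B(1) by (simp add: u_def[abs_def])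
    show "L2_inner \<mu>' (u l) (vdual p (h, k)) = analysis f (h, l)" if "h \<in> vH p"
      using B(2)[OF that] by (simp add: u_def[abs_def] analysis_fourier[OF fg that l])
    show "L2_inner \<mu>' (u l) (vdual p (h, k')) = 0" if "h \<in> vH p" "k' \<in> vH p" "k' \<noteq> k"
      using B(3)[OF that] by (simp add: u_def[abs_def])
  qed
  have vl: "v l \<in> L2 \<mu>'"
    "h \<in> vH p \<Longrightarrow> L2_inner \<mu>' (v l) (vdual p (h, k)) = cnj (testcoeff i (h, l))"
    "h \<in> vH p \<Longrightarrow> k' \<in> vH p \<Longrightarrow> k' \<noteq> k \<Longrightarrow> L2_inner \<mu>' (v l) (vdual p (h, k')) = 0"
    if l: "l \<in> I" for l h k'
  proof -
    note B = D.localized_generator[OF \<Phi>L(1)[OF l] ik(2,3)]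
    show "v l \<in> L2 \<mu>'" using B(1) by (simp add: v_def[abs_def] ik)
    show "L2_inner \<mu>' (v l) (vdual p (h, k)) = cnj (testcoeff i (h, l))" if "h \<in> vH p"
      using B(2)[OF that] by (simp add: v_def[abs_def] ik(1) testcoeff_fourier[OF i that l, unfolded ik(1)])
    show "L2_inner \<mu>' (v l) (vdual p (h, k')) = 0" if "h \<in> vH p" "k' \<in> vH p" "k' \<noteq> k"
      using B(3)[OF that] by (simp add: v_def[abs_def] ik(1))
  qed
  have uv: "((\<lambda>h. analysis f (h, l) * testcoeff i (h, l)) has_sum L2_inner \<mu>' (u l) (v l)) (vH p)" if l: "l \<in> I" for l
    using D.coset_Parseval[OF ul(1)[OF l] vl(1)[OF l] ik(3) ul(3)[OF l]]
    by (subst has_sum_cong) (auto simp: ul(2)[OF l] vl(2)[OF l])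
  have uu: "((\<lambda>h. (cmod (analysis f (h, l)))\<^sup>2) has_sum (L2_norm \<mu>' (u l))\<^sup>2) (vH p)" if l: "l \<in> I" for l
    using has_sum_norm_sq[OF D.coset_Parseval[OF ul(1)[OF l] ul(1)[OF l] ik(3) ul(3)[OF l]]]
    by (subst has_sum_cong) (auto simp: ul(2)[OF l])
  have vv: "((\<lambda>h. (cmod (testcoeff i (h, l)))\<^sup>2) has_sum (L2_norm \<mu>' (v l))\<^sup>2) (vH p)" if l: "l \<in> I" for l
    using has_sum_norm_sq[OF D.coset_Parseval[OF vl(1)[OF l] vl(1)[OF l] ik(3) vl(3)[OF l]]]
    by (subst has_sum_cong) (auto simp: vl(2)[OF l])
  have usm: "(\<lambda>l. (L2_norm \<mu>' (u l))\<^sup>2) summable_on I"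
    using infsum_Times_iterated(1)[OF csq] by (subst summable_on_cong) (auto simp: infsumI[OF uu])
  have vsm: "(\<lambda>l. (L2_norm \<mu>' (v l))\<^sup>2) summable_on I"
    using infsum_Times_iterated(1)[OF dsq] by (subst summable_on_cong) (auto simp: infsumI[OF vv])
  have "(\<lambda>l. cmod (complex_of_real (L2_norm \<mu>' (u l)) * complex_of_real (L2_norm \<mu>' (v l)))) summable_on I"
    by (rule l2_infsum_Cauchy_Schwarz(1)) (simp_all add: usm vsm)
  then have uvsm: "(\<lambda>l. L2_norm \<mu>' (u l) * L2_norm \<mu>' (v l)) summable_on I"
    by (simp add: norm_mult)
  define q where "q l w = u l w * cnj (v l w)" for l w
  \<comment> \<open>The conjugated basis function contains the indicator of the coset, which absorbs the one in \<open>u\<close>.\<close>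
  have q_eq: "q l w = \<Phi> l w * bracket g l w * cnj (vdual p i w)" for l w
    by (simp add: q_def u_def v_def ik(1) vdual_def vbasis_def indicator_def)
  have qint: "\<forall>l\<in>I. integrable \<mu>' (q l)"
    unfolding q_def[abs_def] using L2_integrable_mult ul(1) vl(1) by blast
  have qsm: "(\<lambda>l. \<integral>w. cmod (q l w) \<partial>\<mu>') summable_on I"
  proof (rule summable_on_comparison_test[OF uvsm])
    fix l assume l: "l \<in> I"
    show "(\<integral>w. cmod (q l w) \<partial>\<mu>') \<le> L2_norm \<mu>' (u l) * L2_norm \<mu>' (v l)"
      using L2_Cauchy_Schwarz_abs[OF ul(1)[OF l] vl(1)[OF l]] by (simp add: q_def norm_mult)
  qed simp
  note Q = D.countable_sum_integral[OF I qint qsm]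
  have recon_q: "(\<Sum>\<^sub>\<infinity>l\<in>I. q l w) = recon g w * cnj (vdual p i w)" for w
    unfolding q_eq recon_def by (rule infsum_cmult_left')
  show "AE w in \<mu>'. w \<in> vcyl p 0 (snd i) \<longrightarrow> (\<lambda>l. cmod (\<Phi> l w * bracket g l w)) summable_on I"
    using Q(1)
  proof eventually_elim
    case (elim w)
    then show ?case by (auto simp: q_eq ik(1) vdual_def vbasis_def norm_mult vchar_norm)
  qed
  show "integrable \<mu>' (\<lambda>w. recon g w * cnj (vdual p i w))" using Q(2) by (simp only: recon_q)
  have "infsum (\<lambda>j. analysis f j * testcoeff i j) (vH p \<times> I)
      = (\<Sum>\<^sub>\<infinity>l\<in>I. \<Sum>\<^sub>\<infinity>h\<in>vH p. analysis f (h, l) * testcoeff i (h, l))"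
    by (rule infsum_Times_iterated(2)[OF cd, symmetric])
  also have "\<dots> = (\<Sum>\<^sub>\<infinity>l\<in>I. \<integral>w. q l w \<partial>\<mu>')"
    by (rule infsum_cong) (simp add: infsumI[OF uv] L2_inner_def q_def)
  also have "\<dots> = (\<integral>w. recon g w * cnj (vdual p i w) \<partial>\<mu>')"
    using Q(3) by (simp only: recon_q)
  finally show "infsum (\<lambda>j. analysis f j * testcoeff i j) (vH p \<times> I) = (\<integral>w. recon g w * cnj (vdual p i w) \<partial>\<mu>')" .
qed

lemma AE_summable_recon:
  assumes fg: "fourier_pair f g"
  shows "AE w in \<mu>'. (\<lambda>l. cmod (\<Phi> l w * bracket g l w)) summable_on I"
proof (rule D.AE_by_cosets)
  fix k assume k: "k \<in> vH p"
  show "AE w in \<mu>'. w \<in> vcyl p 0 k \<longrightarrow> (\<lambda>l. cmod (\<Phi> l w * bracket g l w)) summable_on I"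
    using recon_coeff(2)[OF fg, of "(k, k)"] k by simp
qed

text \<open>
  Equality almost everywhere is equality of coefficients, by totality among locally integrable functions; \<open>recon g\<close>
  is not known to be square integrable at this point.
\<close>

lemma recon_eq_iff:
  assumes fg: "fourier_pair f g"
  shows "(AE w in \<mu>'. recon g w = g w) \<longleftrightarrow>
    (\<forall>i\<in>J. infsum (\<lambda>j. analysis f j * testcoeff i j) (vH p \<times> I) = L2_inner \<mu> f (vbasis p i))"
proof
  have g: "g \<in> L2 \<mu>'" using fg by (simp add: fourier_pair_def)
  note [measurable] = L2_measurable[OF g]
  {
    assume eq: "AE w in \<mu>'. recon g w = g w"
    show "\<forall>i\<in>J. infsum (\<lambda>j. analysis f j * testcoeff i j) (vH p \<times> I) = L2_inner \<mu> f (vbasis p i)"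
    proof
      fix i assume i: "i \<in> J"
      have "(\<integral>w. recon g w * cnj (vdual p i w) \<partial>\<mu>') = (\<integral>w. g w * cnj (vdual p i w) \<partial>\<mu>')"
      proof (rule integral_cong_AE)
        show "(\<lambda>w. recon g w * cnj (vdual p i w)) \<in> borel_measurable \<mu>'"
          using recon_coeff(3)[OF fg i] by (rule borel_measurable_integrable)
        show "(\<lambda>w. g w * cnj (vdual p i w)) \<in> borel_measurable \<mu>'"
          using L2_integrable_mult[OF g D.vdual_L2[OF i]] by (rule borel_measurable_integrable)
        show "AE w in \<mu>'. recon g w * cnj (vdual p i w) = g w * cnj (vdual p i w)"
          using eq by eventually_elim simp
      qed
      then show "infsum (\<lambda>j. analysis f j * testcoeff i j) (vH p \<times> I) = L2_inner \<mu> f (vbasis p i)"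
        using recon_coeff(4)[OF fg i] fourier_pair_coeff[OF fg i] by (simp add: L2_inner_def)
    qed
  next
    assume eq: "\<forall>i\<in>J. infsum (\<lambda>j. analysis f j * testcoeff i j) (vH p \<times> I) = L2_inner \<mu> f (vbasis p i)"
    have "AE w in \<mu>'. recon g w - g w = 0"
    proof (rule D.vdual_total)
      fix k assume k: "k \<in> vH p"
      \<comment> \<open>The dual basis function with first index 0 is the bare indicator of the coset, so local integrability is a special case of \<open>recon_coeff\<close>.\<close>
      have z: "(\<lambda>_. 0) \<in> vH p" using G.p by (auto simp: vH_def vilenkin_def)
      have "integrable \<mu>' (\<lambda>w. recon g w * cnj (vdual p ((\<lambda>_. 0), k) w))"
        by (rule recon_coeff(3)[OF fg]) (use z k in auto)
      then have "integrable \<mu>' (\<lambda>w. indicator (vcyl p 0 k) w * recon g w)"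
        by (simp add: vdual_def vbasis_def vchar_def mult.commute)
      then show "integrable \<mu>' (\<lambda>w. indicator (vcyl p 0 k) w * (recon g w - g w))"
        using D.L2_locally_integrable[OF g k] by (simp add: right_diff_distrib)
    next
      fix i assume i: "i \<in> J"
      have "(\<integral>w. (recon g w - g w) * cnj (vdual p i w) \<partial>\<mu>')
          = (\<integral>w. recon g w * cnj (vdual p i w) \<partial>\<mu>') - L2_inner \<mu>' g (vdual p i)"
        unfolding L2_inner_def left_diff_distrib
        by (intro Bochner_Integration.integral_diff recon_coeff(3)[OF fg i] L2_integrable_mult g D.vdual_L2 i)
      then show "(\<integral>w. (recon g w - g w) * cnj (vdual p i w) \<partial>\<mu>') = 0"
        using recon_coeff(4)[OF fg i] fourier_pair_coeff[OF fg i] bspec[OF eq i] by simp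
    qed
    then show "AE w in \<mu>'. recon g w = g w" by simp
  }
qed

text \<open>
  \<open>S\<close> commutes with translations: the character is constant along \<open>H\<^sup>\<bottom>\<close> and leaves the bracket as a factor.
\<close>

lemma recon_translate:
  assumes k: "k \<in> vH p" and w: "w \<in> vilenkin p"
  shows "recon (\<lambda>w. cnj (vchar p k w) * g w) w = cnj (vchar p k w) * recon g w"
proof -
  have br: "bracket (\<lambda>w. cnj (vchar p k w) * g w) l w = cnj (vchar p k w) * bracket g l w" for l
  proof -
    have "cnj (vchar p k (vplus p w h)) = cnj (vchar p k w)" if "h \<in> vH p" for h
      by (simp add: vchar_add_right[OF G.p w vH_vilenkin[OF that] vH_vilenkin[OF k]] vchar_vH[OF G.p k that])
    then have "bracket (\<lambda>w. cnj (vchar p k w) * g w) l w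
       = (\<Sum>\<^sub>\<infinity>h\<in>vH p. cnj (vchar p k w) * (g (vplus p w h) * cnj (\<Phi>' l (vplus p w h))))"
      unfolding bracket_def D.periodize_def by (intro infsum_cong) (simp add: mult_ac)
    then show ?thesis by (simp add: bracket_def D.periodize_def infsum_cmult_right')
  qed
  show ?thesis unfolding recon_def br infsum_cmult_right'[symmetric] by (simp add: mult_ac)
qed

lemma vtranslate_family_L2: "h \<in> vH p \<Longrightarrow> l \<in> I \<Longrightarrow> vtranslate p h (\<phi> l) \<in> L2 \<mu>"
  by (rule vtranslate_L2[OF vH_vilenkin \<phi>])

lemma \<phi>_in_closed_span:
  assumes n: "n \<in> I"
  shows "\<phi> n \<in> L2_closed_span \<mu> (\<lambda>(h, l). vtranslate p h (\<phi> l)) (vH p \<times> I)"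
  unfolding L2_closed_span_def
proof (intro CollectI conjI allI impI \<phi> n)
  fix e :: real assume e: "e > 0"
  let ?z = "(\<lambda>_. 0) :: digits"
  have z: "?z \<in> vH p" using G.p by (auto simp: vH_def vilenkin_def)
  let ?g = "\<lambda>x. \<Sum>j\<in>{(?z, n)}. 1 * (case j of (h, l) \<Rightarrow> vtranslate p h (\<phi> l)) x"
  show "\<exists>g\<in>L2_span (\<lambda>(h, l). vtranslate p h (\<phi> l)) (vH p \<times> I). L2_norm \<mu> (\<lambda>x. \<phi> n x - g x) < e"
  proof (rule bexI)
    show "?g \<in> L2_span (\<lambda>(h, l). vtranslate p h (\<phi> l)) (vH p \<times> I)"
      unfolding L2_span_def using z n by (intro CollectI exI[of _ "{(?z, n)}"] exI[of _ "\<lambda>_. 1"]) auto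
    have "L2_norm \<mu> (\<lambda>x. \<phi> n x - ?g x) = L2_norm \<mu> (\<lambda>x. 0)"
    \<comment> \<open>Translation by zero is the identity on the group only, not on arbitrary digit functions.\<close>
    proof (rule L2_norm_cong_space)
      fix x assume "x \<in> space \<mu>"
      then have "vminus p x ?z = x" by (auto simp: fun_eq_iff vminus_apply G.space_M vdigit_less)
      then show "\<phi> n x - ?g x = 0" by (simp add: vtranslate_def)
    qed
    also have "\<dots> < e" using e by (simp add: L2_norm_def)
    finally show "L2_norm \<mu> (\<lambda>x. \<phi> n x - ?g x) < e" .
  qed
qed

lemma weak_recon_of_expansion:
  assumes f: "f \<in> L2 \<mu>" and i: "i \<in> J"
    and inner: "\<forall>l\<in>I. L2_has_sum \<mu> (\<lambda>h x. L2_inner \<mu> f (vtranslate p h (\<phi>' l)) * vtranslate p h (\<phi> l) x) (vH p) (g l)"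
    and outer: "L2_has_sum \<mu> g I f"
  shows "infsum (\<lambda>j. analysis f j * testcoeff i j) (vH p \<times> I) = L2_inner \<mu> f (vbasis p i)"
proof -
  have e: "vbasis p i \<in> L2 \<mu>" by (rule G.vbasis_L2[OF i])
  have cd: "(\<lambda>j. analysis f j * testcoeff i j) summable_on vH p \<times> I"
    by (rule abs_summable_summable)
       (rule l2_infsum_Cauchy_Schwarz(1)[OF analysis_square_summable[OF f] testcoeff_square_summable[OF i]])
  have "(\<Sum>\<^sub>\<infinity>h\<in>vH p. analysis f (h, l) * testcoeff i (h, l)) = L2_inner \<mu> (g l) (vbasis p i)" if l: "l \<in> I" for l
    using L2_has_sum_inner[OF bspec[OF inner l] e]
    by (intro infsumI) (simp add: L2_inner_cmult_left analysis_def testcoeff_def)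
  then have "(\<Sum>\<^sub>\<infinity>l\<in>I. \<Sum>\<^sub>\<infinity>h\<in>vH p. analysis f (h, l) * testcoeff i (h, l)) = (\<Sum>\<^sub>\<infinity>l\<in>I. L2_inner \<mu> (g l) (vbasis p i))"
    by (rule infsum_cong)
  also have "\<dots> = L2_inner \<mu> f (vbasis p i)" by (rule infsumI[OF L2_has_sum_inner[OF outer e]])
  finally show ?thesis using infsum_Times_iterated(2)[OF cd] by simp
qed

text \<open>
  Both sides are bounded linear functionals of \<open>f\<close>; their difference \<open>\<Lambda>\<close> vanishes on the generators,
  hence on the closed span.
\<close>

lemma weak_recon_closed_span:
  assumes gen: "\<And>k n. k \<in> vH p \<Longrightarrow> n \<in> I \<Longrightarrow>
      infsum (\<lambda>j. analysis (vtranslate p k (\<phi> n)) j * testcoeff i j) (vH p \<times> I)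
        = L2_inner \<mu> (vtranslate p k (\<phi> n)) (vbasis p i)"
    and i: "i \<in> J" and f: "f \<in> L2_closed_span \<mu> (\<lambda>(h, l). vtranslate p h (\<phi> l)) (vH p \<times> I)"
  shows "infsum (\<lambda>j. analysis f j * testcoeff i j) (vH p \<times> I) = L2_inner \<mu> f (vbasis p i)"
proof -
  let ?J = "vH p \<times> I" and ?F = "\<lambda>(h, l). vtranslate p h (\<phi> l)" and ?e = "vbasis p i"
  have e: "?e \<in> L2 \<mu>" by (rule G.vbasis_L2[OF i])
  note dsq = testcoeff_square_summable[OF i]
  have sm: "(\<lambda>j. analysis g j * testcoeff i j) summable_on ?J" if "g \<in> L2 \<mu>" for g
    by (rule abs_summable_summable)
       (rule l2_infsum_Cauchy_Schwarz(1)[OF analysis_square_summable[OF that] dsq])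
  define \<Lambda> where "\<Lambda> g = infsum (\<lambda>j. analysis g j * testcoeff i j) ?J - L2_inner \<mu> g ?e" for g
  have FL: "?F j \<in> L2 \<mu>" if "j \<in> ?J" for j using that vtranslate_family_L2 by auto
  have F'L: "vtranslate p h (\<phi>' l) \<in> L2 \<mu>" if "h \<in> vH p" "l \<in> I" for h l
    by (rule vtranslate_L2[OF vH_vilenkin \<phi>']) (fact that)+
  obtain B where B: "B > 0" "\<forall>g\<in>L2 \<mu>. (\<Sum>\<^sub>\<infinity>j\<in>?J. (cmod (analysis g j))\<^sup>2) \<le> B * (L2_norm \<mu> g)\<^sup>2"
    using bessel' unfolding L2_bessel_def analysis_def case_prod_unfold by blast
  define C where "C = sqrt B * sqrt (\<Sum>\<^sub>\<infinity>j\<in>?J. (cmod (testcoeff i j))\<^sup>2) + L2_norm \<mu> ?e"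
  have C0: "C \<ge> 0" using B(1) by (auto simp: C_def infsum_nonneg intro!: add_nonneg_nonneg)
  have bound: "cmod (\<Lambda> g) \<le> C * L2_norm \<mu> g" if g: "g \<in> L2 \<mu>" for g
  proof -
    have "cmod (infsum (\<lambda>j. analysis g j * testcoeff i j) ?J)
      \<le> sqrt (\<Sum>\<^sub>\<infinity>j\<in>?J. (cmod (analysis g j))\<^sup>2) * sqrt (\<Sum>\<^sub>\<infinity>j\<in>?J. (cmod (testcoeff i j))\<^sup>2)"
      by (rule l2_infsum_Cauchy_Schwarz(2)[OF analysis_square_summable[OF g] dsq])
    also have "\<dots> \<le> sqrt (B * (L2_norm \<mu> g)\<^sup>2) * sqrt (\<Sum>\<^sub>\<infinity>j\<in>?J. (cmod (testcoeff i j))\<^sup>2)"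
      using B(2) g by (intro mult_right_mono real_sqrt_le_mono) (auto simp: infsum_nonneg)
    finally have "cmod (infsum (\<lambda>j. analysis g j * testcoeff i j) ?J)
      \<le> sqrt B * sqrt (\<Sum>\<^sub>\<infinity>j\<in>?J. (cmod (testcoeff i j))\<^sup>2) * L2_norm \<mu> g"
      by (simp add: real_sqrt_mult mult_ac)
    moreover have "cmod (L2_inner \<mu> g ?e) \<le> L2_norm \<mu> ?e * L2_norm \<mu> g"
      using L2_Cauchy_Schwarz[OF g e] by (simp add: mult.commute)
    ultimately show ?thesis unfolding \<Lambda>_def C_def
      using norm_triangle_ineq4[of "infsum (\<lambda>j. analysis g j * testcoeff i j) ?J" "L2_inner \<mu> g ?e"]
      by (simp add: distrib_right)
  qed
  have add: "\<Lambda> (\<lambda>x. a x + b x) = \<Lambda> a + \<Lambda> b" if a: "a \<in> L2 \<mu>" and b: "b \<in> L2 \<mu>" for a b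
  proof -
    have "infsum (\<lambda>j. analysis (\<lambda>x. a x + b x) j * testcoeff i j) ?J
       = infsum (\<lambda>j. analysis a j * testcoeff i j + analysis b j * testcoeff i j) ?J"
      by (rule infsum_cong)
         (auto simp: analysis_def L2_inner_add_left[OF a b F'L] distrib_right)
    also have "\<dots> = infsum (\<lambda>j. analysis a j * testcoeff i j) ?J + infsum (\<lambda>j. analysis b j * testcoeff i j) ?J"
      by (rule infsum_add[OF sm[OF a] sm[OF b]])
    finally show ?thesis by (simp add: \<Lambda>_def L2_inner_add_left[OF a b e])
  qed
  have cmult: "\<Lambda> (\<lambda>x. c * a x) = c * \<Lambda> a" for a c
  proof -
    have "infsum (\<lambda>j. analysis (\<lambda>x. c * a x) j * testcoeff i j) ?J = infsum (\<lambda>j. c * (analysis a j * testcoeff i j)) ?J"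
      by (rule infsum_cong) (auto simp: analysis_def L2_inner_cmult_left)
    then show ?thesis by (simp add: \<Lambda>_def L2_inner_cmult_left infsum_cmult_right' right_diff_distrib)
  qed
  have zero: "\<Lambda> (\<lambda>x. 0) = 0" using cmult[of 0 "\<lambda>x. 0"] by simp
  have span: "\<Lambda> (\<lambda>x. \<Sum>j\<in>E. c j * ?F j x) = 0" if "finite E" "E \<subseteq> ?J" for E c
    using that
  proof (induction E rule: finite_induct)
    case empty show ?case by (simp add: zero)
  next
    case (insert j E)
    obtain k n where kn: "j = (k, n)" "k \<in> vH p" "n \<in> I" using insert.prems by auto
    have g0: "\<Lambda> (?F j) = 0" using gen[OF kn(2,3)] by (simp add: \<Lambda>_def kn(1))
    have "\<Lambda> (\<lambda>x. c j * ?F j x + (\<Sum>j\<in>E. c j * ?F j x)) = \<Lambda> (\<lambda>x. c j * ?F j x) + \<Lambda> (\<lambda>x. \<Sum>j\<in>E. c j * ?F j x)"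
      using insert.prems by (intro add L2_cmult L2_lincomb FL) auto
    then show ?case using insert cmult[of "c j" "?F j"] g0 by simp
  qed
  have fL: "f \<in> L2 \<mu>" using f by (simp add: L2_closed_span_def)
  have "cmod (\<Lambda> f) \<le> C * e'" if e': "e' > 0" for e'
  proof -
    obtain E c where E: "finite E" "E \<subseteq> ?J" "L2_norm \<mu> (\<lambda>x. f x - (\<Sum>j\<in>E. c j * ?F j x)) < e'"
      using f e' unfolding L2_closed_span_def L2_span_def by blast
    let ?g = "\<lambda>x. \<Sum>j\<in>E. c j * ?F j x"
    have gL: "?g \<in> L2 \<mu>" using E(2) by (intro L2_lincomb FL) auto
    have "\<Lambda> f = \<Lambda> (\<lambda>x. f x - ?g x)"
      using add[OF L2_diff[OF fL gL] gL] span[OF E(1,2), of c] by simp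
    also have "cmod \<dots> \<le> C * L2_norm \<mu> (\<lambda>x. f x - ?g x)" by (rule bound[OF L2_diff[OF fL gL]])
    also have "\<dots> \<le> C * e'" using E(3) C0 by (intro mult_left_mono) auto
    finally show ?thesis .
  qed
  then have "cmod (\<Lambda> f) \<le> 0 + e'" if "e' > 0" for e'
  proof -
    have pos: "e' / (C + 1) > 0" using that C0 by simp
    have "cmod (\<Lambda> f) \<le> C * (e' / (C + 1))" by (rule \<open>\<And>e'. e' > 0 \<Longrightarrow> cmod (\<Lambda> f) \<le> C * e'\<close>[OF pos])
    also have "\<dots> \<le> e'" using C0 that by (simp add: field_simps)
    finally show ?thesis by simp
  qed
  then have "cmod (\<Lambda> f) \<le> 0" by (rule field_le_epsilon)
  then show ?thesis by (simp add: \<Lambda>_def)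
qed

text \<open>
  The coefficients are square summable, so the full series converges; testing against the basis identifies its sum
  as \<open>f\<close>. Its sections over single \<open>l\<close> converge for the same reason and may be summed afterwards.
\<close>

lemma expansion_of_weak_recon:
  assumes f: "f \<in> L2 \<mu>"
    and weak: "\<And>i. i \<in> J \<Longrightarrow> infsum (\<lambda>j. analysis f j * testcoeff i j) (vH p \<times> I) = L2_inner \<mu> f (vbasis p i)"
  shows "\<exists>g. (\<forall>l\<in>I. L2_has_sum \<mu>
      (\<lambda>h x. L2_inner \<mu> f (vtranslate p h (\<phi>' l)) * vtranslate p h (\<phi> l) x) (vH p) (g l)) \<and> L2_has_sum \<mu> g I f"
proof -
  let ?F = "\<lambda>(h, l). vtranslate p h (\<phi> l)"
  note csq = analysis_square_summable[OF f]
  obtain s where s: "L2_has_sum \<mu> (\<lambda>j x. analysis f j * ?F j x) (vH p \<times> I) s"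
    using L2_bessel_synthesis[OF bessel csq] by blast
  have sL: "s \<in> L2 \<mu>" using s by (simp add: L2_has_sum_def)
  have "L2_inner \<mu> (\<lambda>x. s x - f x) (vbasis p i) = 0" if i: "i \<in> J" for i
  proof -
    have "((\<lambda>j. analysis f j * testcoeff i j) has_sum L2_inner \<mu> s (vbasis p i)) (vH p \<times> I)"
      using L2_has_sum_inner[OF s G.vbasis_L2[OF i]]
      by (simp add: L2_inner_cmult_left testcoeff_def case_prod_unfold)
    from infsumI[OF this] show ?thesis
      using weak[OF i] by (simp add: L2_inner_diff_left[OF sL f G.vbasis_L2[OF i]])
  qed
  then have "AE x in \<mu>. s x - f x = 0"
    using G.vbasis_L2_basis L2_diff[OF sL f] unfolding L2_basis_def by blast
  then have sf: "L2_has_sum \<mu> (\<lambda>j x. analysis f j * ?F j x) (vH p \<times> I) f"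
    by (intro L2_has_sum_cong_AE[OF s f]) simp
  have "\<exists>t. L2_has_sum \<mu> (\<lambda>h x. analysis f (h, l) * ?F (h, l) x) (vH p) t" if l: "l \<in> I" for l
  proof (rule L2_bessel_synthesis)
    have "L2_bessel \<mu> ?F ((\<lambda>h. (h, l)) ` vH p)"
      by (rule L2_bessel_subset[OF bessel]) (use l in auto)
    then show "L2_bessel \<mu> (\<lambda>h. ?F (h, l)) (vH p)"
      by (rule L2_bessel_reindex) (simp add: inj_on_def)
    show "(\<lambda>h. (cmod (analysis f (h, l)))\<^sup>2) summable_on vH p"
      by (rule summable_on_Times_section[OF csq l])
  qed
  then have "\<forall>l\<in>I. \<exists>t. L2_has_sum \<mu> (\<lambda>h x. analysis f (h, l) * ?F (h, l) x) (vH p) t" by blast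
  from bchoice[OF this] obtain g where
    g: "\<forall>l\<in>I. L2_has_sum \<mu> (\<lambda>h x. analysis f (h, l) * ?F (h, l) x) (vH p) (g l)" by blast
  have "L2_has_sum \<mu> g I f"
    by (rule L2_has_sum_iterated[OF bessel csq sf]) (use g in blast)
  with g show ?thesis by (intro exI[of _ g] conjI) (simp_all add: analysis_def)
qed

text \<open>
  The summability clauses hold almost everywhere in any case, so only the value of the sum carries information.
\<close>

lemma bracket_identity_iff_recon:
  assumes n: "n \<in> I"
  shows "(AE w in \<mu>'.
        (\<forall>l\<in>I. (\<lambda>h. \<Phi> n (vplus p w h) * cnj (\<Phi>' l (vplus p w h))) summable_on vHperp p) \<and>
        ((\<lambda>l. \<Phi> l w * (\<Sum>\<^sub>\<infinity>h\<in>vHperp p. \<Phi> n (vplus p w h) * cnj (\<Phi>' l (vplus p w h)))) has_sum \<Phi> n w) I)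
     \<longleftrightarrow> (AE w in \<mu>'. recon (\<Phi> n) w = \<Phi> n w)"
proof -
  have br: "bracket (\<Phi> n) l w = (\<Sum>\<^sub>\<infinity>h\<in>vHperp p. \<Phi> n (vplus p w h) * cnj (\<Phi>' l (vplus p w h)))" for l w
    by (simp add: bracket_def D.periodize_def vHperp_eq_vH)
  have \<Phi>L: "\<Phi> l \<in> L2 \<mu>'" "\<Phi>' l \<in> L2 \<mu>'" if "l \<in> I" for l
    using fourier_pair_\<phi>[OF that] fourier_pair_\<phi>'[OF that] by (auto simp: fourier_pair_def)
  have A: "AE w in \<mu>'. \<forall>l\<in>I. (\<lambda>h. \<Phi> n (vplus p w h) * cnj (\<Phi>' l (vplus p w h))) summable_on vHperp p"
    unfolding AE_ball_countable[OF I] vHperp_eq_vH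
  proof
    fix l assume l: "l \<in> I"
    have "AE w in \<mu>'. (\<lambda>h. cmod (\<Phi> n (vplus p w h) * cnj (\<Phi>' l (vplus p w h)))) summable_on vH p"
      by (rule D.AE_summable_translates[OF L2_integrable_mult[OF \<Phi>L(1)[OF n] \<Phi>L(2)[OF l]]])
    then show "AE w in \<mu>'. (\<lambda>h. \<Phi> n (vplus p w h) * cnj (\<Phi>' l (vplus p w h))) summable_on vH p"
      by eventually_elim (rule abs_summable_summable)
  qed
  have S: "AE w in \<mu>'. (\<lambda>l. \<Phi> l w * bracket (\<Phi> n) l w) summable_on I"
    using AE_summable_recon[OF fourier_pair_\<phi>[OF n]] by eventually_elim (rule abs_summable_summable)
  show ?thesis unfolding br[symmetric]
  proof
    assume "AE w in \<mu>'. (\<forall>l\<in>I. (\<lambda>h. \<Phi> n (vplus p w h) * cnj (\<Phi>' l (vplus p w h))) summable_on vHperp p)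
       \<and> ((\<lambda>l. \<Phi> l w * bracket (\<Phi> n) l w) has_sum \<Phi> n w) I"
    then show "AE w in \<mu>'. recon (\<Phi> n) w = \<Phi> n w"
      by eventually_elim (simp add: recon_def infsumI)
  next
    assume "AE w in \<mu>'. recon (\<Phi> n) w = \<Phi> n w"
    then show "AE w in \<mu>'. (\<forall>l\<in>I. (\<lambda>h. \<Phi> n (vplus p w h) * cnj (\<Phi>' l (vplus p w h))) summable_on vHperp p)
       \<and> ((\<lambda>l. \<Phi> l w * bracket (\<Phi> n) l w) has_sum \<Phi> n w) I"
      using A S
    proof eventually_elim
      case (elim w)
      from has_sum_infsum[OF elim(3)] elim(1,2) show ?case by (simp add: recon_def)
    qed
  qed
qed

lemma weak_recon_generators:
  assumes ii: "AE w in \<mu>'. recon (\<Phi> n) w = \<Phi> n w" and n: "n \<in> I" and k: "k \<in> vH p" and i: "i \<in> J"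
  shows "infsum (\<lambda>j. analysis (vtranslate p k (\<phi> n)) j * testcoeff i j) (vH p \<times> I)
        = L2_inner \<mu> (vtranslate p k (\<phi> n)) (vbasis p i)"
proof -
  have "AE w in \<mu>'. recon (\<lambda>w. cnj (vchar p k w) * \<Phi> n w) w = cnj (vchar p k w) * \<Phi> n w"
    using ii AE_space by eventually_elim (simp add: recon_translate[OF k] D.space_M)
  then show ?thesis
    using recon_eq_iff[OF fourier_pair_translate[OF k fourier_pair_\<phi>[OF n]]] i by blast
qed

end

theorem theorem4p4:
  fixes p :: nat
    and \<mu> \<mu>' :: "digits measure"
    and I :: "'i set"
    and \<phi> \<phi>' :: "'i \<Rightarrow> digits \<Rightarrow> complex"
    and W :: "(digits \<Rightarrow> complex) set"
  assumes p: "p \<ge> 2"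
    and haar: "vhaar p \<mu>"
    and haar_dual: "vhaar p \<mu>'"
    and I: "countable I"
    and \<phi>: "\<forall>l\<in>I. \<phi> l \<in> L2 \<mu>"
    and \<phi>': "\<forall>l\<in>I. \<phi>' l \<in> L2 \<mu>"
    and bessel: "L2_bessel \<mu> (\<lambda>(h, l). vtranslate p h (\<phi> l)) (vH p \<times> I)"
    and bessel': "L2_bessel \<mu> (\<lambda>(h, l). vtranslate p h (\<phi>' l)) (vH p \<times> I)"
    and W: "W = L2_closed_span \<mu> (\<lambda>(h, l). vtranslate p h (\<phi> l)) (vH p \<times> I)"
  shows
    "(\<forall>f\<in>W. \<exists>g.
        (\<forall>l\<in>I. L2_has_sum \<mu>
           (\<lambda>h x. L2_inner \<mu> f (vtranslate p h (\<phi>' l)) * vtranslate p h (\<phi> l) x) (vH p) (g l)) \<and>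
        L2_has_sum \<mu> g I f)
     \<longleftrightarrow>
     (\<forall>n\<in>I. AE w in \<mu>'.
        (\<forall>l\<in>I. (\<lambda>h. vfourier p \<mu> \<mu>' (\<phi> n) (vplus p w h) *
                      cnj (vfourier p \<mu> \<mu>' (\<phi>' l) (vplus p w h))) summable_on vHperp p) \<and>
        ((\<lambda>l. vfourier p \<mu> \<mu>' (\<phi> l) w *
               (\<Sum>\<^sub>\<infinity>h\<in>vHperp p. vfourier p \<mu> \<mu>' (\<phi> n) (vplus p w h) *
                              cnj (vfourier p \<mu> \<mu>' (\<phi>' l) (vplus p w h))))
          has_sum vfourier p \<mu> \<mu>' (\<phi> n) w) I)"
    (is "?i \<longleftrightarrow> ?ii")
proof -
  interpret translate_systems p \<mu> \<mu>' I \<phi> \<phi>'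
    by unfold_locales (use p haar haar_dual I \<phi> \<phi>' bessel bessel' in auto)
  have ii: "?ii \<longleftrightarrow> (\<forall>n\<in>I. AE w in \<mu>'. recon (\<Phi> n) w = \<Phi> n w)"
    by (intro ball_cong refl bracket_identity_iff_recon)
  show ?thesis unfolding ii
  proof
    assume i: ?i
    show "\<forall>n\<in>I. AE w in \<mu>'. recon (\<Phi> n) w = \<Phi> n w"
    proof
      fix n assume n: "n \<in> I"
      then have "\<phi> n \<in> W" unfolding W by (rule \<phi>_in_closed_span)
      then obtain g where "\<forall>l\<in>I. L2_has_sum \<mu>
           (\<lambda>h x. L2_inner \<mu> (\<phi> n) (vtranslate p h (\<phi>' l)) * vtranslate p h (\<phi> l) x) (vH p) (g l)"
          "L2_has_sum \<mu> g I (\<phi> n)"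
        using i by blast
      then show "AE w in \<mu>'. recon (\<Phi> n) w = \<Phi> n w"
        using \<phi> n unfolding recon_eq_iff[OF fourier_pair_\<phi>[OF n]] by (blast intro: weak_recon_of_expansion)
    qed
  next
    assume ii': "\<forall>n\<in>I. AE w in \<mu>'. recon (\<Phi> n) w = \<Phi> n w"
    show ?i
    proof
      fix f assume f: "f \<in> W"
      show "\<exists>g. (\<forall>l\<in>I. L2_has_sum \<mu>
           (\<lambda>h x. L2_inner \<mu> f (vtranslate p h (\<phi>' l)) * vtranslate p h (\<phi> l) x) (vH p) (g l)) \<and>
          L2_has_sum \<mu> g I f"
      proof (rule expansion_of_weak_recon)
        show "f \<in> L2 \<mu>" using f by (simp add: W L2_closed_span_def)
        fix i assume i: "i \<in> vH p \<times> vH p"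
        show "infsum (\<lambda>j. analysis f j * testcoeff i j) (vH p \<times> I) = L2_inner \<mu> f (vbasis p i)"
        proof (rule weak_recon_closed_span[OF _ i f[unfolded W]])
          fix k n assume "k \<in> vH p" "n \<in> I"
          then show "infsum (\<lambda>j. analysis (vtranslate p k (\<phi> n)) j * testcoeff i j) (vH p \<times> I)
             = L2_inner \<mu> (vtranslate p k (\<phi> n)) (vbasis p i)"
            using ii' i by (intro weak_recon_generators) auto
        qed
      qed
    qed
  qed
qed

end
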